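(* Assume (H1)–(H6). Then for $\mathbb A_n\in\{\mathbb G_n,\mathbb T_n\}$, $$\sqrt{|\mathbb A_n|h_n^{3d}}\,\big(\widehat{\mathcal P}_{\mathbb A_n}(x,x_0,x_1)-\mathcal P(x,x_0,x_1)\big)\xrightarrow[n\to\infty]{(d)}G,$$ where $G$ is a centered Gaussian random variable with variance $\|K_0\|_2^6\,\mathcal P(x,x_0,x_1)/\mu(x)$.
   Context: Let $d\ge1$, $S=\mathbb R^d$ with Borel $\sigma$-field. Binary tree: $\mathbb G_0=\mathbb T_0=\{\emptyset\}$, $\mathbb G_k=\{0,1\}^k$ (so $|\mathbb G_k|=2^k$), $\mathbb T_k=\bigcup_{r\le k}\mathbb G_r$, $\mathbb T=\bigcup_{r\ge0}\mathbb G_r$; $ij$ is the concatenation of words $i,j$ and $iA=\{ij:j\in A\}$. Given a probability kernel $\mathcal P$ from $S$ to $S^2$, for $g:S^3\to\mathbb R$ set $\mathcal Pg(y)=\int g(y,y_0,y_1)\mathcal P(y,dy_0,dy_1)$ and for $h:S^2\to\mathbb R$ set $\mathcal Ph(y)=\int h(y_0,y_1)\mathcal P(y,dy_0,dy_1)$. A bifurcating Markov chain (BMC) with initial law $\nu$ and kernel $\mathcal P$ is a process $X=(X_i)_{i\in\mathbb T}$ with values in $S$ such that $X_\emptyset\sim\nu$ and for all $k\ge0$ and bounded measurable $g_i:S^3\to\mathbb R$, $\mathbb E[\prod_{i\in\mathbb G_k}g_i(X_i,X_{i0},X_{i1})\mid\sigma(X_j;j\in\mathbb T_k)]=\prod_{i\in\mathbb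 G_k}\mathcal Pg_i(X_i)$. Let $P_0(y,A)=\mathcal P(y,A\times S)$, $P_1(y,A)=\mathcal P(y,S\times A)$, $\mathcal Q=\frac12(P_0+P_1)$, $\mathcal Q^n$ its $n$-th iterate, $\langle\lambda,f\rangle=\int f\,d\lambda$. $X$ is a BMC with kernel $\mathcal P$ and initial law $\nu$ satisfying: (H1) There is a set $F$ of real measurable functions on $S$ which is a vector space containing the constants, with $f^2\in F$ for $f\in F$, $F\subset L^1(\nu)$, and for $f_0,f_1\in F$, $f_0\otimes f_1$ is $\mathcal P(y,\cdot)$-integrable for every $y$ and $\mathcal P(f_0\otimes f_1)\in F$. (H2) There is a probability measure $\mu$ on $S$ with $F\subset L^1(\mu)$ such that for every $f\in F$, $\mathcal Q^nf\to\langle\mu,f\rangle$ pointwise and there is $g\in F$ with $|\mathcal Q^nf|\le g$ for all $n$; moreover there exist $V\in F$ with $V\ge1$, $\alpha\in(0,1)$ and $M<\infty$ such that $|\mathcal Q^nf-\langle\mu,f\rangle|\le M\alpha^nV$ for all $n\in\mathbb N$ and all measurable $f$ with $|f|\le V$. (H3) $\mathcal P(y,dy_0,dy_1)$ has a Lebesgue density $\mathcal P(y,y_0,y_1)$; then $\mathcal Q$ has density $\mathcal Q(y,z)=\frac12\int(\mathcal P(y,z,w)+\mathcal P(y,w,z))dw$, $\mu$ has a Lebesgue density denoted $\mu(\cdot)$, and $\mu^{\triangle}(y,y_0,y_1)=\mu(y)\mathcal P(y,y_0,y_1)$. (H4) $C_0=\sup_{y,y_0,y_1\in S}(\mu(y)+\mathcal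 Q(y,y_0)+\mathcal P(y,y_0,y_1))<\infty$. (H5) $h_n=2^{-n\gamma}$ for some $\gamma\in(0,1/(3d))$ with $2\alpha^2<2^{3d\gamma}$; $K_0:\mathbb R^d\to\mathbb R$ is bounded, integrable (hence square integrable) with $\int K_0=1$; $\|K_0\|_p$ denotes its Lebesgue $L^p$ norm. Let $K=K_0\otimes K_0\otimes K_0$ on $\mathbb R^{3d}$. (H6) There is $s>0$ such that: (a) for each $j\in\{1,\dots,3d\}$, $\mu^\triangle$ has partial derivatives in the $j$-th coordinate up to order $\lfloor s\rfloor$ and there is $L<\infty$ with $|\partial_j^{\lfloor s\rfloor}\mu^\triangle(z_{-j},t)-\partial_j^{\lfloor s\rfloor}\mu^\triangle(z)|\le L|z_j-t|^{s-\lfloor s\rfloor}$ for all $z\in\mathbb R^{3d}$, $t\in\mathbb R$ (where $(z_{-j},t)$ is $z$ with $j$-th coordinate replaced by $t$, and $\partial_j^0\mu^\triangle=\mu^\triangle$), and the same holds for $\mu$ on $\mathbb R^d$; (b) $\int_{\mathbb R^d}|z|^s|K_0(z)|dz<\infty$ and $\int_{\mathbb R}z_j^kK_0(z)\,dz_j=0$ for all $k\in\{1,\dots,\lfloor s\rfloor\}$, $j\in\{1,\dots,d\}$; (c) $\gamma>1/(2s+3d)$, i.e. $|\mathbb G_n|h_n^{2s+3d}\to0$. Estimators: for $\mathbb A_n\in\{\mathbb G_n,\mathbb T_n\}$, $\widehat\mu_{\mathbb A_n}(y)=\frac{1}{|\mathbb A_n|h_n^{d}}\sum_{u\in\mathbb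 A_n}K_0(h_n^{-1}(y-X_u))$, $\widehat\mu^{\triangle}_{\mathbb A_n}(y,y_0,y_1)=\frac{1}{|\mathbb A_n|h_n^{3d}}\sum_{u\in\mathbb A_n}K\big(h_n^{-1}(y-X_u),h_n^{-1}(y_0-X_{u0}),h_n^{-1}(y_1-X_{u1})\big)$, and $\widehat{\mathcal P}_{\mathbb A_n}(y,y_0,y_1)=\widehat\mu^{\triangle}_{\mathbb A_n}(y,y_0,y_1)/\widehat\mu_{\mathbb A_n}(y)$, with the convention $\widehat{\mathcal P}_{\mathbb A_n}=0$ if $\widehat\mu_{\mathbb A_n}(y)=0$. Fix $(x,x_0,x_1)\in S^3$ with $\mu(x)>0$. *)

theory Defs
  imports "HOL-Probability.Probability"
begin

text \<open>Vertices of the binary tree are words over {0,1}, encoded as bool lists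
  (False = 0, True = 1); concatenation is list append, the root is [].\<close>

definition Gen :: "nat \<Rightarrow> bool list set" where
  "Gen k = {u. length u = k}"

definition Tree :: "nat \<Rightarrow> bool list set" where
  "Tree k = {u. length u \<le> k}"

text \<open>The kernel P(y, dy0 dy1) given through its Lebesgue density p y y0 y1 (H3).\<close>

definition kernel_meas :: "('a::euclidean_space \<Rightarrow> 'a \<Rightarrow> 'a \<Rightarrow> real) \<Rightarrow> 'a \<Rightarrow> ('a \<times> 'a) measure" where
  "kernel_meas p y = density lborel (\<lambda>z. ennreal (p y (fst z) (snd z)))"

definition is_density_kernel :: "('a::euclidean_space \<Rightarrow> 'a \<Rightarrow> 'a \<Rightarrow> real) \<Rightarrow> bool" where
  "is_density_kernel p \<longleftrightarrow>
     (\<forall>y y0 y1. 0 \<le> p y y0 y1) \<and>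
     (\<lambda>(y, y0, y1). p y y0 y1) \<in> borel_measurable borel \<and>
     (\<forall>y. prob_space (kernel_meas p y))"

definition kernel_op3 :: "('a::euclidean_space \<Rightarrow> 'a \<Rightarrow> 'a \<Rightarrow> real) \<Rightarrow> ('a \<times> 'a \<times> 'a \<Rightarrow> real) \<Rightarrow> 'a \<Rightarrow> real" where
  "kernel_op3 p g y = (\<integral>z. g (y, fst z, snd z) \<partial>kernel_meas p y)"

definition kernel_op2 :: "('a::euclidean_space \<Rightarrow> 'a \<Rightarrow> 'a \<Rightarrow> real) \<Rightarrow> ('a \<times> 'a \<Rightarrow> real) \<Rightarrow> 'a \<Rightarrow> real" where
  "kernel_op2 p h y = (\<integral>z. h z \<partial>kernel_meas p y)"

definition Q_op :: "('a::euclidean_space \<Rightarrow> 'a \<Rightarrow> 'a \<Rightarrow> real) \<Rightarrow> ('a \<Rightarrow> real) \<Rightarrow> 'a \<Rightarrow> real" where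
  "Q_op p f y = ((\<integral>z. f (fst z) \<partial>kernel_meas p y) + (\<integral>z. f (snd z) \<partial>kernel_meas p y)) / 2"

definition Q_dens :: "('a::euclidean_space \<Rightarrow> 'a \<Rightarrow> 'a \<Rightarrow> real) \<Rightarrow> 'a \<Rightarrow> 'a \<Rightarrow> real" where
  "Q_dens p y z = (\<integral>w. (p y z w + p y w z) \<partial>lborel) / 2"

definition tree_sigma :: "'w measure \<Rightarrow> (bool list \<Rightarrow> 'w \<Rightarrow> 'a::topological_space) \<Rightarrow> nat \<Rightarrow> 'w measure" where
  "tree_sigma M X k =
     sigma (space M) {X j -` B \<inter> space M | j B. j \<in> Tree k \<and> B \<in> sets borel}"

definition is_BMC :: "'w measure \<Rightarrow> (bool list \<Rightarrow> 'w \<Rightarrow> 'a::euclidean_space) \<Rightarrow> 'a measure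
    \<Rightarrow> ('a \<Rightarrow> 'a \<Rightarrow> 'a \<Rightarrow> real) \<Rightarrow> bool" where
  "is_BMC M X nu p \<longleftrightarrow>
     prob_space M \<and>
     (\<forall>u. X u \<in> borel_measurable M) \<and>
     distr M borel (X []) = nu \<and>
     (\<forall>k (g :: bool list \<Rightarrow> 'a \<times> 'a \<times> 'a \<Rightarrow> real).
        (\<forall>i\<in>Gen k. g i \<in> borel_measurable borel \<and> (\<exists>C. \<forall>z. \<bar>g i z\<bar> \<le> C)) \<longrightarrow>
        (AE \<omega> in M.
           real_cond_exp M (tree_sigma M X k)
             (\<lambda>\<omega>. \<Prod>i\<in>Gen k. g i (X i \<omega>, X (i @ [False]) \<omega>, X (i @ [True]) \<omega>)) \<omega>
           = (\<Prod>i\<in>Gen k. kernel_op3 p (g i) (X i \<omega>))))"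

definition H1 :: "('a::euclidean_space \<Rightarrow> real) set \<Rightarrow> 'a measure \<Rightarrow> ('a \<Rightarrow> 'a \<Rightarrow> 'a \<Rightarrow> real) \<Rightarrow> bool" where
  "H1 F nu p \<longleftrightarrow>
     (\<forall>f\<in>F. f \<in> borel_measurable borel) \<and>
     (\<forall>f\<in>F. \<forall>g\<in>F. (\<lambda>y. f y + g y) \<in> F) \<and>
     (\<forall>c. \<forall>f\<in>F. (\<lambda>y. c * f y) \<in> F) \<and>
     (\<forall>c. (\<lambda>y. c) \<in> F) \<and>
     (\<forall>f\<in>F. (\<lambda>y. (f y)\<^sup>2) \<in> F) \<and>
     (\<forall>f\<in>F. integrable nu f) \<and>
     (\<forall>f0\<in>F. \<forall>f1\<in>F.
        (\<forall>y. integrable (kernel_meas p y) (\<lambda>z. f0 (fst z) * f1 (snd z))) \<and>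
        kernel_op2 p (\<lambda>z. f0 (fst z) * f1 (snd z)) \<in> F)"

text \<open>(H2), with the witnesses V, alpha, M made explicit parameters.
  The invariant measure mu is given by its Lebesgue density mu (H3).\<close>
definition H2 :: "('a::euclidean_space \<Rightarrow> real) set \<Rightarrow> ('a \<Rightarrow> 'a \<Rightarrow> 'a \<Rightarrow> real) \<Rightarrow> ('a \<Rightarrow> real)
    \<Rightarrow> ('a \<Rightarrow> real) \<Rightarrow> real \<Rightarrow> real \<Rightarrow> bool" where
  "H2 F p mu V \<alpha> Mc \<longleftrightarrow>
     (\<forall>f\<in>F. integrable (density lborel mu) f) \<and>
     (\<forall>f\<in>F. (\<forall>y. (\<lambda>n. (Q_op p ^^ n) f y) \<longlonglongrightarrow> (\<integral>z. f z \<partial>density lborel mu)) \<and>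
            (\<exists>g\<in>F. \<forall>n y. \<bar>(Q_op p ^^ n) f y\<bar> \<le> g y)) \<and>
     V \<in> F \<and> (\<forall>y. 1 \<le> V y) \<and> 0 < \<alpha> \<and> \<alpha> < 1 \<and>
     (\<forall>n (f :: 'a \<Rightarrow> real). f \<in> borel_measurable borel \<and> (\<forall>y. \<bar>f y\<bar> \<le> V y) \<longrightarrow>
        (\<forall>y. \<bar>(Q_op p ^^ n) f y - (\<integral>z. f z \<partial>density lborel mu)\<bar> \<le> Mc * \<alpha> ^ n * V y))"

fun diter :: "'b::euclidean_space \<Rightarrow> nat \<Rightarrow> ('b \<Rightarrow> real) \<Rightarrow> 'b \<Rightarrow> real" where
  "diter b 0 f = f"
| "diter b (Suc k) f = (\<lambda>z. deriv (\<lambda>t. diter b k f (z + t *\<^sub>R b)) 0)"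

definition holder_smooth :: "real \<Rightarrow> real \<Rightarrow> ('b::euclidean_space \<Rightarrow> real) \<Rightarrow> bool" where
  "holder_smooth s L f \<longleftrightarrow>
     (\<forall>b\<in>Basis.
        (\<forall>k < nat \<lfloor>s\<rfloor>. \<forall>z. (\<lambda>t. diter b k f (z + t *\<^sub>R b)) differentiable (at 0)) \<and>
        (\<forall>z t. \<bar>diter b (nat \<lfloor>s\<rfloor>) f (z + (t - z \<bullet> b) *\<^sub>R b) - diter b (nat \<lfloor>s\<rfloor>) f z\<bar>
               \<le> L * \<bar>z \<bullet> b - t\<bar> powr (s - real_of_int \<lfloor>s\<rfloor>)))"

definition mu_tri :: "('a \<Rightarrow> real) \<Rightarrow> ('a \<Rightarrow> 'a \<Rightarrow> 'a \<Rightarrow> real) \<Rightarrow> 'a \<times> 'a \<times> 'a \<Rightarrow> real" where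
  "mu_tri mu p z = mu (fst z) * p (fst z) (fst (snd z)) (snd (snd z))"

definition kernel_moments :: "real \<Rightarrow> ('a::euclidean_space \<Rightarrow> real) \<Rightarrow> bool" where
  "kernel_moments s K0 \<longleftrightarrow>
     (\<forall>b\<in>Basis. \<forall>k\<in>{1..nat \<lfloor>s\<rfloor>}. \<forall>z.
        integrable lborel (\<lambda>t::real. t ^ k * K0 (z + (t - z \<bullet> b) *\<^sub>R b)) \<and>
        (\<integral>t. t ^ k * K0 (z + (t - z \<bullet> b) *\<^sub>R b) \<partial>lborel) = 0)"

definition bandwidth :: "real \<Rightarrow> nat \<Rightarrow> real" where
  "bandwidth \<gamma> n = 2 powr (- (\<gamma> * real n))"

definition Ktens :: "('a \<Rightarrow> real) \<Rightarrow> 'a \<times> 'a \<times> 'a \<Rightarrow> real" where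
  "Ktens K0 z = K0 (fst z) * K0 (fst (snd z)) * K0 (snd (snd z))"

definition L2norm :: "('a::euclidean_space \<Rightarrow> real) \<Rightarrow> real" where
  "L2norm f = sqrt (\<integral>z. (f z)\<^sup>2 \<partial>lborel)"

definition mu_hat :: "('a::euclidean_space \<Rightarrow> real) \<Rightarrow> (bool list \<Rightarrow> 'w \<Rightarrow> 'a) \<Rightarrow> bool list set
    \<Rightarrow> real \<Rightarrow> 'a \<Rightarrow> 'w \<Rightarrow> real" where
  "mu_hat K0 X A h y \<omega> =
     (\<Sum>u\<in>A. K0 ((1 / h) *\<^sub>R (y - X u \<omega>))) / (real (card A) * h ^ DIM('a))"

definition mu_tri_hat :: "('a::euclidean_space \<Rightarrow> real) \<Rightarrow> (bool list \<Rightarrow> 'w \<Rightarrow> 'a) \<Rightarrow> bool list set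
    \<Rightarrow> real \<Rightarrow> 'a \<Rightarrow> 'a \<Rightarrow> 'a \<Rightarrow> 'w \<Rightarrow> real" where
  "mu_tri_hat K0 X A h y y0 y1 \<omega> =
     (\<Sum>u\<in>A. Ktens K0 ((1 / h) *\<^sub>R (y - X u \<omega>),
                         (1 / h) *\<^sub>R (y0 - X (u @ [False]) \<omega>),
                         (1 / h) *\<^sub>R (y1 - X (u @ [True]) \<omega>)))
     / (real (card A) * h ^ (3 * DIM('a)))"

definition P_hat :: "('a::euclidean_space \<Rightarrow> real) \<Rightarrow> (bool list \<Rightarrow> 'w \<Rightarrow> 'a) \<Rightarrow> bool list set
    \<Rightarrow> real \<Rightarrow> 'a \<Rightarrow> 'a \<Rightarrow> 'a \<Rightarrow> 'w \<Rightarrow> real" where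
  "P_hat K0 X A h y y0 y1 \<omega> =
     (if mu_hat K0 X A h y \<omega> = 0 then 0
      else mu_tri_hat K0 X A h y y0 y1 \<omega> / mu_hat K0 X A h y \<omega>)"

definition centered_gaussian :: "real \<Rightarrow> real measure" where
  "centered_gaussian v =
     (if v = 0 then return borel 0
      else density lborel (\<lambda>t. ennreal (normal_density 0 (sqrt v) t)))"

end

theory Submission
  imports Defs
begin

text \<open>
  Let \<open>h\<close> be the bandwidth and \<open>g(z) = Ktens K0 ((xx - z) / h)\<close> with \<open>xx = (x, x0, x1)\<close>. The rescaled error is the quotient
  of a normalised sum of \<open>g(X_u, X_u0, X_u1) - p(xx) h^2d K0((x - X_u) / h)\<close> over the vertices and of the density
  estimate at \<open>x\<close>. Subtracting \<open>P g (X_u)\<close> from each summand of the numerator leaves a martingale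
  over the generations plus sums of functions of \<open>X_u\<close> alone.

  The latter are negligible. If \<open>f\<close> is of size \<open>h^2d\<close> and concentrated near \<open>x\<close> at scale \<open>h\<close>, one application of \<open>Q\<close> gains
  a factor \<open>h^d\<close> because \<open>Q\<close> has a bounded density, and ergodicity yields \<open>|Q^j f - mu(f)| \<le> C h^3d \<alpha>^(j-1) V\<close>. The
  recursion \<open>E S_(k+1)(f)^2 \<le> 4 E S_k(Q f)^2 + 2 E S_(k+1)(f^2)\<close> for the sums \<open>S_k\<close> over generation \<open>k\<close> turns this into a
  variance bound, which is small enough as soon as \<open>2 \<alpha>^2 < 2^(3 d \<gamma>)\<close>. The means \<open>mu(f)\<close> are bias terms of order \<open>h^s\<close>.

  Given the past, the summands of one generation are independent, so the conditional characteristic function of a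
  martingale increment is a product, close to \<open>exp (- t^2 v / 2)\<close> with \<open>v\<close> the conditional variance. The same variance
  bound shows that \<open>v\<close> is asymptotically deterministic in each generation, and the characteristic function of the
  martingale converges by telescoping over the generations. Slutsky's theorem and Levy's continuity theorem conclude.
\<close>

subsection \<open>Bifurcating Markov chains with a density kernel\<close>

text \<open>The rate condition comes out as follows. Divided by \<open>2 ^ k\<close>, the second
  moment of a centered generation sum is at most a constant times
  \<open>c\<^sup>2 + e\<^sup>2 * \<beta> ^ k\<close>, with \<open>c\<close> of order
  \<open>h^2d\<close>, \<open>e\<close> of order \<open>h^3d\<close>, and any
  \<open>\<beta> > 1\<close> with \<open>2 * \<alpha>\<^sup>2 \<le> \<beta>\<close>. The
  normalisation divides by \<open>h^3d\<close> and leaves \<open>h^d\<close> and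
  \<open>h^3d * \<beta> ^ n\<close>; the second vanishes for a suitable \<open>\<beta>\<close>
  because 1 and \<open>2 * \<alpha>\<^sup>2\<close> both lie below
  \<open>2 powr (3 d \<gamma>)\<close>. Three obstacles shape the rest. The chain need not start in
  equilibrium and \<open>V\<close> may be unbounded, so moments along the tree go through a
  \<open>nu\<close>-integrable function of \<open>F\<close> that dominates the orbit of
  \<open>V\<^sup>2\<close> under \<open>Q\<close>. The Markov property speaks of bounded real test
  functions, whence the class \<open>bdd_borel\<close> and the expansion of complex products into
  real ones. Smoothness is given along coordinate lines only, so joint continuity, measurability of
  the derivatives and the cancellation of Taylor terms are all obtained one coordinate at a
  time.\<close>

definition bdd_borel :: "('b::topological_space \<Rightarrow> real) \<Rightarrow> bool" where
  "bdd_borel f \<longleftrightarrow> f \<in> borel_measurable borel \<and> (\<exists>C. \<forall>z. \<bar>f z\<bar> \<le> C)"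

lemma bdd_borelI: "f \<in> borel_measurable borel \<Longrightarrow> (\<And>z. \<bar>f z\<bar> \<le> C) \<Longrightarrow> bdd_borel f"
  unfolding bdd_borel_def by blast

lemma bdd_borel_measurable [measurable_dest]: "bdd_borel f \<Longrightarrow> f \<in> borel_measurable borel"
  unfolding bdd_borel_def by blast

lemma bdd_borelE:
  assumes "bdd_borel f"
  obtains C where "0 < C" "\<And>z. \<bar>f z\<bar> \<le> C"
proof -
  from assms obtain C where "\<forall>z. \<bar>f z\<bar> \<le> C" unfolding bdd_borel_def by blast
  then have "\<bar>f z\<bar> \<le> \<bar>C\<bar> + 1" for z by (meson abs_ge_self add_increasing2 order_trans zero_le_one)
  then show ?thesis using that[of "\<bar>C\<bar> + 1"] by simp
qed

lemma bdd_borel_const [simp]: "bdd_borel (\<lambda>z. c)"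
  by (rule bdd_borelI[where C = "\<bar>c\<bar>"]) auto

lemma bdd_borel_add:
  assumes "bdd_borel f" "bdd_borel g" shows "bdd_borel (\<lambda>z. f z + g z)"
proof -
  note [measurable] = assms[THEN bdd_borel_measurable]
  obtain C where "0 < C" "\<And>z. \<bar>f z\<bar> \<le> C" by (rule bdd_borelE[OF assms(1)]) blast
  moreover obtain D where "0 < D" "\<And>z. \<bar>g z\<bar> \<le> D" by (rule bdd_borelE[OF assms(2)]) blast
  ultimately show ?thesis by (intro bdd_borelI[where C = "C + D"]) (auto intro!: abs_triangle_ineq[THEN order_trans] add_mono)
qed

lemma bdd_borel_mult:
  assumes "bdd_borel f" "bdd_borel g" shows "bdd_borel (\<lambda>z. f z * g z)"
proof -
  note [measurable] = assms[THEN bdd_borel_measurable]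
  obtain C where "0 < C" "\<And>z. \<bar>f z\<bar> \<le> C" by (rule bdd_borelE[OF assms(1)]) blast
  moreover obtain D where "0 < D" "\<And>z. \<bar>g z\<bar> \<le> D" by (rule bdd_borelE[OF assms(2)]) blast
  ultimately show ?thesis
    by (intro bdd_borelI[where C = "C * D"]) (measurable, auto simp: abs_mult intro!: mult_mono)
qed

lemma bdd_borel_cmult: "bdd_borel f \<Longrightarrow> bdd_borel (\<lambda>z. c * f z)"
  by (intro bdd_borel_mult) auto

lemma bdd_borel_diff: "bdd_borel f \<Longrightarrow> bdd_borel g \<Longrightarrow> bdd_borel (\<lambda>z. f z - g z)"
  using bdd_borel_add[OF _ bdd_borel_cmult[of g "-1"]] by simp

lemma bdd_borel_power2: "bdd_borel f \<Longrightarrow> bdd_borel (\<lambda>z. (f z)\<^sup>2)"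
  unfolding power2_eq_square by (rule bdd_borel_mult)

lemma bdd_borel_compose:
  assumes "bdd_borel f" "T \<in> borel_measurable borel" shows "bdd_borel (\<lambda>z. f (T z))"
proof -
  note [measurable] = assms(1)[THEN bdd_borel_measurable] assms(2)
  obtain C where "0 < C" "\<And>z. \<bar>f z\<bar> \<le> C" by (rule bdd_borelE[OF assms(1)]) blast
  then show ?thesis by (intro bdd_borelI[where C = C]) auto
qed

lemma (in prob_space) integrable_bdd_borel:
  assumes "bdd_borel f" "Y \<in> borel_measurable M"
  shows "integrable M (\<lambda>\<omega>. f (Y \<omega>))"
proof -
  note [measurable] = assms(1)[THEN bdd_borel_measurable] assms(2)
  obtain C where "0 < C" "\<And>z. \<bar>f z\<bar> \<le> C" by (rule bdd_borelE[OF assms(1)]) blast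
  then show ?thesis by (intro integrable_const_bound[where B = C]) auto
qed

lemma fst_borel_measurable [measurable]:
  "fst \<in> borel_measurable (borel :: ('b::second_countable_topology \<times> 'c::second_countable_topology) measure)"
  by (simp add: borel_prod[symmetric])

lemma snd_borel_measurable [measurable]:
  "snd \<in> borel_measurable (borel :: ('b::second_countable_topology \<times> 'c::second_countable_topology) measure)"
  by (simp add: borel_prod[symmetric])

locale density_kernel =
  fixes p :: "'a::euclidean_space \<Rightarrow> 'a \<Rightarrow> 'a \<Rightarrow> real"
  assumes kernel: "is_density_kernel p"
begin

abbreviation "P \<equiv> kernel_op3 p"
abbreviation "Q \<equiv> Q_op p"

lemma p_nonneg: "0 \<le> p y y0 y1"
  using kernel unfolding is_density_kernel_def by blast

lemma p_measurable [measurable (raw)]: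
  assumes [measurable]: "f \<in> borel_measurable N" "g \<in> borel_measurable N" "h \<in> borel_measurable N"
  shows "(\<lambda>w. p (f w) (g w) (h w)) \<in> borel_measurable N"
proof -
  have [measurable]: "(\<lambda>(y, y0, y1). p y y0 y1) \<in> borel_measurable borel"
    using kernel unfolding is_density_kernel_def by blast
  have "(\<lambda>w. (\<lambda>(y, y0, y1). p y y0 y1) (f w, g w, h w)) \<in> borel_measurable N"
    by measurable
  then show ?thesis by simp
qed

lemma prob_space_kernel: "prob_space (kernel_meas p y)"
  using kernel unfolding is_density_kernel_def by blast

lemma sets_kernel [simp, measurable_cong]: "sets (kernel_meas p y) = sets borel"
  by (simp add: kernel_meas_def)

lemma space_kernel [simp]: "space (kernel_meas p y) = UNIV"
  by (simp add: kernel_meas_def)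

lemma kernel_integrable:
  assumes "bdd_borel g" shows "integrable (kernel_meas p y) g"
proof -
  interpret prob_space "kernel_meas p y" by (rule prob_space_kernel)
  show ?thesis using integrable_bdd_borel[OF assms, of "\<lambda>z. z"] by simp
qed

lemma P_def: "P g y = (\<integral>z. g (y, z) \<partial>kernel_meas p y)"
  by (simp add: kernel_op3_def)

lemma kernel_integrable3:
  assumes "bdd_borel g" shows "integrable (kernel_meas p y) (\<lambda>z. g (y, z))"
  by (intro kernel_integrable bdd_borel_compose[OF assms]) simp

lemma kernel_integral_density:
  assumes [measurable]: "g \<in> borel_measurable borel"
  shows "(\<integral>z. g z \<partial>kernel_meas p y) = (\<integral>z. p y (fst z) (snd z) * g z \<partial>lborel)"
  unfolding kernel_meas_def by (subst integral_density) (auto simp: p_nonneg)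

lemma P_eq_lborel:
  assumes [measurable]: "g \<in> borel_measurable borel"
  shows "P g y = (\<integral>z. p y (fst z) (snd z) * g (y, z) \<partial>lborel)"
  unfolding P_def by (subst kernel_integral_density) auto

lemma P_const [simp]: "P (\<lambda>z. c) y = c"
proof -
  interpret prob_space "kernel_meas p y" by (rule prob_space_kernel)
  show ?thesis using prob_space by (simp add: P_def)
qed

lemma P_measurable [measurable]:
  assumes [measurable]: "g \<in> borel_measurable borel"
  shows "P g \<in> borel_measurable borel"
proof -
  have "(\<lambda>(y, z). p y (fst z) (snd z) * g (y, z)) \<in> borel_measurable (borel \<Otimes>\<^sub>M lborel)"
    unfolding borel_prod measurable_cong_sets[OF sets_pair_measure_cong[OF refl sets_lborel] refl]
    by (simp add: case_prod_beta)
  then have "(\<lambda>y. \<integral>z. p y (fst z) (snd z) * g (y, z) \<partial>lborel) \<in> borel_measurable borel"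
    by (rule lborel.borel_measurable_lebesgue_integral)
  moreover have "P g = (\<lambda>y. \<integral>z. p y (fst z) (snd z) * g (y, z) \<partial>lborel)"
    by (rule ext) (rule P_eq_lborel[OF assms])
  ultimately show ?thesis by simp
qed

lemma P_mono:
  assumes "bdd_borel f" "bdd_borel g" "\<And>z. f z \<le> g z" shows "P f y \<le> P g y"
  unfolding P_def by (intro integral_mono kernel_integrable3 assms)

lemma P_abs_le:
  assumes "bdd_borel g" "\<And>z. \<bar>g z\<bar> \<le> C" shows "\<bar>P g y\<bar> \<le> C"
proof -
  have "g z \<le> C" "- C \<le> g z" for z using assms(2)[of z] by auto
  then have "P g y \<le> P (\<lambda>_. C) y" "P (\<lambda>_. -C) y \<le> P g y"
    by (intro P_mono assms(1) bdd_borel_const, simp)+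
  then show ?thesis by simp
qed

lemma bdd_borel_P:
  assumes "bdd_borel g" shows "bdd_borel (P g)"
proof -
  obtain C where "0 < C" "\<And>z. \<bar>g z\<bar> \<le> C" by (rule bdd_borelE[OF assms]) blast
  with assms show ?thesis
    by (intro bdd_borelI[where C = C] P_abs_le P_measurable bdd_borel_measurable[OF assms])
qed

lemma P_diff: "bdd_borel f \<Longrightarrow> bdd_borel g \<Longrightarrow> P (\<lambda>z. f z - g z) y = P f y - P g y"
  unfolding P_def by (simp add: kernel_integrable3)

lemma P_cmult: "P (\<lambda>z. c * g z) y = c * P g y"
  unfolding P_def by simp

text \<open>Through the mean over the two children, \<open>Q\<close> inherits measurability,
  boundedness and additivity from \<open>P\<close>, and the Markov property of the tree applies to
  it.\<close>

lemma Q_eq_P: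
  assumes "bdd_borel f"
  shows "Q f y = P (\<lambda>z. (f (fst (snd z)) + f (snd (snd z))) / 2) y"
proof -
  have [simp]: "integrable (kernel_meas p y) (\<lambda>z. f (fst z))" "integrable (kernel_meas p y) (\<lambda>z. f (snd z))"
    by (auto intro!: kernel_integrable bdd_borel_compose[OF assms])
  show ?thesis unfolding Q_op_def P_def by simp
qed

lemma bdd_borel_children:
  assumes "bdd_borel f" shows "bdd_borel (\<lambda>z::'a \<times> 'a \<times> 'a. (f (fst (snd z)) + f (snd (snd z))) / 2)"
proof -
  have "bdd_borel (\<lambda>z::'a \<times> 'a \<times> 'a. inverse 2 * (f (fst (snd z)) + f (snd (snd z))))"
    by (intro bdd_borel_cmult bdd_borel_add bdd_borel_compose[OF assms]) simp_all
  then show ?thesis by (simp add: field_simps)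
qed

lemma bdd_borel_Q:
  assumes "bdd_borel f" shows "bdd_borel (Q f)"
proof -
  have "Q f = P (\<lambda>z. (f (fst (snd z)) + f (snd (snd z))) / 2)"
    by (rule ext) (rule Q_eq_P[OF assms])
  then show ?thesis by (simp add: bdd_borel_P bdd_borel_children assms)
qed

lemma bdd_borel_Q_power: "bdd_borel f \<Longrightarrow> bdd_borel ((Q ^^ n) f)"
  by (induction n) (auto intro: bdd_borel_Q)

lemma Q_power_Suc_right: "(Q ^^ Suc n) f = (Q ^^ n) (Q f)"
  by (simp add: funpow_swap1)

lemma Q_const [simp]: "Q (\<lambda>_. c) = (\<lambda>_. c)"
  by (rule ext) (simp add: Q_eq_P)

lemma Q_cmult: "Q (\<lambda>z. c * f z) = (\<lambda>y. c * Q f y)"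
  by (rule ext) (simp add: Q_op_def algebra_simps)

lemma Q_power_cmult: "(Q ^^ n) (\<lambda>z. c * f z) = (\<lambda>y. c * (Q ^^ n) f y)"
  by (induction n) (simp_all add: Q_cmult)

lemma Q_diff:
  assumes "bdd_borel f" "bdd_borel g"
  shows "Q (\<lambda>z. f z - g z) = (\<lambda>y. Q f y - Q g y)"
proof (rule ext)
  fix y
  have "Q (\<lambda>z. f z - g z) y = P (\<lambda>z. (f (fst (snd z)) + f (snd (snd z))) / 2 - (g (fst (snd z)) + g (snd (snd z))) / 2) y"
    by (simp add: Q_eq_P bdd_borel_diff assms diff_divide_distrib add_divide_distrib algebra_simps)
  also have "\<dots> = Q f y - Q g y"
    by (simp add: P_diff bdd_borel_children assms Q_eq_P)
  finally show "Q (\<lambda>z. f z - g z) y = Q f y - Q g y" .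
qed

end

section \<open>Generations of the tree and the integrated Markov property\<close>

definition offspring :: "(bool list \<Rightarrow> 'w \<Rightarrow> 'a) \<Rightarrow> bool list \<Rightarrow> 'w \<Rightarrow> 'a \<times> 'a \<times> 'a" where
  "offspring X u \<omega> = (X u \<omega>, X (u @ [False]) \<omega>, X (u @ [True]) \<omega>)"

definition gen_sum :: "(bool list \<Rightarrow> 'w \<Rightarrow> 'a) \<Rightarrow> nat \<Rightarrow> ('a \<Rightarrow> real) \<Rightarrow> 'w \<Rightarrow> real" where
  "gen_sum X k f \<omega> = (\<Sum>u\<in>Gen k. f (X u \<omega>))"

lemma finite_Gen [simp]: "finite (Gen k)"
  using finite_lists_length_eq[of "UNIV :: bool set" k] by (simp add: Gen_def)

lemma card_Gen [simp]: "card (Gen k) = 2 ^ k"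
  using card_lists_length_eq[of "UNIV :: bool set" k] by (simp add: Gen_def)

lemma sum_Gen_Suc:
  fixes f :: "bool list \<Rightarrow> real"
  shows "(\<Sum>u\<in>Gen (Suc k). f u) = (\<Sum>u\<in>Gen k. f (u @ [False]) + f (u @ [True]))"
proof -
  have eq: "Gen (Suc k) = (\<lambda>u. u @ [False]) ` Gen k \<union> (\<lambda>u. u @ [True]) ` Gen k"
  proof
    show "Gen (Suc k) \<subseteq> (\<lambda>u. u @ [False]) ` Gen k \<union> (\<lambda>u. u @ [True]) ` Gen k"
    proof
      fix v assume "v \<in> Gen (Suc k)"
      then have len: "length v = Suc k" by (simp add: Gen_def)
      then have "v = butlast v @ [last v]" by (metis append_butlast_last_id list.size(3) nat.distinct(1))
      moreover have "butlast v \<in> Gen k" using len by (simp add: Gen_def)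
      ultimately show "v \<in> (\<lambda>u. u @ [False]) ` Gen k \<union> (\<lambda>u. u @ [True]) ` Gen k"
        by (cases "last v") (auto intro: rev_image_eqI)
    qed
  qed (auto simp: Gen_def)
  show ?thesis unfolding eq
    by (subst sum.union_disjoint) (auto simp: sum.reindex inj_on_def sum.distrib)
qed

lemma Tree_eq_UN_Gen: "Tree n = (\<Union>k\<in>{..n}. Gen k)"
  by (auto simp: Tree_def Gen_def)

locale bmc = density_kernel p
  for p :: "'a::euclidean_space \<Rightarrow> 'a \<Rightarrow> 'a \<Rightarrow> real" +
  fixes M :: "'w measure" and X :: "bool list \<Rightarrow> 'w \<Rightarrow> 'a" and nu :: "'a measure"
  assumes BMC: "is_BMC M X nu p"
begin

sublocale prob_space M
  using BMC unfolding is_BMC_def by blast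

lemma X_measurable [measurable]: "X u \<in> borel_measurable M"
  using BMC unfolding is_BMC_def by blast

lemma distr_root: "distr M borel (X []) = nu"
  using BMC unfolding is_BMC_def by blast

abbreviation "S \<equiv> gen_sum X"
abbreviation "\<FF> \<equiv> tree_sigma M X"

lemma offspring_measurable [measurable]: "offspring X u \<in> borel_measurable M"
  unfolding offspring_def[abs_def] by measurable

lemma S_measurable [measurable]:
  assumes [measurable]: "f \<in> borel_measurable borel" shows "S k f \<in> borel_measurable M"
  unfolding gen_sum_def[abs_def] by measurable

lemma integrable_X: "bdd_borel f \<Longrightarrow> integrable M (\<lambda>\<omega>. f (X u \<omega>))"
  by (rule integrable_bdd_borel) auto

lemma integrable_S: "bdd_borel f \<Longrightarrow> integrable M (S k f)"
  unfolding gen_sum_def[abs_def] by (auto intro: integrable_X)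

lemma subalgebra_tree: "subalgebra M (\<FF> k)"
proof -
  have *: "{X j -` B \<inter> space M | j B. j \<in> Tree k \<and> B \<in> sets borel} \<subseteq> sets M"
    by (auto intro: measurable_sets[OF X_measurable])
  then have "{X j -` B \<inter> space M | j B. j \<in> Tree k \<and> B \<in> sets borel} \<subseteq> Pow (space M)"
    using sets.space_closed by fastforce
  with * show ?thesis
    unfolding subalgebra_def tree_sigma_def by (simp add: sets.sigma_sets_subset)
qed

lemma space_tree [simp]: "space (\<FF> k) = space M"
  using subalgebra_tree[of k] by (simp add: subalgebra_def)

lemma X_measurable_tree:
  assumes "length u \<le> k" shows "X u \<in> borel_measurable (\<FF> k)"
proof (rule measurableI)
  fix B :: "'a set" assume "B \<in> sets borel"
  then have "X u -` B \<inter> space M \<in> {X j -` B \<inter> space M | j B. j \<in> Tree k \<and> B \<in> sets borel}"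
    using assms by (auto simp: Tree_def)
  moreover have "{X j -` B \<inter> space M | j B. j \<in> Tree k \<and> B \<in> sets borel} \<subseteq> Pow (space M)" by auto
  ultimately show "X u -` B \<inter> space (\<FF> k) \<in> sets (\<FF> k)"
    unfolding space_tree unfolding tree_sigma_def by simp
qed simp

text \<open>Testing the conditional expectation against a bounded \<open>\<FF> k\<close>-measurable
  factor replaces almost sure identities by equalities of numbers. In the martingale arguments
  \<open>H\<close> carries the contribution of the earlier generations.\<close>

lemma expectation_prod:
  assumes H: "H \<in> borel_measurable (\<FF> k)" "\<And>\<omega>. \<bar>H \<omega>\<bar> \<le> C"
    and g: "\<And>u. u \<in> Gen k \<Longrightarrow> bdd_borel (g u)"
  shows "expectation (\<lambda>\<omega>. H \<omega> * (\<Prod>u\<in>Gen k. g u (offspring X u \<omega>)))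
       = expectation (\<lambda>\<omega>. H \<omega> * (\<Prod>u\<in>Gen k. P (g u) (X u \<omega>)))"
proof -
  interpret S: finite_measure_subalgebra M "\<FF> k"
    by standard (rule subalgebra_tree)
  have [measurable]: "\<And>u. u \<in> Gen k \<Longrightarrow> g u \<in> borel_measurable borel"
    using g bdd_borel_measurable by blast
  have Hm [measurable]: "H \<in> borel_measurable M"
    by (rule measurable_from_subalg[OF subalgebra_tree H(1)])
  define G where "G \<omega> = (\<Prod>u\<in>Gen k. g u (offspring X u \<omega>))" for \<omega>
  have [measurable]: "G \<in> borel_measurable M" unfolding G_def by measurable
  have "\<forall>u\<in>Gen k. \<exists>C. \<forall>z. \<bar>g u z\<bar> \<le> C" using g by (meson bdd_borelE)
  then obtain D where D: "\<And>u z. u \<in> Gen k \<Longrightarrow> \<bar>g u z\<bar> \<le> D u" by metis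
  have "integrable M (\<lambda>\<omega>. H \<omega> * G \<omega>)"
  proof (rule integrable_const_bound[where B = "C * (\<Prod>u\<in>Gen k. D u)"])
    have "\<bar>G \<omega>\<bar> \<le> (\<Prod>u\<in>Gen k. D u)" for \<omega>
      unfolding G_def abs_prod by (intro prod_mono) (auto simp: D)
    then show "AE \<omega> in M. norm (H \<omega> * G \<omega>) \<le> C * (\<Prod>u\<in>Gen k. D u)"
      using H(2) by (auto simp: abs_mult intro!: mult_mono intro: order_trans[OF abs_ge_zero])
  qed measurable
  then have "expectation (\<lambda>\<omega>. H \<omega> * G \<omega>) = expectation (\<lambda>\<omega>. H \<omega> * real_cond_exp M (\<FF> k) G \<omega>)"
    by (simp add: S.real_cond_exp_intg(2) H(1))
  also have "\<dots> = expectation (\<lambda>\<omega>. H \<omega> * (\<Prod>u\<in>Gen k. P (g u) (X u \<omega>)))"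
  proof (rule integral_cong_AE)
    have "AE \<omega> in M. real_cond_exp M (\<FF> k) G \<omega> = (\<Prod>i\<in>Gen k. P (g i) (X i \<omega>))"
      using BMC g unfolding is_BMC_def bdd_borel_def G_def offspring_def by blast
    then show "AE \<omega> in M. H \<omega> * real_cond_exp M (\<FF> k) G \<omega> = H \<omega> * (\<Prod>u\<in>Gen k. P (g u) (X u \<omega>))"
      by eventually_elim simp
  qed (auto simp: borel_measurable_cond_exp2)
  finally show ?thesis by (simp add: G_def)
qed

text \<open>Put the constant 1 at all other vertices of the generation; \<open>P\<close> fixes
  constants.\<close>

lemma expectation_single:
  assumes H: "H \<in> borel_measurable (\<FF> k)" "\<And>\<omega>. \<bar>H \<omega>\<bar> \<le> C"
    and g: "bdd_borel g" and u: "u \<in> Gen k"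
  shows "expectation (\<lambda>\<omega>. H \<omega> * g (offspring X u \<omega>)) = expectation (\<lambda>\<omega>. H \<omega> * P g (X u \<omega>))"
proof -
  have *: "(\<Prod>w\<in>Gen k. (if w = u then g else (\<lambda>_. 1)) (offspring X w \<omega>)) = g (offspring X u \<omega>)" for \<omega>
    using u by (subst prod.remove[OF _ u]) auto
  have **: "(\<Prod>w\<in>Gen k. P (if w = u then g else (\<lambda>_. 1)) (X w \<omega>)) = P g (X u \<omega>)" for \<omega>
    using u by (subst prod.remove[OF _ u]) auto
  show ?thesis
    using expectation_prod[OF H, of "\<lambda>w. if w = u then g else (\<lambda>_. 1)"] g unfolding * ** by simp
qed

lemma expectation_offspring:
  assumes "bdd_borel g"
  shows "expectation (\<lambda>\<omega>. g (offspring X u \<omega>)) = expectation (\<lambda>\<omega>. P g (X u \<omega>))"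
  using expectation_single[of "\<lambda>_. 1" "length u" 1 g u] assms by (simp add: Gen_def)

text \<open>Conditional independence of the offspring triples of two vertices of one generation.
  Within a triple the two children may be dependent, so nothing of the kind holds there.\<close>

lemma expectation_pair:
  assumes g: "bdd_borel g" and uv: "u \<in> Gen k" "v \<in> Gen k" "u \<noteq> v"
  shows "expectation (\<lambda>\<omega>. g (offspring X u \<omega>) * g (offspring X v \<omega>))
       = expectation (\<lambda>\<omega>. P g (X u \<omega>) * P g (X v \<omega>))"
proof -
  let ?g = "\<lambda>w. if w = u \<or> w = v then g else (\<lambda>_. 1)"
  have *: "(\<Prod>w\<in>Gen k. (?g w) (offspring X w \<omega>)) = g (offspring X u \<omega>) * g (offspring X v \<omega>)" for \<omega>
    using uv by (subst prod.remove[OF _ uv(1)], simp, subst prod.remove[OF _ , of _ v]) auto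
  have **: "(\<Prod>w\<in>Gen k. P (?g w) (X w \<omega>)) = P g (X u \<omega>) * P g (X v \<omega>)" for \<omega>
    using uv by (subst prod.remove[OF _ uv(1)], simp, subst prod.remove[OF _ , of _ v]) auto
  show ?thesis
    using expectation_prod[of "\<lambda>_. 1" k 1 ?g] g unfolding * ** by simp
qed

end

subsection \<open>Second moments over a generation\<close>

context bmc begin

lemma expectation_S_Suc:
  assumes "bdd_borel f"
  shows "expectation (S (Suc k) f) = 2 * expectation (S k (Q f))"
proof -
  let ?g = "\<lambda>z::'a \<times> 'a \<times> 'a. (f (fst (snd z)) + f (snd (snd z))) / 2"
  have g: "bdd_borel ?g" by (rule bdd_borel_children[OF assms])
  have 1: "S (Suc k) f = (\<lambda>\<omega>. \<Sum>u\<in>Gen k. 2 * ?g (offspring X u \<omega>))"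
    by (rule ext) (simp add: gen_sum_def sum_Gen_Suc offspring_def add_divide_distrib distrib_left)
  have "expectation (S (Suc k) f) = (\<Sum>u\<in>Gen k. 2 * expectation (\<lambda>\<omega>. ?g (offspring X u \<omega>)))"
    unfolding 1 by (subst Bochner_Integration.integral_sum)
      (auto intro!: integrable_bdd_borel[OF g] integrable_mult_right simp del: times_divide_eq_right)
  also have "\<dots> = (\<Sum>u\<in>Gen k. 2 * expectation (\<lambda>\<omega>. Q f (X u \<omega>)))"
    by (simp only: expectation_offspring[OF g] Q_eq_P[OF assms])
  also have "\<dots> = 2 * expectation (S k (Q f))"
    unfolding gen_sum_def[abs_def]
    by (subst Bochner_Integration.integral_sum)
      (auto intro!: integrable_X bdd_borel_Q assms simp: sum_distrib_left)
  finally show ?thesis .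
qed

text \<open>Many-to-one formula: on average a generation behaves like \<open>2 ^ k\<close> copies of
  a single line of descent that moves by \<open>Q\<close>. The induction removes the last
  generation, which replaces \<open>f\<close> by \<open>Q f\<close>; hence the general
  \<open>f\<close>.\<close>

lemma expectation_S:
  "bdd_borel f \<Longrightarrow> expectation (S k f) = 2 ^ k * (\<integral>y. (Q ^^ k) f y \<partial>nu)"
proof (induction k arbitrary: f)
  case 0
  have "Gen 0 = {[]}" by (simp add: Gen_def)
  then have "S 0 f = (\<lambda>\<omega>. f (X [] \<omega>))" by (simp add: gen_sum_def[abs_def])
  then show ?case using 0 by (simp add: distr_root[symmetric] integral_distr bdd_borel_measurable)
next
  case (Suc k)
  then show ?case
    using Suc.IH[OF bdd_borel_Q[OF Suc.prems]] expectation_S_Suc[OF Suc.prems, of k]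
    by (simp add: Q_power_Suc_right del: funpow.simps)
qed

text \<open>Off the diagonal the products factor conditionally, so the square of the sum of the conditional
  means accounts for them; only the diagonal terms are new.\<close>
lemma second_moment_offspring_sum:
  assumes "bdd_borel g"
  shows "expectation (\<lambda>\<omega>. (\<Sum>u\<in>Gen k. g (offspring X u \<omega>))\<^sup>2)
     = expectation (\<lambda>\<omega>. (S k (P g) \<omega>)\<^sup>2) + expectation (S k (\<lambda>y. P (\<lambda>z. (g z)\<^sup>2) y - (P g y)\<^sup>2))"
proof -
  let ?A = "\<lambda>u v. expectation (\<lambda>\<omega>. g (offspring X u \<omega>) * g (offspring X v \<omega>))"
  let ?B = "\<lambda>u v. expectation (\<lambda>\<omega>. P g (X u \<omega>) * P g (X v \<omega>))"
  have g2: "bdd_borel (\<lambda>z. (g z)\<^sup>2)" by (intro bdd_borel_power2 assms)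
  have Pg: "bdd_borel (P g)" by (rule bdd_borel_P[OF assms])
  have mm: "integrable M (\<lambda>\<omega>. f (Y \<omega>) * f (Z \<omega>))"
    if "bdd_borel f" and [measurable]: "Y \<in> borel_measurable M" "Z \<in> borel_measurable M"
    for f :: "'c::{second_countable_topology} \<Rightarrow> real" and Y Z
  proof -
    have "bdd_borel (\<lambda>w. f (fst w) * f (snd w))"
      by (intro bdd_borel_mult bdd_borel_compose[OF that(1)]) auto
    from integrable_bdd_borel[OF this, of "\<lambda>\<omega>. (Y \<omega>, Z \<omega>)"] show ?thesis by simp
  qed
  have int1: "integrable M (\<lambda>\<omega>. g (offspring X u \<omega>) * g (offspring X v \<omega>))" for u v
    by (rule mm[OF assms]) auto
  have int2: "integrable M (\<lambda>\<omega>. P g (X u \<omega>) * P g (X v \<omega>))" for u v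
    by (rule mm[OF Pg]) auto
  have diag: "?A u u - ?B u u = expectation (\<lambda>\<omega>. P (\<lambda>z. (g z)\<^sup>2) (X u \<omega>) - (P g (X u \<omega>))\<^sup>2)" for u
    using expectation_offspring[OF g2, of u]
    by (simp add: power2_eq_square integrable_X bdd_borel_P[OF g2, unfolded power2_eq_square] int2)
  have "expectation (\<lambda>\<omega>. (\<Sum>u\<in>Gen k. g (offspring X u \<omega>))\<^sup>2) - expectation (\<lambda>\<omega>. (S k (P g) \<omega>)\<^sup>2)
      = (\<Sum>u\<in>Gen k. \<Sum>v\<in>Gen k. ?A u v - ?B u v)"
    by (simp add: gen_sum_def power2_eq_square sum_product int1 int2 sum_subtractf)
  also have "\<dots> = (\<Sum>u\<in>Gen k. \<Sum>v\<in>Gen k. if v = u then ?A u u - ?B u u else 0)"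
    by (intro sum.cong refl) (auto simp: expectation_pair[OF assms])
  also have "\<dots> = (\<Sum>u\<in>Gen k. expectation (\<lambda>\<omega>. P (\<lambda>z. (g z)\<^sup>2) (X u \<omega>) - (P g (X u \<omega>))\<^sup>2))"
    by (simp add: diag)
  also have "\<dots> = expectation (S k (\<lambda>y. P (\<lambda>z. (g z)\<^sup>2) y - (P g y)\<^sup>2))"
    unfolding gen_sum_def[abs_def]
    by (subst Bochner_Integration.integral_sum)
       (auto intro!: integrable_X bdd_borel_diff bdd_borel_P[OF g2] bdd_borel_power2 Pg)
  finally show ?thesis by simp
qed

lemma integrable_S_power2: "bdd_borel f \<Longrightarrow> integrable M (\<lambda>\<omega>. (S k f \<omega>)\<^sup>2)"
proof -
  assume f: "bdd_borel f"
  then obtain C where C: "0 < C" "\<And>z. \<bar>f z\<bar> \<le> C" by (rule bdd_borelE) blast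
  have "\<bar>S k f \<omega>\<bar> \<le> 2 ^ k * C" for \<omega>
    unfolding gen_sum_def
    using order_trans[OF sum_abs sum_mono[of "Gen k" "\<lambda>u. \<bar>f (X u \<omega>)\<bar>" "\<lambda>_. C"]] C by auto
  then have "\<bar>S k f \<omega>\<bar>\<^sup>2 \<le> (2 ^ k * C)\<^sup>2" for \<omega> by (intro power_mono) auto
  then show ?thesis
    using f by (intro integrable_const_bound[where B = "(2 ^ k * C)\<^sup>2"])
      (auto intro: bdd_borel_measurable)
qed

lemma expectation_S_mono:
  assumes "bdd_borel f" "bdd_borel g" "\<And>y. f y \<le> g y"
  shows "expectation (S k f) \<le> expectation (S k g)"
  by (intro integral_mono integrable_S assms) (auto simp: gen_sum_def intro!: sum_mono assms)

lemma S_cmult: "S k (\<lambda>y. c * f y) = (\<lambda>\<omega>. c * S k f \<omega>)"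
  by (rule ext) (simp add: gen_sum_def sum_distrib_left)

text \<open>Given generation \<open>k\<close>, the pair of children has conditional mean
  \<open>2 * Q f\<close>, whose square gives the factor 4. The diagonal term involves dependent
  siblings and is bounded by
  \<open>(r + q)\<^sup>2 \<le> 2 * (r\<^sup>2 + q\<^sup>2)\<close>.\<close>

lemma second_moment_Suc:
  assumes f: "bdd_borel f"
  shows "expectation (\<lambda>\<omega>. (S (Suc k) f \<omega>)\<^sup>2)
     \<le> 4 * expectation (\<lambda>\<omega>. (S k (Q f) \<omega>)\<^sup>2) + 2 * expectation (S (Suc k) (\<lambda>y. (f y)\<^sup>2))"
proof -
  let ?c = "\<lambda>h (z::'a \<times> 'a \<times> 'a). (h (fst (snd z)) + h (snd (snd z))) / 2"
  define g where "g z = 2 * ?c f z" for z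
  have g: "bdd_borel g" unfolding g_def by (intro bdd_borel_cmult bdd_borel_children f)
  have g2: "bdd_borel (\<lambda>z. (g z)\<^sup>2)" by (intro bdd_borel_power2 g)
  have f2: "bdd_borel (\<lambda>y. (f y)\<^sup>2)" by (intro bdd_borel_power2 f)
  have Pg: "P g y = 2 * Q f y" for y unfolding g_def P_cmult by (simp add: Q_eq_P[OF f])
  have S: "S (Suc k) f \<omega> = (\<Sum>u\<in>Gen k. g (offspring X u \<omega>))" for \<omega>
    by (simp add: gen_sum_def sum_Gen_Suc offspring_def g_def add_divide_distrib distrib_left)
  have le: "P (\<lambda>z. (g z)\<^sup>2) y - (P g y)\<^sup>2 \<le> 4 * Q (\<lambda>y. (f y)\<^sup>2) y" for y
  proof -
    have "P (\<lambda>z. (g z)\<^sup>2) y \<le> P (\<lambda>z. 4 * ?c (\<lambda>y. (f y)\<^sup>2) z) y"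
    proof (intro P_mono g2 bdd_borel_cmult bdd_borel_children f2)
      fix z :: "'a \<times> 'a \<times> 'a"
      show "(g z)\<^sup>2 \<le> 4 * ?c (\<lambda>y. (f y)\<^sup>2) z"
        using sum_squares_ge_zero[of "f (fst (snd z)) - f (snd (snd z))" 0]
        by (simp add: g_def power2_eq_square algebra_simps)
    qed
    also have "\<dots> = 4 * Q (\<lambda>y. (f y)\<^sup>2) y" unfolding P_cmult by (simp add: Q_eq_P[OF f2])
    finally show ?thesis using zero_le_power2[of "P g y"] by linarith
  qed
  have "expectation (\<lambda>\<omega>. (S (Suc k) f \<omega>)\<^sup>2)
      = expectation (\<lambda>\<omega>. (S k (P g) \<omega>)\<^sup>2) + expectation (S k (\<lambda>y. P (\<lambda>z. (g z)\<^sup>2) y - (P g y)\<^sup>2))"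
    unfolding S by (rule second_moment_offspring_sum[OF g])
  also have "expectation (\<lambda>\<omega>. (S k (P g) \<omega>)\<^sup>2) = 4 * expectation (\<lambda>\<omega>. (S k (Q f) \<omega>)\<^sup>2)"
    by (simp add: S_cmult Pg[abs_def] power_mult_distrib)
  also have "expectation (S k (\<lambda>y. P (\<lambda>z. (g z)\<^sup>2) y - (P g y)\<^sup>2)) \<le> expectation (S k (\<lambda>y. 4 * Q (\<lambda>y. (f y)\<^sup>2) y))"
    by (intro expectation_S_mono le bdd_borel_diff bdd_borel_P g2 bdd_borel_power2 g bdd_borel_cmult bdd_borel_Q f2)
  also have "\<dots> = 2 * expectation (S (Suc k) (\<lambda>y. (f y)\<^sup>2))"
    by (simp add: expectation_S_Suc[OF f2] S_cmult)
  finally show ?thesis by simp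
qed

text \<open>Unrolling the recursion, \<open>(Q ^^ j) f\<close> is met at generation
  \<open>k - j\<close> with weight \<open>4 ^ j\<close>, and
  \<open>4 ^ j * 2 ^ (k - j) = 2 ^ k * 2 ^ j\<close>: the correlation between relatives costs
  \<open>2 ^ j\<close>, to be paid by the decay of \<open>c j\<close>. The hypothesis on
  \<open>B\<close> controls \<open>V\<^sup>2\<close> along the tree, stated through bounded
  minorants since \<open>V\<close> itself may be unbounded.\<close>

lemma second_moment_bound:
  assumes B: "\<And>w r C. bdd_borel w \<Longrightarrow> 0 \<le> C \<Longrightarrow> (\<And>y. w y \<le> C * (V y)\<^sup>2) \<Longrightarrow> expectation (S r w) \<le> C * 2 ^ r * B"
    and f: "bdd_borel f" and c: "\<And>j y. \<bar>(Q ^^ j) f y\<bar> \<le> c j * V y"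
  shows "expectation (\<lambda>\<omega>. (S k f \<omega>)\<^sup>2) \<le> 2 ^ Suc k * B * (\<Sum>j\<le>k. 2 ^ j * (c j)\<^sup>2)"
proof -
  have B': "expectation (S r (\<lambda>y. (f y)\<^sup>2)) \<le> (c 0)\<^sup>2 * 2 ^ r * B"
    if "bdd_borel f" "\<And>y. \<bar>f y\<bar> \<le> c 0 * V y" for f c r
  proof (rule B)
    show "(f y)\<^sup>2 \<le> (c 0)\<^sup>2 * (V y)\<^sup>2" for y
      using power_mono[OF that(2)[of y], of 2] by (simp add: power_mult_distrib)
  qed (auto intro: bdd_borel_power2 that)
  have "0 \<le> B" using B[of "\<lambda>_. 0" 1 0] by (simp add: gen_sum_def[abs_def])
  show ?thesis using f c
  proof (induction k arbitrary: f c)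
    case 0
    have "Gen 0 = {[]}" by (simp add: Gen_def)
    then have "(S 0 f \<omega>)\<^sup>2 = S 0 (\<lambda>y. (f y)\<^sup>2) \<omega>" for \<omega> by (auto simp: gen_sum_def)
    moreover have "expectation (S 0 (\<lambda>y. (f y)\<^sup>2)) \<le> (c 0)\<^sup>2 * 2 ^ 0 * B"
      using 0(2)[of 0] by (intro B' 0(1)) auto
    moreover have "0 \<le> (c 0)\<^sup>2 * B" using \<open>0 \<le> B\<close> by auto
    ultimately show ?case by (simp add: mult.commute)
  next
    case (Suc k)
    have IH: "expectation (\<lambda>\<omega>. (S k (Q f) \<omega>)\<^sup>2) \<le> 2 ^ Suc k * B * (\<Sum>j\<le>k. 2 ^ j * (c (Suc j))\<^sup>2)"
      using Suc.prems(2)[of "Suc _"] 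
      by (intro Suc.IH bdd_borel_Q Suc.prems(1)) (simp add: Q_power_Suc_right del: funpow.simps)
    have "expectation (S (Suc k) (\<lambda>y. (f y)\<^sup>2)) \<le> (c 0)\<^sup>2 * 2 ^ Suc k * B"
      using Suc.prems(2)[of 0] by (intro B' Suc.prems(1)) auto
    then have "expectation (\<lambda>\<omega>. (S (Suc k) f \<omega>)\<^sup>2)
      \<le> 4 * (2 ^ Suc k * B * (\<Sum>j\<le>k. 2 ^ j * (c (Suc j))\<^sup>2)) + 2 * ((c 0)\<^sup>2 * 2 ^ Suc k * B)"
      using second_moment_Suc[OF Suc.prems(1), of k] IH by linarith
    \<comment> \<open>Of the factor 4, one 2 counts the new generation and the other turns the
      weight \<open>2 ^ j\<close> into \<open>2 ^ Suc j\<close>.\<close>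
    also have "\<dots> = 2 ^ Suc (Suc k) * B * (\<Sum>j\<le>Suc k. 2 ^ j * (c j)\<^sup>2)"
      unfolding sum.atMost_Suc_shift by (simp add: sum_distrib_left algebra_simps)
    finally show ?case .
  qed
qed

section \<open>Martingale increments over the generations\<close>

definition centered :: "('a \<times> 'a \<times> 'a \<Rightarrow> real) \<Rightarrow> 'a \<times> 'a \<times> 'a \<Rightarrow> real" where
  "centered g z = g z - P g (fst z)"

definition cond_var :: "('a \<times> 'a \<times> 'a \<Rightarrow> real) \<Rightarrow> 'a \<Rightarrow> real" where
  "cond_var g y = P (\<lambda>z. (g z)\<^sup>2) y - (P g y)\<^sup>2"

definition mart_incr :: "nat \<Rightarrow> ('a \<times> 'a \<times> 'a \<Rightarrow> real) \<Rightarrow> 'w \<Rightarrow> real" where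
  "mart_incr k g \<omega> = (\<Sum>u\<in>Gen k. centered g (offspring X u \<omega>))"

lemma bdd_borel_centered: "bdd_borel g \<Longrightarrow> bdd_borel (centered g)"
  unfolding centered_def[abs_def]
  by (intro bdd_borel_diff bdd_borel_compose[OF bdd_borel_P]) auto

lemma centered_measurable [measurable]:
  "bdd_borel g \<Longrightarrow> centered g \<in> borel_measurable borel"
  by (intro bdd_borel_measurable bdd_borel_centered)

lemma centered_abs_le:
  assumes "bdd_borel g" "\<And>z. \<bar>g z\<bar> \<le> \<kappa>" shows "\<bar>centered g z\<bar> \<le> 2 * \<kappa>"
  using assms(2)[of z] P_abs_le[OF assms, of "fst z"] unfolding centered_def by linarith

lemma P_centered: "bdd_borel g \<Longrightarrow> P (centered g) y = 0"
proof -
  assume g: "bdd_borel g"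
  interpret K: prob_space "kernel_meas p y" by (rule prob_space_kernel)
  show ?thesis
    using kernel_integrable3[OF g, of y] K.prob_space by (simp add: P_def centered_def)
qed

lemma P_centered_power2:
  assumes g: "bdd_borel g" shows "P (\<lambda>z. (centered g z)\<^sup>2) y = cond_var g y"
proof -
  interpret K: prob_space "kernel_meas p y" by (rule prob_space_kernel)
  have [simp]: "integrable (kernel_meas p y) (\<lambda>z. (g (y, z))\<^sup>2)"
    using kernel_integrable3[OF bdd_borel_power2[OF g]] .
  have "P (\<lambda>z. (centered g z)\<^sup>2) y
    = (\<integral>z. (g (y, z))\<^sup>2 - 2 * P g y * g (y, z) + (P g y)\<^sup>2 \<partial>kernel_meas p y)"
    unfolding P_def[of "\<lambda>z. (centered g z)\<^sup>2"]
    by (intro Bochner_Integration.integral_cong refl) (simp add: centered_def power2_diff)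
  also have "\<dots> = P (\<lambda>z. (g z)\<^sup>2) y - 2 * P g y * P g y + (P g y)\<^sup>2"
    using kernel_integrable3[OF g, of y] K.prob_space by (simp add: P_def)
  finally show ?thesis by (simp add: cond_var_def power2_eq_square)
qed

lemma cond_var_nonneg: "bdd_borel g \<Longrightarrow> 0 \<le> cond_var g y"
  using P_mono[of "\<lambda>_. 0" "\<lambda>z. (centered g z)\<^sup>2" y]
  by (simp add: P_centered_power2 bdd_borel_power2 bdd_borel_centered)

lemma cond_var_le: "cond_var g y \<le> P (\<lambda>z. (g z)\<^sup>2) y"
  by (simp add: cond_var_def)

lemma bdd_borel_cond_var: "bdd_borel g \<Longrightarrow> bdd_borel (cond_var g)"
  unfolding cond_var_def[abs_def] by (intro bdd_borel_diff bdd_borel_P bdd_borel_power2)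

text \<open>A crude bound that grows with \<open>k\<close>; it only serves to make integrals
  exist.\<close>

lemma mart_incr_bounded:
  assumes "bdd_borel g" obtains C where "\<And>\<omega>. \<bar>mart_incr k g \<omega>\<bar> \<le> C"
proof -
  obtain C where C: "0 < C" "\<And>z. \<bar>centered g z\<bar> \<le> C"
    by (rule bdd_borelE[OF bdd_borel_centered[OF assms]]) blast
  have "\<bar>mart_incr k g \<omega>\<bar> \<le> 2 ^ k * C" for \<omega>
    unfolding mart_incr_def
    using order_trans[OF sum_abs sum_mono[of "Gen k" "\<lambda>u. \<bar>centered g (offspring X u \<omega>)\<bar>" "\<lambda>_. C"]] C by auto
  then show ?thesis using that by blast
qed

text \<open>The increment of generation \<open>k\<close> looks at children, which live in generation
  \<open>k + 1\<close>. Hence the strict inequality: at time \<open>n\<close> the increments before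
  \<open>n\<close> are known and the \<open>n\<close>-th is still to come.\<close>

lemma mart_incr_measurable_tree:
  assumes g: "bdd_borel g" and "k < n" shows "mart_incr k g \<in> borel_measurable (\<FF> n)"
  unfolding mart_incr_def[abs_def]
proof (rule borel_measurable_sum)
  fix u assume "u \<in> Gen k"
  then have Xuv [measurable]: "X (u @ v) \<in> borel_measurable (\<FF> n)" if "length v \<le> 1" for v
    using that assms(2) by (intro X_measurable_tree) (auto simp: Gen_def)
  have [measurable]: "X u \<in> borel_measurable (\<FF> n)" using Xuv[of "[]"] by simp
  have "offspring X u \<in> borel_measurable (\<FF> n)" unfolding offspring_def[abs_def] by measurable
  then show "(\<lambda>\<omega>. centered g (offspring X u \<omega>)) \<in> borel_measurable (\<FF> n)"
    using centered_measurable[OF g] by measurable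
qed

lemma mart_incr_measurable [measurable]:
  "bdd_borel g \<Longrightarrow> mart_incr k g \<in> borel_measurable M"
  by (rule measurable_from_subalg[OF subalgebra_tree mart_incr_measurable_tree]) auto

text \<open>Increments are orthogonal, because the new one has conditional mean zero given the past.
  The function may change with the generation, so that unobserved generations can later be switched
  off by a weight.\<close>

lemma mart_second_moment:
  assumes g: "\<And>k. bdd_borel (g k)"
  shows "expectation (\<lambda>\<omega>. (\<Sum>k<n. mart_incr k (g k) \<omega>)\<^sup>2) = (\<Sum>k<n. expectation (S k (cond_var (g k))))"
proof (induction n)
  case 0 show ?case by simp
next
  case (Suc n)
  define T where "T \<omega> = (\<Sum>k<n. mart_incr k (g k) \<omega>)" for \<omega>
  have "\<forall>k. \<exists>C. \<forall>\<omega>. \<bar>mart_incr k (g k) \<omega>\<bar> \<le> C" by (meson mart_incr_bounded g)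
  from choice[OF this] obtain C where "\<forall>k \<omega>. \<bar>mart_incr k (g k) \<omega>\<bar> \<le> C k" by (rule exE)
  then have C: "\<And>k \<omega>. \<bar>mart_incr k (g k) \<omega>\<bar> \<le> C k" by simp
  have T: "\<bar>T \<omega>\<bar> \<le> (\<Sum>k<n. C k)" for \<omega>
    unfolding T_def by (rule order_trans[OF sum_abs sum_mono]) (rule C)
  have Tm: "T \<in> borel_measurable (\<FF> n)"
    unfolding T_def[abs_def] by (intro borel_measurable_sum mart_incr_measurable_tree g) auto
  have [measurable]: "T \<in> borel_measurable M" "\<And>k. mart_incr k (g k) \<in> borel_measurable M"
    by (auto intro: measurable_from_subalg[OF subalgebra_tree Tm] mart_incr_measurable g)
  have i1: "integrable M (\<lambda>\<omega>. (T \<omega>)\<^sup>2)"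
    using power_mono[OF T abs_ge_zero, where n = 2]
    by (intro integrable_const_bound[where B = "(\<Sum>k<n. C k)\<^sup>2"]) simp_all
  have i2: "integrable M (\<lambda>\<omega>. (mart_incr n (g n) \<omega>)\<^sup>2)"
    using power_mono[OF C[of n] abs_ge_zero, where n = 2]
    by (intro integrable_const_bound[where B = "(C n)\<^sup>2"]) simp_all
  have i3: "integrable M (\<lambda>\<omega>. T \<omega> * centered (g n) (offspring X u \<omega>))" for u
  proof -
    obtain D where D: "0 < D" "\<And>z. \<bar>centered (g n) z\<bar> \<le> D"
      by (rule bdd_borelE[OF bdd_borel_centered[OF g]]) blast
    have "\<bar>T \<omega> * centered (g n) (offspring X u \<omega>)\<bar> \<le> (\<Sum>k<n. C k) * D" for \<omega>
      unfolding abs_mult by (intro mult_mono T D order_trans[OF abs_ge_zero T]) auto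
    then show ?thesis
      using centered_measurable[OF g] by (intro integrable_const_bound[where B = "(\<Sum>k<n. C k) * D"]) auto
  qed
  have cross: "expectation (\<lambda>\<omega>. T \<omega> * mart_incr n (g n) \<omega>) = 0"
    unfolding mart_incr_def sum_distrib_left
    by (subst Bochner_Integration.integral_sum[OF i3])
       (simp add: expectation_single[OF Tm T bdd_borel_centered[OF g]] P_centered[OF g])
  have i4: "integrable M (\<lambda>\<omega>. T \<omega> * mart_incr n (g n) \<omega>)"
    unfolding mart_incr_def sum_distrib_left using i3 by auto
  have last: "expectation (\<lambda>\<omega>. (mart_incr n (g n) \<omega>)\<^sup>2) = expectation (S n (cond_var (g n)))"
    unfolding mart_incr_def second_moment_offspring_sum[OF bdd_borel_centered[OF g]]
    by (simp add: P_centered_power2[OF g] P_centered[OF g] gen_sum_def[abs_def])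
  have "expectation (\<lambda>\<omega>. (\<Sum>k<Suc n. mart_incr k (g k) \<omega>)\<^sup>2)
     = expectation (\<lambda>\<omega>. (T \<omega>)\<^sup>2 + (mart_incr n (g n) \<omega>)\<^sup>2 + 2 * (T \<omega> * mart_incr n (g n) \<omega>))"
    by (intro Bochner_Integration.integral_cong refl)
       (simp add: T_def power2_sum)
  also have "\<dots> = expectation (\<lambda>\<omega>. (T \<omega>)\<^sup>2) + expectation (S n (cond_var (g n)))"
    using i1 i2 i4 cross last by simp
  finally show ?case using Suc.IH by (simp add: T_def)
qed


text \<open>Bridge from complex factors to the real Markov property: expand the product over the set
  \<open>B\<close> of vertices that contribute their real part. Each term is again a product of one
  real test function per vertex.\<close>

lemma prod_complex_split:
  fixes a b :: "'i \<Rightarrow> real"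
  assumes "finite A"
  shows "(\<Prod>u\<in>A. complex_of_real (a u) + \<i> * complex_of_real (b u))
       = (\<Sum>B\<in>Pow A. \<i> ^ card (A - B) * complex_of_real (\<Prod>u\<in>A. if u \<in> B then a u else b u))"
  unfolding prod_add[OF assms]
proof (intro sum.cong refl)
  fix B assume "B \<in> Pow A"
  then have B: "B \<subseteq> A" "A = B \<union> (A - B)" "B \<inter> (A - B) = {}" by auto
  have fin: "finite B" "finite (A - B)" using B assms by (auto intro: finite_subset)
  have "(\<Prod>u\<in>A. if u \<in> B then a u else b u) = (\<Prod>u\<in>B. a u) * (\<Prod>u\<in>A - B. b u)"
    by (subst B(2), subst prod.union_disjoint[OF fin B(3)]) simp
  then show "(\<Prod>u\<in>B. complex_of_real (a u)) * (\<Prod>u\<in>A - B. \<i> * complex_of_real (b u))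
    = \<i> ^ card (A - B) * complex_of_real (\<Prod>u\<in>A. if u \<in> B then a u else b u)"
    by (simp add: prod.distrib mult_ac)
qed

lemma expectation_prod_complex_real:
  fixes H :: "'w \<Rightarrow> real"
  assumes H: "H \<in> borel_measurable (\<FF> k)" "\<And>\<omega>. \<bar>H \<omega>\<bar> \<le> C"
    and ab: "bdd_borel a" "bdd_borel b"
  shows "(CLINT \<omega>|M. H \<omega> * (\<Prod>u\<in>Gen k. complex_of_real (a (offspring X u \<omega>)) + \<i> * complex_of_real (b (offspring X u \<omega>))))
       = (CLINT \<omega>|M. H \<omega> * (\<Prod>u\<in>Gen k. complex_of_real (P a (X u \<omega>)) + \<i> * complex_of_real (P b (X u \<omega>))))"
proof -
  have Hm [measurable]: "H \<in> borel_measurable M"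
    by (rule measurable_from_subalg[OF subalgebra_tree H(1)])
  let ?s = "\<lambda>B u. if u \<in> B then a else b"
  have s: "bdd_borel (?s B u)" for B and u :: "bool list" using ab by simp
  have int: "integrable M (\<lambda>\<omega>. H \<omega> * (\<Prod>u\<in>Gen k. f u (Y u \<omega>)))"
    if f: "\<And>u. bdd_borel (f u)" and Y: "\<And>u. Y u \<in> borel_measurable M"
    for f :: "bool list \<Rightarrow> 'c::second_countable_topology \<Rightarrow> real" and Y
  proof -
    have [measurable]: "\<And>u. f u \<in> borel_measurable borel" "\<And>u. Y u \<in> borel_measurable M"
      using f Y by (auto intro: bdd_borel_measurable)
    have "\<forall>u. \<exists>D. \<forall>z. \<bar>f u z\<bar> \<le> D" using f by (meson bdd_borelE)
    from choice[OF this] obtain D where "\<forall>u z. \<bar>f u z\<bar> \<le> D u" by (rule exE)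
    then have D: "\<And>u z. \<bar>f u z\<bar> \<le> D u" by simp
    have "\<bar>\<Prod>u\<in>Gen k. f u (Y u \<omega>)\<bar> \<le> (\<Prod>u\<in>Gen k. D u)" for \<omega>
      unfolding abs_prod by (intro prod_mono) (auto simp: D)
    then have "\<bar>H \<omega> * (\<Prod>u\<in>Gen k. f u (Y u \<omega>))\<bar> \<le> C * (\<Prod>u\<in>Gen k. D u)" for \<omega>
      unfolding abs_mult using H(2) abs_ge_zero[of "H \<omega>"]
      by (intro mult_mono) (auto intro: order_trans[OF abs_ge_zero])
    then show ?thesis
      by (intro integrable_const_bound[where B = "C * (\<Prod>u\<in>Gen k. D u)"]) auto
  qed
  have expand: "(CLINT \<omega>|M. H \<omega> * (\<Prod>u\<in>Gen k. complex_of_real (f (Y u \<omega>)) + \<i> * complex_of_real (g (Y u \<omega>))))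
    = (\<Sum>B\<in>Pow (Gen k). \<i> ^ card (Gen k - B) *
         complex_of_real (expectation (\<lambda>\<omega>. H \<omega> * (\<Prod>u\<in>Gen k. (if u \<in> B then f else g) (Y u \<omega>)))))"
    if f: "bdd_borel f" "bdd_borel g" and Y: "\<And>u. Y u \<in> borel_measurable M"
    for f g :: "'c::second_countable_topology \<Rightarrow> real" and Y
  proof -
    have i: "integrable M (\<lambda>\<omega>. H \<omega> * (\<Prod>u\<in>Gen k. (if u \<in> B then f else g) (Y u \<omega>)))" for B
      using f by (intro int Y) auto
    have "(CLINT \<omega>|M. H \<omega> * (\<Prod>u\<in>Gen k. complex_of_real (f (Y u \<omega>)) + \<i> * complex_of_real (g (Y u \<omega>))))
      = (CLINT \<omega>|M. (\<Sum>B\<in>Pow (Gen k). \<i> ^ card (Gen k - B) *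
         complex_of_real (H \<omega> * (\<Prod>u\<in>Gen k. (if u \<in> B then f else g) (Y u \<omega>)))))"
      by (intro Bochner_Integration.integral_cong refl)
         (simp add: prod_complex_split sum_distrib_left mult_ac if_distrib[where f = "\<lambda>h. h _"] if_distrib[where f = complex_of_real] cong: if_cong)
    also have "\<dots> = (\<Sum>B\<in>Pow (Gen k). CLINT \<omega>|M. \<i> ^ card (Gen k - B) *
         complex_of_real (H \<omega> * (\<Prod>u\<in>Gen k. (if u \<in> B then f else g) (Y u \<omega>))))"
      by (intro Bochner_Integration.integral_sum integrable_mult_right integrable_of_real i)
    finally show ?thesis
      by (simp only: integral_mult_right_zero integral_complex_of_real)
  qed
  have ex: "expectation (\<lambda>\<omega>. H \<omega> * (\<Prod>u\<in>Gen k. (?s B u) (offspring X u \<omega>)))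
    = expectation (\<lambda>\<omega>. H \<omega> * (\<Prod>u\<in>Gen k. (if u \<in> B then P a else P b) (X u \<omega>)))" for B
    unfolding expectation_prod[OF H s]
    by (simp add: if_distrib[where f = P] cong: if_cong)
  show ?thesis
    by (subst expand[OF ab], simp, subst expand[OF bdd_borel_P[OF ab(1)] bdd_borel_P[OF ab(2)]], simp)
       (simp only: ex)
qed

text \<open>A complex \<open>H\<close> is reduced to the previous case by splitting it into real and
  imaginary part. The bounds by 1 on all factors keep every integrand bounded by 1, which justifies
  the splitting on both sides.\<close>

lemma expectation_prod_complex:
  assumes H: "H \<in> borel_measurable (\<FF> k)" "\<And>\<omega>. cmod (H \<omega>) \<le> 1"
    and ab: "bdd_borel a" "bdd_borel b" and ab1: "\<And>z. cmod (complex_of_real (a z) + \<i> * complex_of_real (b z)) \<le> 1"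
    and P1: "\<And>y. cmod (complex_of_real (P a y) + \<i> * complex_of_real (P b y)) \<le> 1"
  shows "(CLINT \<omega>|M. H \<omega> * (\<Prod>u\<in>Gen k. complex_of_real (a (offspring X u \<omega>)) + \<i> * complex_of_real (b (offspring X u \<omega>))))
       = (CLINT \<omega>|M. H \<omega> * (\<Prod>u\<in>Gen k. complex_of_real (P a (X u \<omega>)) + \<i> * complex_of_real (P b (X u \<omega>))))"
    (is "(CLINT \<omega>|M. H \<omega> * ?F \<omega>) = (CLINT \<omega>|M. H \<omega> * ?G \<omega>)")
proof -
  have Hm: "H \<in> borel_measurable M"
    by (rule measurable_from_subalg[OF subalgebra_tree H(1)])
  note [measurable] = Hm bdd_borel_measurable[OF ab(1)] bdd_borel_measurable[OF ab(2)]
    bdd_borel_measurable[OF bdd_borel_P[OF ab(1)]] bdd_borel_measurable[OF bdd_borel_P[OF ab(2)]]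
  have re: "(\<lambda>\<omega>. Re (H \<omega>)) \<in> borel_measurable (\<FF> k)" "\<And>\<omega>. \<bar>Re (H \<omega>)\<bar> \<le> 1"
    and im: "(\<lambda>\<omega>. Im (H \<omega>)) \<in> borel_measurable (\<FF> k)" "\<And>\<omega>. \<bar>Im (H \<omega>)\<bar> \<le> 1"
    using H(1) order_trans[OF abs_Re_le_cmod H(2)] order_trans[OF abs_Im_le_cmod H(2)] by auto
  have split: "(CLINT \<omega>|M. H \<omega> * K \<omega>) = (CLINT \<omega>|M. Re (H \<omega>) * K \<omega>) + \<i> * (CLINT \<omega>|M. Im (H \<omega>) * K \<omega>)"
    if [measurable]: "K \<in> borel_measurable M" and K: "\<And>\<omega>. cmod (K \<omega>) \<le> 1" for K :: "'w \<Rightarrow> complex"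
  proof -
    have i: "integrable M (\<lambda>\<omega>. Re (H \<omega>) * K \<omega>)" "integrable M (\<lambda>\<omega>. Im (H \<omega>) * K \<omega>)"
      using re im by (auto intro!: integrable_const_bound[where B = 1] AE_I2 mult_le_one K simp: norm_mult)
    have "H \<omega> * K \<omega> = Re (H \<omega>) * K \<omega> + \<i> * (Im (H \<omega>) * K \<omega>)" for \<omega>
      by (subst complex_eq[of "H \<omega>"]) (simp add: algebra_simps)
    then show ?thesis using i by simp
  qed
  have F: "?F \<in> borel_measurable M" "\<And>\<omega>. cmod (?F \<omega>) \<le> 1"
    unfolding prod_norm[symmetric] by (measurable, intro prod_le_1 conjI ab1 norm_ge_zero)
  have G: "?G \<in> borel_measurable M" "\<And>\<omega>. cmod (?G \<omega>) \<le> 1"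
    unfolding prod_norm[symmetric] by (measurable, intro prod_le_1 conjI P1 norm_ge_zero)
  show ?thesis
    unfolding split[OF F] split[OF G]
    using expectation_prod_complex_real[OF re ab] expectation_prod_complex_real[OF im ab] by simp
qed

end

subsection \<open>Conditional characteristic functions\<close>

lemma abs_exp_minus_linear_le:
  fixes x :: real assumes "0 \<le> x" shows "\<bar>exp (- x) - (1 - x)\<bar> \<le> x\<^sup>2 / 2"
proof -
  have 1: "1 + x + x\<^sup>2 / 2 \<le> exp x" by (rule exp_lower_Taylor_quadratic[OF assms])
  \<comment> \<open>A lower bound on \<open>exp x\<close> is to become an upper bound on
    \<open>exp (- x)\<close>. The two quadratic polynomials \<open>1 - x + x\<^sup>2 / 2\<close> and
    \<open>1 + x + x\<^sup>2 / 2\<close> multiply to \<open>1 + x ^ 4 / 4\<close>, so the first is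
    at least \<open>exp (- x)\<close>.\<close>
  have "1 \<le> 1 + x ^ 4 / 4" by simp
  also have "1 + x ^ 4 / 4 = (1 - x + x\<^sup>2 / 2) * (1 + x + x\<^sup>2 / 2)"
    by (simp add: power2_eq_square power4_eq_xxxx field_simps)
  also have "\<dots> \<le> (1 - x + x\<^sup>2 / 2) * exp x"
  proof (rule mult_left_mono[OF 1])
    have "0 \<le> (1 - x)\<^sup>2 + 1" by simp
    then show "0 \<le> 1 - x + x\<^sup>2 / 2" by (simp add: power2_eq_square algebra_simps)
  qed
  finally have "exp (- x) \<le> 1 - x + x\<^sup>2 / 2"
    by (simp add: exp_minus field_simps)
  moreover have "1 - x \<le> exp (- x)" using exp_ge_add_one_self[of "- x"] by simp
  ultimately show ?thesis by (simp add: abs_if)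
qed

lemma abs_exp_minus_diff_le:
  fixes x y :: real assumes "0 \<le> x" "0 \<le> y" shows "\<bar>exp (- x) - exp (- y)\<bar> \<le> \<bar>x - y\<bar>"
proof -
  have *: "exp (- a) - exp (- b) \<le> b - a" if "0 \<le> a" "a \<le> b" for a b :: real
  proof -
    have "exp (- a) - exp (- b) = exp (- a) * (1 - exp (- (b - a)))"
      by (simp add: algebra_simps exp_add[symmetric])
    also have "\<dots> \<le> 1 * (b - a)"
    proof (intro mult_mono)
      show "1 - exp (- (b - a)) \<le> b - a" using exp_ge_add_one_self[of "- (b - a)"] by linarith
    qed (use that in auto)
    finally show ?thesis by simp
  qed
  show ?thesis using *[of x y] *[of y x] assms by (cases "x \<le> y") (auto simp: abs_if)
qed

lemma iexp_eq_cos_sin: "iexp s = complex_of_real (cos s) + \<i> * complex_of_real (sin s)"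
  by (simp add: cis_conv_exp[symmetric] complex_eq_iff)

context bmc begin

text \<open>Characteristic function at \<open>t\<close> of the centered summand of a vertex situated
  at \<open>y\<close>. Cosine and sine are kept apart because \<open>P\<close> acts on real
  functions.\<close>

definition cond_char :: "real \<Rightarrow> ('a \<times> 'a \<times> 'a \<Rightarrow> real) \<Rightarrow> 'a \<Rightarrow> complex" where
  "cond_char t g y = complex_of_real (P (\<lambda>z. cos (t * centered g z)) y)
     + \<i> * complex_of_real (P (\<lambda>z. sin (t * centered g z)) y)"

lemma bdd_borel_cos_sin:
  assumes "bdd_borel g"
  shows "bdd_borel (\<lambda>z. cos (t * centered g z))" "bdd_borel (\<lambda>z. sin (t * centered g z))"
  using centered_measurable[OF assms] by (auto intro!: bdd_borelI[where C = 1])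

text \<open>Both errors are linear in the conditional variance, so that summing them over the
  \<open>2 ^ k\<close> vertices of a generation yields its total conditional variance times a small
  factor. The cubic term bounds \<open>\<bar>Y\<bar> ^ 3\<close> by
  \<open>2 * \<kappa> * Y\<^sup>2\<close> in the third order expansion; the quartic one bounds the
  square of the variance by \<open>4 * \<kappa>\<^sup>2\<close> times the variance in the expansion
  of \<open>exp\<close>.\<close>

lemma cond_char_approx:
  assumes g: "bdd_borel g" and \<kappa>: "\<And>z. \<bar>g z\<bar> \<le> \<kappa>"
  shows "cmod (cond_char t g y) \<le> 1"
    and "cmod (cond_char t g y - exp (- (t\<^sup>2 / 2 * cond_var g y)))
      \<le> (\<bar>t\<bar> ^ 3 * \<kappa> / 3 + t ^ 4 * \<kappa>\<^sup>2 / 2) * cond_var g y"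
proof -
  let ?N = "kernel_meas p y"
  interpret K: prob_space ?N by (rule prob_space_kernel)
  define Y where "Y z = centered g (y, z)" for z
  have Ym: "Y \<in> borel_measurable borel"
    unfolding Y_def using centered_measurable[OF g] by measurable
  then have Y_meas [measurable]: "Y \<in> borel_measurable ?N" by (simp add: measurable_cong_sets[OF sets_kernel refl])
  have Yb: "\<bar>Y z\<bar> \<le> 2 * \<kappa>" for z unfolding Y_def by (rule centered_abs_le[OF g \<kappa>])
  have i1: "integrable ?N Y" using kernel_integrable3[OF bdd_borel_centered[OF g]] by (simp add: Y_def[abs_def])
  have i2: "integrable ?N (\<lambda>z. (Y z)\<^sup>2)"
    using kernel_integrable3[OF bdd_borel_power2[OF bdd_borel_centered[OF g]]] by (simp add: Y_def)
  have m1: "K.expectation Y = 0" using P_centered[OF g, of y] by (simp add: P_def Y_def[abs_def])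
  have m2: "K.expectation (\<lambda>z. (Y z)\<^sup>2) = cond_var g y" using P_centered_power2[OF g, of y] by (simp add: P_def Y_def)
  have ch: "char (distr ?N borel Y) t = cond_char t g y"
  proof -
    have "char (distr ?N borel Y) t = (CLINT z|?N. iexp (t * Y z))"
      unfolding char_def by (subst integral_distr) auto
    also have "\<dots> = (CLINT z|?N. complex_of_real (cos (t * Y z)) + \<i> * complex_of_real (sin (t * Y z)))"
      unfolding iexp_eq_cos_sin ..
    also have "\<dots> = complex_of_real (K.expectation (\<lambda>z. cos (t * Y z))) + \<i> * complex_of_real (K.expectation (\<lambda>z. sin (t * Y z)))"
      using kernel_integrable3[OF bdd_borel_cos_sin(1)[OF g], of y t] kernel_integrable3[OF bdd_borel_cos_sin(2)[OF g], of y t]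
      by (simp add: Y_def)
    finally show ?thesis by (simp add: cond_char_def P_def Y_def)
  qed
  interpret R: real_distribution "distr ?N borel Y" by (rule K.real_distribution_distr) measurable
  show "cmod (cond_char t g y) \<le> 1" unfolding ch[symmetric] by (rule R.cmod_char_le_1)
  have "cmod (cond_char t g y - (1 - t\<^sup>2 * cond_var g y / 2))
      \<le> t\<^sup>2 / 6 * K.expectation (\<lambda>z. min (6 * (Y z)\<^sup>2) (\<bar>t\<bar> * \<bar>Y z\<bar> ^ 3))"
    unfolding ch[symmetric] by (rule K.char_approx3'[OF Y_meas i1 i2 m1 _ refl]) (simp add: m1 m2)
  also have "\<dots> \<le> t\<^sup>2 / 6 * K.expectation (\<lambda>z. \<bar>t\<bar> * (2 * \<kappa>) * (Y z)\<^sup>2)"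
  proof (intro mult_left_mono integral_mono)
    show "integrable ?N (\<lambda>z. min (6 * (Y z)\<^sup>2) (\<bar>t\<bar> * \<bar>Y z\<bar> ^ 3))"
      by (rule Bochner_Integration.integrable_bound[of _ "\<lambda>z. 6 * (Y z)\<^sup>2"]) (auto intro: i2)
    fix z
    have "\<bar>Y z\<bar> ^ 3 = \<bar>Y z\<bar> * (Y z)\<^sup>2" by (simp add: power3_eq_cube power2_eq_square)
    also have "\<dots> \<le> 2 * \<kappa> * (Y z)\<^sup>2" by (intro mult_right_mono Yb) simp
    finally have "\<bar>t\<bar> * \<bar>Y z\<bar> ^ 3 \<le> \<bar>t\<bar> * (2 * \<kappa> * (Y z)\<^sup>2)" by (rule mult_left_mono) simp
    then show "min (6 * (Y z)\<^sup>2) (\<bar>t\<bar> * \<bar>Y z\<bar> ^ 3) \<le> \<bar>t\<bar> * (2 * \<kappa>) * (Y z)\<^sup>2" by (simp add: mult.assoc)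
  qed (use i2 in auto)
  also have "\<dots> = \<bar>t\<bar> ^ 3 * \<kappa> / 3 * cond_var g y"
    unfolding integral_mult_right_zero m2 by (simp add: power3_eq_cube power2_eq_square)
  finally have A: "cmod (cond_char t g y - (1 - t\<^sup>2 * cond_var g y / 2)) \<le> \<bar>t\<bar> ^ 3 * \<kappa> / 3 * cond_var g y" .
  have v0: "0 \<le> cond_var g y" by (rule cond_var_nonneg[OF g])
  have "cond_var g y \<le> K.expectation (\<lambda>z. 4 * \<kappa>\<^sup>2)"
    unfolding m2[symmetric] using power_mono[OF Yb abs_ge_zero, where n = 2]
    by (intro integral_mono i2) (auto simp: power_mult_distrib)
  then have v4: "cond_var g y \<le> 4 * \<kappa>\<^sup>2" by (simp add: K.prob_space[simplified])
  define x where "x = t\<^sup>2 / 2 * cond_var g y"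
  have "\<bar>exp (- x) - (1 - x)\<bar> \<le> x\<^sup>2 / 2" by (rule abs_exp_minus_linear_le) (simp add: x_def v0)
  also have "x\<^sup>2 / 2 = t ^ 4 / 8 * cond_var g y * cond_var g y"
    by (simp add: x_def power2_eq_square power4_eq_xxxx)
  also have "\<dots> \<le> t ^ 4 / 8 * cond_var g y * (4 * \<kappa>\<^sup>2)" by (intro mult_left_mono v4) (simp add: v0)
  finally have "\<bar>exp (- x) - (1 - x)\<bar> \<le> t ^ 4 * \<kappa>\<^sup>2 / 2 * cond_var g y" by (simp add: mult_ac)
  then have B: "cmod (complex_of_real (1 - x) - complex_of_real (exp (- x))) \<le> t ^ 4 * \<kappa>\<^sup>2 / 2 * cond_var g y"
    unfolding of_real_diff[symmetric] norm_of_real by (simp only: abs_minus_commute)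
  have "cmod (cond_char t g y - complex_of_real (exp (- x)))
     \<le> cmod (cond_char t g y - complex_of_real (1 - x)) + cmod (complex_of_real (1 - x) - complex_of_real (exp (- x)))"
    using norm_triangle_ineq[of "cond_char t g y - complex_of_real (1 - x)" "complex_of_real (1 - x) - complex_of_real (exp (- x))"]
    by simp
  moreover have "1 - t\<^sup>2 * cond_var g y / 2 = 1 - x" by (simp add: x_def)
  ultimately show "cmod (cond_char t g y - exp (- (t\<^sup>2 / 2 * cond_var g y)))
      \<le> (\<bar>t\<bar> ^ 3 * \<kappa> / 3 + t ^ 4 * \<kappa>\<^sup>2 / 2) * cond_var g y"
    using A B unfolding x_def[symmetric] by (simp add: distrib_right)
qed

lemma cond_char_measurable [measurable]:
  assumes g: "bdd_borel g" shows "cond_char t g \<in> borel_measurable borel"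
  unfolding cond_char_def[abs_def]
  using bdd_borel_cos_sin[OF g, of t, THEN bdd_borel_P, THEN bdd_borel_measurable] by measurable

lemma iexp_mart_incr:
  "iexp (t * mart_incr k g \<omega>)
     = (\<Prod>u\<in>Gen k. complex_of_real (cos (t * centered g (offspring X u \<omega>)))
          + \<i> * complex_of_real (sin (t * centered g (offspring X u \<omega>))))"
proof -
  have "iexp (t * mart_incr k g \<omega>) = (\<Prod>u\<in>Gen k. iexp (t * centered g (offspring X u \<omega>)))"
    by (simp add: mart_incr_def sum_distrib_left exp_sum of_real_sum)
  then show ?thesis unfolding iexp_eq_cos_sin .
qed

text \<open>Two replacements are made under the expectation. First the factors are exchanged for
  Gaussian ones; as all have modulus at most 1, the error of the product is at most the sum of the
  errors. Their product is \<open>exp (- (t\<^sup>2 / 2 * S k (cond_var g)))\<close>, still random.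
  Then the random exponent becomes \<open>\<sigma>\<close>, at a cost that is linear since
  \<open>exp (- r)\<close> is 1-Lipschitz for \<open>r \<ge> 0\<close>.\<close>

lemma mart_step_bound:
  assumes g: "bdd_borel g" and \<kappa>: "\<And>z. \<bar>g z\<bar> \<le> \<kappa>" and \<sigma>: "0 \<le> \<sigma>"
    and H: "H \<in> borel_measurable (\<FF> k)" "\<And>\<omega>. cmod (H \<omega>) \<le> 1"
  shows "cmod ((CLINT \<omega>|M. H \<omega> * iexp (t * mart_incr k g \<omega>)) - (CLINT \<omega>|M. H \<omega>) * exp (- (t\<^sup>2 / 2 * \<sigma>)))
    \<le> t\<^sup>2 / 2 * expectation (\<lambda>\<omega>. \<bar>S k (cond_var g) \<omega> - \<sigma>\<bar>)
      + (\<bar>t\<bar> ^ 3 * \<kappa> / 3 + t ^ 4 * \<kappa>\<^sup>2 / 2) * expectation (S k (cond_var g))"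
proof -
  define W where "W \<omega> = (\<Prod>u\<in>Gen k. cond_char t g (X u \<omega>))" for \<omega>
  define E where "E = complex_of_real (exp (- (t\<^sup>2 / 2 * \<sigma>)))"
  let ?c = "\<bar>t\<bar> ^ 3 * \<kappa> / 3 + t ^ 4 * \<kappa>\<^sup>2 / 2"
  have Hm [measurable]: "H \<in> borel_measurable M"
    by (rule measurable_from_subalg[OF subalgebra_tree H(1)])
  have Wm [measurable]: "W \<in> borel_measurable M" unfolding W_def[abs_def] using cond_char_measurable[OF g] by measurable
  have W1: "cmod (W \<omega>) \<le> 1" for \<omega>
    unfolding W_def prod_norm[symmetric] by (intro prod_le_1) (auto intro: cond_char_approx(1)[OF g \<kappa>])
  have v: "bdd_borel (cond_var g)" by (rule bdd_borel_cond_var[OF g])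
  have i: "integrable M (\<lambda>\<omega>. H \<omega> * W \<omega>)" "integrable M H"
    using W1 H(2) by (auto intro!: integrable_const_bound[where B = 1] AE_I2 mult_le_one simp: norm_mult)
  have iS: "integrable M (S k (cond_var g))" by (rule integrable_S[OF v])
  have "cmod (complex_of_real (cos s) + \<i> * complex_of_real (sin s)) \<le> 1" for s
    by (simp add: cmod_def)
  then have "(CLINT \<omega>|M. H \<omega> * iexp (t * mart_incr k g \<omega>)) = (CLINT \<omega>|M. H \<omega> * W \<omega>)"
    unfolding iexp_mart_incr W_def cond_char_def
    by (intro expectation_prod_complex H bdd_borel_cos_sin g)
       (use cond_char_approx(1)[OF g \<kappa>] in \<open>auto simp: cond_char_def\<close>)
  then have "(CLINT \<omega>|M. H \<omega> * iexp (t * mart_incr k g \<omega>)) - (CLINT \<omega>|M. H \<omega>) * E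
      = (CLINT \<omega>|M. H \<omega> * W \<omega> - H \<omega> * E)"
    using i by simp
  also have "cmod \<dots> \<le> expectation (\<lambda>\<omega>. cmod (H \<omega> * W \<omega> - H \<omega> * E))"
    by (rule integral_norm_bound)
  also have "\<dots> \<le> expectation (\<lambda>\<omega>. t\<^sup>2 / 2 * \<bar>S k (cond_var g) \<omega> - \<sigma>\<bar> + ?c * S k (cond_var g) \<omega>)"
  proof (rule integral_mono)
    show "integrable M (\<lambda>\<omega>. cmod (H \<omega> * W \<omega> - H \<omega> * E))" using i by auto
    show "integrable M (\<lambda>\<omega>. t\<^sup>2 / 2 * \<bar>S k (cond_var g) \<omega> - \<sigma>\<bar> + ?c * S k (cond_var g) \<omega>)" using iS by auto
    fix \<omega>
    let ?e = "\<lambda>u. complex_of_real (exp (- (t\<^sup>2 / 2 * cond_var g (X u \<omega>))))"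
    have v0: "0 \<le> cond_var g y" for y by (rule cond_var_nonneg[OF g])
    have "cmod (W \<omega> - (\<Prod>u\<in>Gen k. ?e u)) \<le> (\<Sum>u\<in>Gen k. cmod (cond_char t g (X u \<omega>) - ?e u))"
      unfolding W_def by (intro norm_prod_diff cond_char_approx(1)[OF g \<kappa>]) (auto simp: v0)
    also have "\<dots> \<le> (\<Sum>u\<in>Gen k. ?c * cond_var g (X u \<omega>))"
      by (intro sum_mono cond_char_approx(2)[OF g \<kappa>])
    also have "\<dots> = ?c * S k (cond_var g) \<omega>" by (simp add: gen_sum_def sum_distrib_left)
    finally have 1: "cmod (W \<omega> - (\<Prod>u\<in>Gen k. ?e u)) \<le> ?c * S k (cond_var g) \<omega>" .
    have "(\<Prod>u\<in>Gen k. ?e u) = complex_of_real (exp (- (t\<^sup>2 / 2 * S k (cond_var g) \<omega>)))"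
      unfolding of_real_prod[symmetric] by (simp add: exp_sum[symmetric] gen_sum_def sum_distrib_left sum_negf)
    then have "cmod ((\<Prod>u\<in>Gen k. ?e u) - E) = \<bar>exp (- (t\<^sup>2 / 2 * S k (cond_var g) \<omega>)) - exp (- (t\<^sup>2 / 2 * \<sigma>))\<bar>"
      unfolding E_def of_real_diff[symmetric] by (simp only: of_real_diff[symmetric] norm_of_real)
    also have "\<dots> \<le> \<bar>t\<^sup>2 / 2 * S k (cond_var g) \<omega> - t\<^sup>2 / 2 * \<sigma>\<bar>"
      by (intro abs_exp_minus_diff_le mult_nonneg_nonneg \<sigma>) (auto simp: gen_sum_def v0 intro!: sum_nonneg)
    also have "\<dots> = t\<^sup>2 / 2 * \<bar>S k (cond_var g) \<omega> - \<sigma>\<bar>"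
      unfolding right_diff_distrib[symmetric] abs_mult by simp
    finally have 2: "cmod ((\<Prod>u\<in>Gen k. ?e u) - E) \<le> t\<^sup>2 / 2 * \<bar>S k (cond_var g) \<omega> - \<sigma>\<bar>" .
    have "cmod (H \<omega> * W \<omega> - H \<omega> * E) = cmod (H \<omega>) * cmod (W \<omega> - E)"
      unfolding right_diff_distrib[symmetric] norm_mult ..
    also have "\<dots> \<le> 1 * cmod (W \<omega> - E)" by (intro mult_right_mono H) simp
    also have "cmod (W \<omega> - E) \<le> cmod (W \<omega> - (\<Prod>u\<in>Gen k. ?e u)) + cmod ((\<Prod>u\<in>Gen k. ?e u) - E)"
      using norm_triangle_ineq[of "W \<omega> - (\<Prod>u\<in>Gen k. ?e u)" "(\<Prod>u\<in>Gen k. ?e u) - E"] by simp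
    finally show "cmod (H \<omega> * W \<omega> - H \<omega> * E) \<le> t\<^sup>2 / 2 * \<bar>S k (cond_var g) \<omega> - \<sigma>\<bar> + ?c * S k (cond_var g) \<omega>"
      using 1 2 by simp
  qed
  also have "\<dots> = t\<^sup>2 / 2 * expectation (\<lambda>\<omega>. \<bar>S k (cond_var g) \<omega> - \<sigma>\<bar>) + ?c * expectation (S k (cond_var g))"
    using iS by simp
  finally show ?thesis by (simp add: E_def)
qed

text \<open>The conditional variances are compared generation by generation with deterministic targets \<open>\<sigma> k\<close>;
  peeling off the last generation first, no stopping time is needed to control the total conditional variance.\<close>
lemma mart_clt_bound:
  assumes g: "\<And>k. bdd_borel (g k)" and \<kappa>: "\<And>k z. \<bar>g k z\<bar> \<le> \<kappa>" and \<sigma>: "\<And>k. 0 \<le> \<sigma> k"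
  shows "cmod ((CLINT \<omega>|M. iexp (t * (\<Sum>k<n. mart_incr k (g k) \<omega>))) - exp (- (t\<^sup>2 / 2 * (\<Sum>k<n. \<sigma> k))))
    \<le> (\<Sum>k<n. t\<^sup>2 / 2 * expectation (\<lambda>\<omega>. \<bar>S k (cond_var (g k)) \<omega> - \<sigma> k\<bar>)
      + (\<bar>t\<bar> ^ 3 * \<kappa> / 3 + t ^ 4 * \<kappa>\<^sup>2 / 2) * expectation (S k (cond_var (g k))))"
    (is "_ \<le> (\<Sum>k<n. ?\<epsilon> k)")
proof (induction n)
  case 0 show ?case by (simp add: prob_space)
next
  case (Suc n)
  define T where "T \<omega> = (\<Sum>k<n. mart_incr k (g k) \<omega>)" for \<omega>
  define H where "H \<omega> = iexp (t * T \<omega>)" for \<omega>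
  have "T \<in> borel_measurable (\<FF> n)"
    unfolding T_def[abs_def] by (intro borel_measurable_sum mart_incr_measurable_tree g) auto
  then have Hm: "H \<in> borel_measurable (\<FF> n)" unfolding H_def[abs_def] by measurable
  have H1: "cmod (H \<omega>) \<le> 1" for \<omega> by (simp add: H_def)
  let ?E = "complex_of_real (exp (- (t\<^sup>2 / 2 * \<sigma> n)))"
  let ?F = "complex_of_real (exp (- (t\<^sup>2 / 2 * (\<Sum>k<n. \<sigma> k))))"
  have e: "complex_of_real (exp (- (t\<^sup>2 / 2 * (\<Sum>k<Suc n. \<sigma> k)))) = ?F * ?E"
    by (simp add: of_real_mult[symmetric] exp_add[symmetric] algebra_simps del: of_real_mult)
  have h: "iexp (t * (\<Sum>k<Suc n. mart_incr k (g k) \<omega>)) = H \<omega> * iexp (t * mart_incr n (g n) \<omega>)" for \<omega>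
    by (simp add: H_def T_def exp_add[symmetric] algebra_simps)
  have "cmod ((CLINT \<omega>|M. H \<omega> * iexp (t * mart_incr n (g n) \<omega>)) - ?F * ?E)
     \<le> cmod ((CLINT \<omega>|M. H \<omega> * iexp (t * mart_incr n (g n) \<omega>)) - (CLINT \<omega>|M. H \<omega>) * ?E)
        + cmod ((CLINT \<omega>|M. H \<omega>) * ?E - ?F * ?E)"
    using norm_triangle_ineq[of "(CLINT \<omega>|M. H \<omega> * iexp (t * mart_incr n (g n) \<omega>)) - (CLINT \<omega>|M. H \<omega>) * ?E"
       "(CLINT \<omega>|M. H \<omega>) * ?E - ?F * ?E"] by simp
  also have "cmod ((CLINT \<omega>|M. H \<omega> * iexp (t * mart_incr n (g n) \<omega>)) - (CLINT \<omega>|M. H \<omega>) * ?E) \<le> ?\<epsilon> n"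
    by (rule mart_step_bound[OF g \<kappa> \<sigma> Hm H1])
  also have "cmod ((CLINT \<omega>|M. H \<omega>) * ?E - ?F * ?E) = cmod ((CLINT \<omega>|M. H \<omega>) - ?F) * cmod ?E"
    unfolding left_diff_distrib[symmetric] norm_mult ..
  also have "\<dots> \<le> cmod ((CLINT \<omega>|M. H \<omega>) - ?F) * 1"
    by (intro mult_left_mono) (auto simp: \<sigma>)
  also have "\<dots> \<le> (\<Sum>k<n. ?\<epsilon> k)" using Suc.IH by (simp add: H_def T_def)
  finally show ?case unfolding e h by simp
qed

end

subsection \<open>Kernel bias under coordinatewise Hoelder smoothness\<close>

lemma lborel_integral_affine:
  fixes f :: "'b::euclidean_space \<Rightarrow> real"
  assumes [measurable]: "f \<in> borel_measurable borel" and c: "c \<noteq> 0"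
  shows "(\<integral>z. f z \<partial>lborel) = \<bar>c\<bar> ^ DIM('b) * (\<integral>w. f (t + c *\<^sub>R w) \<partial>lborel)"
proof -
  have "(\<integral>z. f z \<partial>lborel) = (\<integral>z. f z \<partial>density (distr lborel borel (\<lambda>x. t + c *\<^sub>R x)) (\<lambda>_. \<bar>c\<bar> ^ DIM('b)))"
    using lborel_affine[OF c, of t] by simp
  also have "\<dots> = \<bar>c\<bar> ^ DIM('b) * (\<integral>w. f (t + c *\<^sub>R w) \<partial>lborel)"
    by (subst integral_density) (auto simp: integral_distr)
  finally show ?thesis .
qed

lemma lborel_integral_rescale:
  fixes f :: "'b::euclidean_space \<Rightarrow> real"
  assumes [measurable]: "f \<in> borel_measurable borel" and h: "0 < h"
  shows "(\<integral>z. f ((1 / h) *\<^sub>R (x - z)) \<partial>lborel) = h ^ DIM('b) * (\<integral>w. f w \<partial>lborel)"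
  \<comment> \<open>The substitution is \<open>z = x - h * w\<close>, a reflection; this accounts
    for the negative factor.\<close>
  using h by (subst lborel_integral_affine[of _ "- h" x]) auto

lemma lborel_integrable_affine:
  fixes f :: "'b::euclidean_space \<Rightarrow> real"
  assumes f: "integrable lborel f" and c: "c \<noteq> 0"
  shows "integrable lborel (\<lambda>w. f (t + c *\<^sub>R w))"
proof -
  have [measurable]: "f \<in> borel_measurable borel" using f by (auto dest: borel_measurable_integrable)
  have "integrable (density (distr lborel borel (\<lambda>x. t + c *\<^sub>R x)) (\<lambda>_. \<bar>c\<bar> ^ DIM('b))) f"
    using lborel_affine[OF c, of t] f by simp
  then show ?thesis
    using c by (subst (asm) integrable_density) (auto simp: integrable_distr_eq)
qed

lemma lborel_integrable_rescale:
  fixes f :: "'b::euclidean_space \<Rightarrow> real"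
  assumes f: "integrable lborel f" and h: "0 < h"
  shows "integrable lborel (\<lambda>z. f ((1 / h) *\<^sub>R (x - z)))"
  using lborel_integrable_affine[OF f, of "- 1 / h" "(1 / h) *\<^sub>R x"] h
  by (simp add: scaleR_diff_right)

text \<open>Fubini in a single coordinate without choosing coordinates: averaging \<open>G\<close> over the slab
  \<open>0 \<le> w \<bullet> b \<le> 1\<close> and all its translates along \<open>b\<close> reproduces the full integral.\<close>
lemma lborel_integral_zero_of_lines:
  fixes G :: "'b::euclidean_space \<Rightarrow> real"
  assumes G: "integrable lborel G" and b: "b \<in> Basis"
    and zero: "\<And>w. (\<integral>t. G (w + t *\<^sub>R b) \<partial>lborel) = 0"
  shows "(\<integral>w. G w \<partial>lborel) = 0"
proof -
  have [measurable]: "G \<in> borel_measurable borel" using G by (auto dest: borel_measurable_integrable)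
  have bb: "b \<bullet> b = 1" using b by simp
  define \<phi> :: "'b \<Rightarrow> real" where "\<phi> w = indicator {0..1} (w \<bullet> b)" for w
  have \<phi>m [measurable]: "\<phi> \<in> borel_measurable borel" unfolding \<phi>_def[abs_def] by measurable
  have \<phi>01: "0 \<le> \<phi> w" "\<phi> w \<le> 1" for w by (auto simp: \<phi>_def indicator_def)
  \<comment> \<open>For fixed \<open>w\<close> the shifts \<open>t\<close> whose slab contains
    \<open>w\<close> form an interval of length 1, so integrating \<open>F' w t\<close> over
    \<open>t\<close> gives back \<open>G w\<close>.\<close>
  have \<phi>t: "\<phi> (w - t *\<^sub>R b) = indicator {w \<bullet> b - 1..w \<bullet> b} t" for w t
    by (auto simp: \<phi>_def indicator_def inner_diff_left bb)
  define F' where "F' w t = \<phi> (w - t *\<^sub>R b) * G w" for w t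
  define F where "F t w = \<phi> w * G (w + t *\<^sub>R b)" for t w
  have [measurable]: "(\<lambda>(w, t). F' w t) \<in> borel_measurable (lborel \<Otimes>\<^sub>M lborel)"
    "(\<lambda>(t, w). F t w) \<in> borel_measurable (lborel \<Otimes>\<^sub>M lborel)"
    unfolding F'_def F_def by measurable
  have tr: "(\<integral>w. f w \<partial>lborel) = (\<integral>w. f (w + t *\<^sub>R b) \<partial>lborel)" if [measurable]: "f \<in> borel_measurable borel" for f :: "'b \<Rightarrow> real" and t
    using lborel_integral_affine[of f 1 "t *\<^sub>R b"] by (simp add: add.commute)
  \<comment> \<open>Translation by \<open>t *\<^sub>R b\<close> exchanges a moving slab with fixed
    \<open>G\<close> for a fixed slab with moving \<open>G\<close>. Fubini is used once for each
    form, and the second one contains the line integrals of \<open>G\<close>.\<close>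
  have FF': "F t w = F' (w + t *\<^sub>R b) t" for t w by (simp add: F_def F'_def)
  have iF': "integrable (lborel \<Otimes>\<^sub>M lborel) (\<lambda>(w, t). F' w t)"
  proof (rule lborel_pair.Fubini_integrable)
    have "(\<integral>t. norm (F' w t) \<partial>lborel) = \<bar>G w\<bar>" for w
      by (simp add: F'_def \<phi>t abs_mult)
    then show "integrable lborel (\<lambda>w. \<integral>t. norm (case (w, t) of (w, t) \<Rightarrow> F' w t) \<partial>lborel)"
      using G by simp
    show "AE w in lborel. integrable lborel (\<lambda>t. case (w, t) of (w, t) \<Rightarrow> F' w t)"
      by (simp add: F'_def \<phi>t)
  qed measurable
  have iF: "integrable (lborel \<Otimes>\<^sub>M lborel) (\<lambda>(t, w). F t w)"
  proof (rule lborel_pair.Fubini_integrable)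
    have "integrable (lborel \<Otimes>\<^sub>M lborel) (\<lambda>(w, t). norm (F' w t))"
      using integrable_norm[OF iF'] by (simp add: case_prod_beta')
    from lborel_pair.integrable_snd[OF this]
    have "integrable lborel (\<lambda>t. \<integral>w. norm (F' w t) \<partial>lborel)" .
    moreover have "(\<integral>w. norm (F' w t) \<partial>lborel) = (\<integral>w. norm (F t w) \<partial>lborel)" for t
      unfolding FF' by (rule tr) (unfold F'_def, measurable)
    ultimately show "integrable lborel (\<lambda>t. \<integral>w. norm (case (t, w) of (t, w) \<Rightarrow> F t w) \<partial>lborel)" by simp
    have "integrable lborel (\<lambda>w. F t w)" for t
    proof (rule Bochner_Integration.integrable_bound)
      show "integrable lborel (\<lambda>w. G (w + t *\<^sub>R b))"
        using lborel_integrable_affine[OF G, of 1 "t *\<^sub>R b"] by (simp add: add.commute)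
      show "AE w in lborel. norm (F t w) \<le> norm (G (w + t *\<^sub>R b))"
        using \<phi>01 by (auto simp: F_def abs_mult mult_left_le_one_le)
    qed (simp add: F_def)
    then show "AE t in lborel. integrable lborel (\<lambda>w. case (t, w) of (t, w) \<Rightarrow> F t w)" by simp
  qed measurable
  have "(\<integral>w. G w \<partial>lborel) = (\<integral>w. (\<integral>t. F' w t \<partial>lborel) \<partial>lborel)"
    by (simp add: F'_def \<phi>t)
  also have "\<dots> = (\<integral>t. (\<integral>w. F' w t \<partial>lborel) \<partial>lborel)"
    by (rule lborel_pair.Fubini_integral[symmetric]) (rule iF')
  also have "\<dots> = (\<integral>t. (\<integral>w. F t w \<partial>lborel) \<partial>lborel)"
    unfolding FF' by (intro Bochner_Integration.integral_cong refl tr) (unfold F'_def, measurable)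
  also have "\<dots> = (\<integral>w. (\<integral>t. F t w \<partial>lborel) \<partial>lborel)"
    by (rule lborel_pair.Fubini_integral[symmetric]) (rule iF)
  also have "\<dots> = 0" by (simp add: F_def zero)
  finally show ?thesis .
qed

section \<open>Taylor expansion along a coordinate, and joint continuity\<close>

lemma holder_smooth_deriv:
  assumes "holder_smooth s L f" "b \<in> Basis" "k < nat \<lfloor>s\<rfloor>"
  shows "((\<lambda>t. diter b k f (z + t *\<^sub>R b)) has_real_derivative diter b (Suc k) f (z + t *\<^sub>R b)) (at t)"
proof -
  let ?w = "z + t *\<^sub>R b"
  have "(\<lambda>r. diter b k f (?w + r *\<^sub>R b)) differentiable (at 0)"
    using assms unfolding holder_smooth_def by blast
  then have "((\<lambda>r. diter b k f (?w + r *\<^sub>R b)) has_real_derivative diter b (Suc k) f ?w) (at 0)"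
    by (simp add: DERIV_deriv_iff_real_differentiable)
  then have "((\<lambda>r. diter b k f (?w + (- t + r) *\<^sub>R b)) has_real_derivative diter b (Suc k) f ?w) (at t)"
    using DERIV_shift[of "\<lambda>r. diter b k f (?w + r *\<^sub>R b)" "diter b (Suc k) f ?w" t "- t"] by (simp add: add.commute)
  then show ?thesis by (simp add: algebra_simps)
qed

text \<open>Expand to order \<open>nat \<lfloor>s\<rfloor>\<close> with Lagrange remainder; the
  highest derivative is then evaluated at an intermediate point, and the Hoelder condition compares
  it with the one at \<open>z\<close>. The sign of \<open>L\<close> is not prescribed, hence
  \<open>\<bar>L\<bar>\<close>.\<close>

lemma holder_smooth_taylor:
  assumes H: "holder_smooth s L f" and s: "0 < s" and b: "b \<in> Basis"
  shows "\<bar>f (z + t *\<^sub>R b) - (\<Sum>k\<le>nat \<lfloor>s\<rfloor>. diter b k f z / fact k * t ^ k)\<bar> \<le> \<bar>L\<bar> * \<bar>t\<bar> powr s"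
proof -
  let ?m = "nat \<lfloor>s\<rfloor>"
  let ?\<psi> = "\<lambda>k t. diter b k f (z + t *\<^sub>R b)"
  have m: "real ?m \<le> s" "s - of_int \<lfloor>s\<rfloor> = s - real ?m" using s by linarith+
  obtain \<xi> where \<xi>: "\<bar>\<xi>\<bar> \<le> \<bar>t\<bar>"
    "f (z + t *\<^sub>R b) = (\<Sum>k<?m. ?\<psi> k 0 / fact k * t ^ k) + ?\<psi> ?m \<xi> / fact ?m * t ^ ?m"
    using Maclaurin_bi_le[of ?\<psi> "\<lambda>t. f (z + t *\<^sub>R b)" ?m t] holder_smooth_deriv[OF H b] by auto
  have "\<bar>diter b ?m f (z + (\<xi> + z \<bullet> b - z \<bullet> b) *\<^sub>R b) - diter b ?m f z\<bar>
      \<le> L * \<bar>z \<bullet> b - (\<xi> + z \<bullet> b)\<bar> powr (s - of_int \<lfloor>s\<rfloor>)"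
    using H b unfolding holder_smooth_def by blast
  then have h: "\<bar>?\<psi> ?m \<xi> - diter b ?m f z\<bar> \<le> L * \<bar>\<xi>\<bar> powr (s - real ?m)" by (simp add: m)
  have "f (z + t *\<^sub>R b) - (\<Sum>k\<le>?m. diter b k f z / fact k * t ^ k)
      = (?\<psi> ?m \<xi> - diter b ?m f z) / fact ?m * t ^ ?m"
    unfolding \<xi>(2) by (simp add: lessThan_Suc_atMost[symmetric] diff_divide_distrib left_diff_distrib)
  also have "\<bar>\<dots>\<bar> = \<bar>?\<psi> ?m \<xi> - diter b ?m f z\<bar> / fact ?m * \<bar>t\<bar> ^ ?m"
    by (simp add: abs_mult power_abs)
  also have "\<dots> \<le> \<bar>L\<bar> * \<bar>t\<bar> powr s"
  \<comment> \<open>The two kinds of power disagree at zero for exponent 0, where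
    \<open>0 ^ 0 = 1\<close> but \<open>0 powr 0 = 0\<close>; so they are exchanged only for
    \<open>t \<noteq> 0\<close>.\<close>
  proof (cases "t = 0")
    case True then show ?thesis using \<xi>(1) s by simp
  next
    case False
    have "\<bar>?\<psi> ?m \<xi> - diter b ?m f z\<bar> / fact ?m \<le> \<bar>?\<psi> ?m \<xi> - diter b ?m f z\<bar>"
      using fact_ge_1[of ?m, where 'a = real] by (simp add: divide_le_eq mult_left_mono[of 1, simplified] mult_le_cancel_left1)
    also have "\<dots> \<le> \<bar>L\<bar> * \<bar>\<xi>\<bar> powr (s - real ?m)"
      by (rule order_trans[OF h]) (auto intro!: mult_right_mono)
    also have "\<dots> \<le> \<bar>L\<bar> * \<bar>t\<bar> powr (s - real ?m)"
      using \<xi>(1) m by (intro mult_left_mono powr_mono2) auto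
    finally have "\<bar>?\<psi> ?m \<xi> - diter b ?m f z\<bar> / fact ?m * \<bar>t\<bar> ^ ?m
        \<le> \<bar>L\<bar> * \<bar>t\<bar> powr (s - real ?m) * \<bar>t\<bar> ^ ?m"
      by (rule mult_right_mono) simp
    also have "\<dots> = \<bar>L\<bar> * (\<bar>t\<bar> powr (s - real ?m) * \<bar>t\<bar> powr real ?m)" using False by (simp add: powr_realpow)
    also have "\<dots> = \<bar>L\<bar> * \<bar>t\<bar> powr s"
      unfolding powr_add[symmetric] by simp
    finally show ?thesis .
  qed
  finally show ?thesis .
qed

text \<open>Regularity along lines says nothing about how a derivative varies across them. Still
  each derivative is the pointwise limit of difference quotients along one fixed sequence of steps,
  hence Borel.\<close>

lemma diter_measurable:
  assumes H: "holder_smooth s L f" and b: "b \<in> Basis" and f: "f \<in> borel_measurable borel"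
  shows "k \<le> nat \<lfloor>s\<rfloor> \<Longrightarrow> diter b k f \<in> borel_measurable borel"
proof (induction k)
  case 0 then show ?case using f by simp
next
  case (Suc k)
  then have [measurable]: "diter b k f \<in> borel_measurable borel" by simp
  define e where "e n = inverse (real (Suc n))" for n
  have e: "e \<longlonglongrightarrow> 0" unfolding e_def by (rule LIMSEQ_inverse_real_of_nat)
  have lim: "(\<lambda>n. (diter b k f (z + e n *\<^sub>R b) - diter b k f z) / e n) \<longlonglongrightarrow> diter b (Suc k) f z" for z
  proof -
    have "((\<lambda>t. diter b k f (z + t *\<^sub>R b)) has_real_derivative diter b (Suc k) f (z + 0 *\<^sub>R b)) (at 0)"
      using Suc.prems by (intro holder_smooth_deriv[OF H b]) simp
    then have "((\<lambda>t. (diter b k f (z + t *\<^sub>R b) - diter b k f z) / t) \<longlongrightarrow> diter b (Suc k) f z) (at 0)"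
      by (simp add: has_field_derivative_iff)
    moreover have "filterlim e (at 0) sequentially"
      using e by (intro filterlim_atI) (auto simp: e_def)
    ultimately show ?thesis by (rule filterlim_compose)
  qed
  show ?case by (rule borel_measurable_LIMSEQ_real[OF lim]) measurable
qed

text \<open>Equivalence of norms on polynomials of degree at most \<open>m\<close>. Combined with
  Taylor's formula it turns a bound on a function into bounds on its derivatives that are uniform in
  the base point.\<close>

lemma poly_coeff_bound:
  "\<exists>C\<ge>0. \<forall>(c :: nat \<Rightarrow> real) B. (\<forall>t\<in>{0..1}. \<bar>\<Sum>k\<le>m. c k * t ^ k\<bar> \<le> B) \<longrightarrow> (\<forall>k\<le>m. \<bar>c k\<bar> \<le> C * B)"
proof (induction m)
  case 0
  show ?case by (rule exI[of _ 1]) auto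
next
  case (Suc m)
  then obtain C where C: "0 \<le> C"
    "\<And>c :: nat \<Rightarrow> real. \<And>B. (\<forall>t\<in>{0..1}. \<bar>\<Sum>k\<le>m. c k * t ^ k\<bar> \<le> B) \<Longrightarrow> (\<forall>k\<le>m. \<bar>c k\<bar> \<le> C * B)"
    by blast
  define D where "D = C * (2 ^ Suc m + 1)"
  have D0: "0 \<le> D" using C(1) by (simp add: D_def)
  show ?case
  proof (intro exI[of _ "1 + real (Suc m) * D"] conjI allI impI)
    show "0 \<le> 1 + real (Suc m) * D" using D0 by simp
    fix c :: "nat \<Rightarrow> real" and B k
    assume B: "\<forall>t\<in>{0..1}. \<bar>\<Sum>k\<le>Suc m. c k * t ^ k\<bar> \<le> B" and k: "k \<le> Suc m"
    have B0: "0 \<le> B" using B[rule_format, of 0] by (meson abs_ge_zero atLeastAtMost_iff order_trans order_refl zero_le_one)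
    text \<open>The combination \<open>2\<^sup>m\<^sup>+\<^sup>1 q(t/2) - q(t)\<close> has no term of degree \<open>m + 1\<close>.\<close>
    have "\<bar>\<Sum>j\<le>m. (c j * (2 ^ (Suc m - j) - 1)) * t ^ j\<bar> \<le> (2 ^ Suc m + 1) * B" if t: "t \<in> {0..1}" for t
    proof -
      have "(\<Sum>j\<le>m. (c j * (2 ^ (Suc m - j) - 1)) * t ^ j)
        = (\<Sum>j\<le>Suc m. (c j * (2 ^ (Suc m - j) - 1)) * t ^ j)" by simp
      also have "\<dots> = 2 ^ Suc m * (\<Sum>j\<le>Suc m. c j * (t / 2) ^ j) - (\<Sum>j\<le>Suc m. c j * t ^ j)"
        unfolding sum_distrib_left sum_subtractf[symmetric]
        by (intro sum.cong refl) (auto simp: power_diff power_divide field_simps simp del: power_Suc)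
      also have "\<bar>\<dots>\<bar> \<le> 2 ^ Suc m * \<bar>\<Sum>j\<le>Suc m. c j * (t / 2) ^ j\<bar> + \<bar>\<Sum>j\<le>Suc m. c j * t ^ j\<bar>"
        by (rule order_trans[OF abs_triangle_ineq4]) (simp add: abs_mult del: sum.atMost_Suc)
      also have "\<dots> \<le> 2 ^ Suc m * B + B"
        using t by (intro add_mono mult_left_mono B[rule_format]) auto
      finally show ?thesis by (simp add: algebra_simps)
    qed
    then have cj: "\<bar>c j * (2 ^ (Suc m - j) - 1)\<bar> \<le> D * B" if "j \<le> m" for j
      using C(2)[of "\<lambda>j. c j * (2 ^ (Suc m - j) - 1)" "(2 ^ Suc m + 1) * B"] that by (simp add: D_def mult.assoc)
    have low: "\<bar>c j\<bar> \<le> D * B" if "j \<le> m" for j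
    proof -
      \<comment> \<open>For \<open>j \<le> m\<close> the multiplier
        \<open>2 ^ (Suc m - j) - 1\<close> is at least 1, so the original coefficients are no larger
        than the new ones.\<close>
      have "(2::real) ^ 1 \<le> 2 ^ (Suc m - j)" using that by (intro power_increasing) auto
      then have "\<bar>c j\<bar> * 1 \<le> \<bar>c j\<bar> * \<bar>2 ^ (Suc m - j) - 1\<bar>" by (intro mult_left_mono) auto
      also have "\<dots> \<le> D * B" using cj[OF that] by (simp add: abs_mult)
      finally show ?thesis by simp
    qed
    show "\<bar>c k\<bar> \<le> (1 + real (Suc m) * D) * B"
    proof (cases "k \<le> m")
      case True
      have "D * B \<le> (1 + real (Suc m) * D) * B"
        using B0 D0 by (intro mult_right_mono) (auto simp: algebra_simps)
      then show ?thesis using low[OF True] by linarith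
    next
      case False
      then have k: "k = Suc m" using k by simp
      \<comment> \<open>The eliminated top coefficient is recovered from the value at
        \<open>t = 1\<close> and the lower coefficients.\<close>
      have "\<bar>\<Sum>j\<le>m. c j\<bar> \<le> (\<Sum>j\<le>m. D * B)"
        by (rule order_trans[OF sum_abs sum_mono]) (use low in auto)
      then have "\<bar>\<Sum>j\<le>m. c j\<bar> \<le> real (Suc m) * D * B" by simp
      moreover have "\<bar>(\<Sum>j\<le>m. c j) + c (Suc m)\<bar> \<le> B" using B[rule_format, of 1] by simp
      ultimately have "\<bar>c (Suc m)\<bar> \<le> B + real (Suc m) * D * B" by linarith
      then show ?thesis by (simp add: k algebra_simps)
    qed
  qed
qed

text \<open>The point is that \<open>D\<close> depends neither on \<open>z\<close> nor on the
  direction: changing several coordinates in turn moves the base point, and the modulus must survive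
  this.\<close>

lemma holder_smooth_modulus:
  fixes f :: "'b::euclidean_space \<Rightarrow> real"
  assumes H: "holder_smooth s L f" and s: "0 < s" and B: "\<And>z. \<bar>f z\<bar> \<le> B"
  obtains D where "0 \<le> D" "\<And>z (t :: real) b. b \<in> Basis \<Longrightarrow> \<bar>t\<bar> \<le> 1 \<Longrightarrow> \<bar>f (z + t *\<^sub>R b) - f z\<bar> \<le> D * \<bar>t\<bar> + \<bar>L\<bar> * \<bar>t\<bar> powr s"
proof -
  let ?m = "nat \<lfloor>s\<rfloor>"
  obtain C where C: "0 \<le> C"
    "\<And>c :: nat \<Rightarrow> real. \<And>B. (\<forall>t\<in>{0..1}. \<bar>\<Sum>k\<le>?m. c k * t ^ k\<bar> \<le> B) \<Longrightarrow> (\<forall>k\<le>?m. \<bar>c k\<bar> \<le> C * B)"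
    using poly_coeff_bound[of ?m] by blast
  have B0: "0 \<le> B" using B[of undefined] by linarith
  let ?E = "C * (B + \<bar>L\<bar>)"
  show ?thesis
  proof (rule that[of "real ?m * ?E"])
    show "0 \<le> real ?m * ?E" using C(1) B0 by simp
    fix z b :: 'b and t :: real assume b: "b \<in> Basis" and t: "\<bar>t\<bar> \<le> 1"
    let ?c = "\<lambda>k. diter b k f z / fact k"
    \<comment> \<open>On the unit interval the Taylor polynomial differs from \<open>f\<close> by at
      most \<open>\<bar>L\<bar>\<close>, so its coefficients have a bound independent of
      \<open>z\<close>.\<close>
    have "\<bar>\<Sum>k\<le>?m. ?c k * r ^ k\<bar> \<le> B + \<bar>L\<bar>" if "r \<in> {0..1}" for r
    proof -
      have "\<bar>L\<bar> * \<bar>r\<bar> powr s \<le> \<bar>L\<bar> * 1" using that s by (intro mult_left_mono powr_le1) auto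
      then show ?thesis using holder_smooth_taylor[OF H s b, of z r] B[of "z + r *\<^sub>R b"] by linarith
    qed
    then have c: "\<And>k. k \<le> ?m \<Longrightarrow> \<bar>?c k\<bar> \<le> ?E" using C(2)[of ?c "B + \<bar>L\<bar>"] by blast
    have "(\<Sum>k\<le>?m. ?c k * t ^ k) = f z + (\<Sum>k=1..?m. ?c k * t ^ k)"
      by (simp add: sum.atMost_shift sum.atLeast1_atMost_eq lessThan_Suc_atMost atLeast0LessThan[symmetric] del: fact_Suc diter.simps(2))
    moreover have "\<bar>\<Sum>k=1..?m. ?c k * t ^ k\<bar> \<le> (\<Sum>k=1..?m. ?E * \<bar>t\<bar>)"
    proof (rule order_trans[OF sum_abs sum_mono])
      fix k assume k: "k \<in> {1..?m}"
      have "\<bar>t\<bar> ^ k \<le> \<bar>t\<bar> ^ 1" using k t by (intro power_decreasing) auto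
      then show "\<bar>?c k * t ^ k\<bar> \<le> ?E * \<bar>t\<bar>"
        unfolding abs_mult power_abs using c[of k] k C(1) B0 by (intro mult_mono) auto
    qed
    moreover have "(\<Sum>k=1..?m. ?E * \<bar>t\<bar>) = real ?m * ?E * \<bar>t\<bar>" by simp
    ultimately show "\<bar>f (z + t *\<^sub>R b) - f z\<bar> \<le> real ?m * ?E * \<bar>t\<bar> + \<bar>L\<bar> * \<bar>t\<bar> powr s"
      using holder_smooth_taylor[OF H s b, of z t] by linarith
  qed
qed

text \<open>Separate continuity alone would not suffice. With a modulus uniform in the base point
  one walks from \<open>x\<close> to \<open>x + v\<close> along the coordinates and adds up the
  increments.\<close>

lemma holder_smooth_isCont:
  fixes f :: "'b::euclidean_space \<Rightarrow> real"
  assumes H: "holder_smooth s L f" and s: "0 < s" and B: "\<And>z. \<bar>f z\<bar> \<le> B"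
  shows "isCont f x"
proof -
  obtain D where D: "0 \<le> D"
    "\<And>z (t :: real) b. b \<in> Basis \<Longrightarrow> \<bar>t\<bar> \<le> 1 \<Longrightarrow> \<bar>f (z + t *\<^sub>R b) - f z\<bar> \<le> D * \<bar>t\<bar> + \<bar>L\<bar> * \<bar>t\<bar> powr s"
    by (rule holder_smooth_modulus[OF H s B]) blast
  define \<omega> where "\<omega> r = D * r + \<bar>L\<bar> * r powr s" for r
  have bound: "\<bar>f (x + v) - f x\<bar> \<le> real DIM('b) * \<omega> (norm v)" if v: "norm v \<le> 1" for v
  proof -
    have "\<bar>f (x + (\<Sum>b\<in>A. (v \<bullet> b) *\<^sub>R b)) - f x\<bar> \<le> (\<Sum>b\<in>A. \<omega> (norm v))"
      if "finite A" "A \<subseteq> Basis" for A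
      using that
    proof (induction A rule: finite_induct)
      case (insert b A)
      have b: "b \<in> Basis" using insert.prems by simp
      let ?z = "x + (\<Sum>b\<in>A. (v \<bullet> b) *\<^sub>R b)"
      have vb: "\<bar>v \<bullet> b\<bar> \<le> norm v" by (rule Basis_le_norm[OF b])
      have "\<bar>f (?z + (v \<bullet> b) *\<^sub>R b) - f ?z\<bar> \<le> D * \<bar>v \<bullet> b\<bar> + \<bar>L\<bar> * \<bar>v \<bullet> b\<bar> powr s"
        by (rule D(2)[OF b]) (use vb v in linarith)
      also have "\<dots> \<le> \<omega> (norm v)"
        unfolding \<omega>_def using D(1) vb s by (intro add_mono mult_left_mono powr_mono2) auto
      finally have step: "\<bar>f (?z + (v \<bullet> b) *\<^sub>R b) - f ?z\<bar> \<le> \<omega> (norm v)" .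
      have eq: "x + (\<Sum>b\<in>insert b A. (v \<bullet> b) *\<^sub>R b) = ?z + (v \<bullet> b) *\<^sub>R b"
        using insert.hyps by (simp add: algebra_simps)
      have "\<bar>f ?z - f x\<bar> \<le> (\<Sum>b\<in>A. \<omega> (norm v))" using insert by blast
      moreover have "(\<Sum>b\<in>insert b A. \<omega> (norm v)) = \<omega> (norm v) + (\<Sum>b\<in>A. \<omega> (norm v))"
        by (rule sum.insert[OF insert.hyps])
      ultimately show ?case unfolding eq using step by linarith
    qed simp
    from this[of Basis] show ?thesis by (simp add: euclidean_representation)
  qed
  have "((\<lambda>v. f (x + v) - f x) \<longlongrightarrow> 0) (at 0)"
  proof (rule Lim_null_comparison)
    have "eventually (\<lambda>v::'b. norm v \<le> 1) (at 0)"
      by (rule eventually_mono[OF eventually_at_ball[of 1 0 UNIV]]) auto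
    then show "eventually (\<lambda>v. norm (f (x + v) - f x) \<le> real DIM('b) * \<omega> (norm v)) (at 0)"
      by eventually_elim (use bound in simp)
    have n0: "((\<lambda>v::'b. norm v) \<longlongrightarrow> 0) (at 0)" by (rule tendsto_norm_zero) (rule tendsto_ident_at)
    have "((\<lambda>v::'b. norm v powr s) \<longlongrightarrow> 0) (at 0)"
      using s by (intro tendsto_zero_powrI[OF n0 tendsto_const]) auto
    then have "((\<lambda>v::'b. real DIM('b) * (D * norm v + \<bar>L\<bar> * norm v powr s)) \<longlongrightarrow> real DIM('b) * (D * 0 + \<bar>L\<bar> * 0)) (at 0)"
      by (intro tendsto_intros n0)
    then show "((\<lambda>v::'b. real DIM('b) * \<omega> (norm v)) \<longlongrightarrow> 0) (at 0)" by (simp add: \<omega>_def)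
  qed
  then have "((\<lambda>v. f (x + v)) \<longlongrightarrow> f x) (at 0)" by (simp add: LIM_zero_iff)
  then show ?thesis by (simp add: isCont_iff)
qed

text \<open>Serves where a limit without rate is enough, in particular for the squared kernel, whose
  moments have no reason to vanish. The dominating function is
  \<open>B * \<bar>K w\<bar>\<close>.\<close>

lemma approx_identity:
  fixes f K :: "'b::euclidean_space \<Rightarrow> real"
  assumes [measurable]: "f \<in> borel_measurable borel" and B: "\<And>z. \<bar>f z\<bar> \<le> B" and cont: "isCont f x"
    and K: "integrable lborel K" and h: "h \<longlonglongrightarrow> 0"
  shows "(\<lambda>n. \<integral>w. K w * f (x - h n *\<^sub>R w) \<partial>lborel) \<longlonglongrightarrow> (\<integral>w. K w \<partial>lborel) * f x"
proof -
  have [measurable]: "K \<in> borel_measurable borel" using K by (auto dest: borel_measurable_integrable)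
  have "(\<lambda>n. \<integral>w. K w * f (x - h n *\<^sub>R w) \<partial>lborel) \<longlonglongrightarrow> (\<integral>w. K w * f x \<partial>lborel)"
  proof (rule integral_dominated_convergence[where w = "\<lambda>w. B * \<bar>K w\<bar>"])
    show "integrable lborel (\<lambda>w. B * \<bar>K w\<bar>)" using K by auto
    have "(\<lambda>n. K w * f (x - h n *\<^sub>R w)) \<longlonglongrightarrow> K w * f x" for w
    proof (intro tendsto_mult_left isCont_tendsto_compose[OF cont])
      have "(\<lambda>n. x - h n *\<^sub>R w) \<longlonglongrightarrow> x - 0 *\<^sub>R w" by (intro tendsto_intros h)
      then show "(\<lambda>n. x - h n *\<^sub>R w) \<longlonglongrightarrow> x" by simp
    qed
    then show "AE w in lborel. (\<lambda>n. K w * f (x - h n *\<^sub>R w)) \<longlonglongrightarrow> K w * f x" by simp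
    show "AE w in lborel. norm (K w * f (x - h n *\<^sub>R w)) \<le> B * \<bar>K w\<bar>" for n
      using B by (auto simp: abs_mult mult.commute[of B] intro!: mult_left_mono)
  qed measurable
  then show ?thesis by simp
qed

text \<open>Since \<open>y\<close> is constant along \<open>b\<close>, the Taylor coefficients at
  \<open>y w\<close> are constant on each line in that direction. There the Taylor part integrates
  to a combination of one-dimensional moments of \<open>K\<close>, which vanish; only the Hoelder
  remainder survives.\<close>

lemma holder_bias_step:
  fixes f K :: "'b::euclidean_space \<Rightarrow> real"
  assumes H: "holder_smooth s L f" and s: "0 < s"
    and fm [measurable]: "f \<in> borel_measurable borel" and C: "\<And>z. \<bar>f z\<bar> \<le> C"
    and K: "integrable lborel K" and mom: "kernel_moments s K" and b: "b \<in> Basis"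
    and Ks: "integrable lborel (\<lambda>w. \<bar>w \<bullet> b\<bar> powr s * \<bar>K w\<bar>)" and h: "0 < h"
    and ym [measurable]: "y \<in> borel_measurable borel" and y: "\<And>w t. y (w + t *\<^sub>R b) = y w"
  shows "\<bar>\<integral>w. K w * (f (y w + (- h * (w \<bullet> b)) *\<^sub>R b) - f (y w)) \<partial>lborel\<bar>
    \<le> h powr s * (\<bar>L\<bar> * (\<integral>w. \<bar>w \<bullet> b\<bar> powr s * \<bar>K w\<bar> \<partial>lborel))"
proof -
  let ?m = "nat \<lfloor>s\<rfloor>"
  have Km [measurable]: "K \<in> borel_measurable borel" using K by (auto dest: borel_measurable_integrable)
  define \<Delta> where "\<Delta> w = f (y w + (- h * (w \<bullet> b)) *\<^sub>R b) - f (y w)" for w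
  define T where "T w = (\<Sum>k=1..?m. diter b k f (y w) / fact k * (- h * (w \<bullet> b)) ^ k)" for w
  have dm: "(\<lambda>w. diter b k f (y w)) \<in> borel_measurable borel" if "k \<le> ?m" for k
    using diter_measurable[OF H b fm that] by measurable
  have [measurable]: "\<Delta> \<in> borel_measurable borel" unfolding \<Delta>_def[abs_def] by measurable
  have [measurable]: "T \<in> borel_measurable borel"
    unfolding T_def[abs_def]
    by (intro borel_measurable_sum borel_measurable_times borel_measurable_divide dm) auto
  have R: "\<bar>\<Delta> w - T w\<bar> \<le> h powr s * \<bar>L\<bar> * \<bar>w \<bullet> b\<bar> powr s" for w
  proof -
    let ?t = "- h * (w \<bullet> b)"
    have "(\<Sum>k\<le>?m. diter b k f (y w) / fact k * ?t ^ k) = f (y w) + T w"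
      by (simp add: T_def sum.atMost_shift sum.atLeast1_atMost_eq lessThan_Suc_atMost atLeast0LessThan[symmetric] del: fact_Suc diter.simps(2))
    then have "\<bar>\<Delta> w - T w\<bar> \<le> \<bar>L\<bar> * \<bar>?t\<bar> powr s"
      using holder_smooth_taylor[OF H s b, of "y w" ?t] by (simp add: \<Delta>_def algebra_simps)
    also have "\<bar>?t\<bar> powr s = h powr s * \<bar>w \<bullet> b\<bar> powr s" using h by (simp add: abs_mult powr_mult)
    finally show ?thesis by (simp add: mult_ac)
  qed
  have iD: "integrable lborel (\<lambda>w. K w * \<Delta> w)"
  proof (rule Bochner_Integration.integrable_bound)
    show "integrable lborel (\<lambda>w. 2 * C * \<bar>K w\<bar>)" using K by auto
    have "\<bar>\<Delta> w\<bar> \<le> 2 * C" for w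
      unfolding \<Delta>_def using C[of "y w + (- h * (w \<bullet> b)) *\<^sub>R b"] C[of "y w"] by linarith
    then have "norm (K w * \<Delta> w) \<le> \<bar>2 * C * \<bar>K w\<bar>\<bar>" for w
      unfolding real_norm_def abs_mult[of "K w"] by (subst mult.commute, intro order_trans[OF mult_right_mono abs_ge_self]) auto
    then show "AE w in lborel. norm (K w * \<Delta> w) \<le> norm (2 * C * \<bar>K w\<bar>)" by simp
  qed measurable
  have KR: "\<bar>K w * (\<Delta> w - T w)\<bar> \<le> h powr s * \<bar>L\<bar> * (\<bar>w \<bullet> b\<bar> powr s * \<bar>K w\<bar>)" for w
    using mult_left_mono[OF R[of w] abs_ge_zero[of "K w"]] by (simp add: abs_mult mult_ac)
  have iR: "integrable lborel (\<lambda>w. K w * (\<Delta> w - T w))"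
  proof (rule Bochner_Integration.integrable_bound)
    show "integrable lborel (\<lambda>w. h powr s * \<bar>L\<bar> * (\<bar>w \<bullet> b\<bar> powr s * \<bar>K w\<bar>))" using Ks by auto
    show "AE w in lborel. norm (K w * (\<Delta> w - T w)) \<le> norm (h powr s * \<bar>L\<bar> * (\<bar>w \<bullet> b\<bar> powr s * \<bar>K w\<bar>))"
      using order_trans[OF KR abs_ge_self] by simp
  qed measurable
  \<comment> \<open>The moment condition concerns single lines and gives no joint integrability.
    That of \<open>K w * T w\<close> is obtained as a difference of two integrable
    functions.\<close>
  have iT: "integrable lborel (\<lambda>w. K w * T w)"
    using Bochner_Integration.integrable_diff[OF iD iR] by (simp add: algebra_simps)
  \<comment> \<open>In \<open>kernel_moments\<close> the parameter is the coordinate itself; here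
    \<open>t\<close> is the displacement from \<open>w\<close>, so the line is shifted by
    \<open>w \<bullet> b\<close>.\<close>
  have line: "integrable lborel (\<lambda>t. (w \<bullet> b + t) ^ k * K (w + t *\<^sub>R b))" 
    "(\<integral>t. (w \<bullet> b + t) ^ k * K (w + t *\<^sub>R b) \<partial>lborel) = 0" if k: "k \<in> {1..?m}" for k w
  proof -
    let ?g = "\<lambda>t. t ^ k * K (w + (t - w \<bullet> b) *\<^sub>R b)"
    have g: "integrable lborel ?g" "(\<integral>t. ?g t \<partial>lborel) = 0"
      using mom b k unfolding kernel_moments_def by blast+
    show "integrable lborel (\<lambda>t. (w \<bullet> b + t) ^ k * K (w + t *\<^sub>R b))"
      using lborel_integrable_affine[OF g(1), of 1 "w \<bullet> b"] by simp
    show "(\<integral>t. (w \<bullet> b + t) ^ k * K (w + t *\<^sub>R b) \<partial>lborel) = 0"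
      using lborel_integral_affine[of ?g 1 "w \<bullet> b"] g by (simp add: borel_measurable_integrable)
  qed
  have zero: "(\<integral>w. K w * T w \<partial>lborel) = 0"
  proof (rule lborel_integral_zero_of_lines[OF iT b])
    fix w
    have "K (w + t *\<^sub>R b) * T (w + t *\<^sub>R b)
      = (\<Sum>k=1..?m. (diter b k f (y w) / fact k * (- h) ^ k) * ((w \<bullet> b + t) ^ k * K (w + t *\<^sub>R b)))" for t
      using b unfolding T_def y sum_distrib_left
      by (intro sum.cong refl) (simp only: inner_add_left inner_scaleR_left inner_same_Basis power_mult_distrib mult_ac mult_1_right mult_1_left)
    then show "(\<integral>t. K (w + t *\<^sub>R b) * T (w + t *\<^sub>R b) \<partial>lborel) = 0"
      by (simp add: line Bochner_Integration.integral_sum del: times_divide_eq_left)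
  qed
  have "(\<integral>w. K w * \<Delta> w \<partial>lborel) = (\<integral>w. K w * (\<Delta> w - T w) \<partial>lborel) + (\<integral>w. K w * T w \<partial>lborel)"
    unfolding Bochner_Integration.integral_add[OF iR iT, symmetric] by (simp add: algebra_simps)
  also have "\<bar>\<dots>\<bar> \<le> (\<integral>w. \<bar>K w * (\<Delta> w - T w)\<bar> \<partial>lborel)"
    using integral_abs_bound[of lborel "\<lambda>w. K w * (\<Delta> w - T w)"] by (simp add: zero)
  also have "\<dots> \<le> (\<integral>w. h powr s * \<bar>L\<bar> * (\<bar>w \<bullet> b\<bar> powr s * \<bar>K w\<bar>) \<partial>lborel)"
    by (intro integral_mono KR integrable_abs iR integrable_mult_right Ks)
  finally show ?thesis by (simp add: \<Delta>_def mult.assoc)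
qed

text \<open>The point \<open>y A w\<close> has only the coordinates in \<open>A\<close> displaced
  from \<open>x\<close>. Adding \<open>b\<close> to \<open>A\<close> is one application of the
  one-coordinate estimate, since \<open>y A w\<close> does not depend on the coordinate
  \<open>w \<bullet> b\<close>.\<close>

lemma holder_bias:
  fixes f K :: "'b::euclidean_space \<Rightarrow> real"
  assumes H: "holder_smooth s L f" and s: "0 < s"
    and fm [measurable]: "f \<in> borel_measurable borel" and C: "\<And>z. \<bar>f z\<bar> \<le> C"
    and K: "integrable lborel K" and mom: "kernel_moments s K"
    and Ks: "\<And>b. b \<in> Basis \<Longrightarrow> integrable lborel (\<lambda>w. \<bar>w \<bullet> b\<bar> powr s * \<bar>K w\<bar>)" and h: "0 < h"
  shows "\<bar>(\<integral>w. K w * f (x - h *\<^sub>R w) \<partial>lborel) - (\<integral>w. K w \<partial>lborel) * f x\<bar>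
    \<le> h powr s * (\<bar>L\<bar> * (\<Sum>b\<in>Basis. \<integral>w. \<bar>w \<bullet> b\<bar> powr s * \<bar>K w\<bar> \<partial>lborel))"
proof -
  have [measurable]: "K \<in> borel_measurable borel" using K by (auto dest: borel_measurable_integrable)
  define y where "y A w = x - h *\<^sub>R (\<Sum>b\<in>A. (w \<bullet> b) *\<^sub>R b)" for A and w :: 'b
  have ym [measurable]: "y A \<in> borel_measurable borel" for A unfolding y_def[abs_def] by measurable
  have int: "integrable lborel (\<lambda>w. K w * f (g w))" if [measurable]: "g \<in> borel_measurable borel" for g :: "'b \<Rightarrow> 'b"
  proof (rule Bochner_Integration.integrable_bound)
    show "integrable lborel (\<lambda>w. C * K w)" using K by auto
    show "AE w in lborel. norm (K w * f (g w)) \<le> norm (C * K w)"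
      using order_trans[OF C abs_ge_self] by (intro AE_I2) (simp add: abs_mult mult.commute[of "\<bar>C\<bar>"] mult_left_mono)
  qed measurable
  have "\<bar>(\<integral>w. K w * f (y A w) \<partial>lborel) - (\<integral>w. K w * f x \<partial>lborel)\<bar>
    \<le> h powr s * (\<bar>L\<bar> * (\<Sum>b\<in>A. \<integral>w. \<bar>w \<bullet> b\<bar> powr s * \<bar>K w\<bar> \<partial>lborel))"
    if "finite A" "A \<subseteq> Basis" for A
    using that
  proof (induction A rule: finite_induct)
    case empty
    show ?case by (simp add: y_def)
  next
    case (insert b A)
    have b: "b \<in> Basis" and A: "A \<subseteq> Basis" using insert.prems by auto
    have yb: "y A (w + t *\<^sub>R b) = y A w" for w t
    proof -
      have "(w + t *\<^sub>R b) \<bullet> c = w \<bullet> c" if "c \<in> A" for c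
      proof -
        have "b \<noteq> c" "c \<in> Basis" using that insert.hyps A by auto
        then show ?thesis using b by (simp add: inner_add_left inner_not_same_Basis)
      qed
      then show ?thesis by (simp add: y_def)
    qed
    have ins: "y (insert b A) w = y A w + (- h * (w \<bullet> b)) *\<^sub>R b" for w
      using insert.hyps by (simp add: y_def algebra_simps)
    have "(\<integral>w. K w * f (y (insert b A) w) \<partial>lborel) - (\<integral>w. K w * f (y A w) \<partial>lborel)
      = (\<integral>w. K w * (f (y (insert b A) w) - f (y A w)) \<partial>lborel)"
      by (simp add: int right_diff_distrib)
    also have "\<bar>\<dots>\<bar> \<le> h powr s * (\<bar>L\<bar> * (\<integral>w. \<bar>w \<bullet> b\<bar> powr s * \<bar>K w\<bar> \<partial>lborel))"
      unfolding ins by (rule holder_bias_step[OF H s fm C K mom b Ks[OF b] h ym yb])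
    finally show ?case using insert.IH[OF A] insert.hyps by (simp add: algebra_simps)
  qed
  from this[of Basis] show ?thesis by (simp add: y_def euclidean_representation)
qed

subsection \<open>Generation sums under geometric ergodicity\<close>

locale ergodic_bmc = bmc p M X nu
  for p :: "'a::euclidean_space \<Rightarrow> 'a \<Rightarrow> 'a \<Rightarrow> real"
    and M :: "'w measure" and X and nu +
  fixes F :: "('a \<Rightarrow> real) set" and mu V :: "'a \<Rightarrow> real" and \<alpha> Mc C0 :: real
  assumes H1: "H1 F nu p" and H2: "H2 F p mu V \<alpha> Mc"
    and mu_nonneg: "0 \<le> mu y" and mu_meas [measurable]: "mu \<in> borel_measurable borel"
    and mu_prob: "prob_space (density lborel mu)"
    and bounded_densities: "mu y + Q_dens p y y0 + p y y0 y1 \<le> C0"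
begin

abbreviation "\<mu> \<equiv> density lborel mu"

lemma Q_dens_nonneg: "0 \<le> Q_dens p y z"
  unfolding Q_dens_def by (auto intro!: Bochner_Integration.integral_nonneg simp: p_nonneg)

lemma density_bounds: "mu y \<le> C0" "Q_dens p y y0 \<le> C0" "p y y0 y1 \<le> C0" "0 \<le> C0"
  using bounded_densities[of y y0 y1] mu_nonneg[of y] Q_dens_nonneg[of y y0] p_nonneg[of y y0 y1] by linarith+

lemma \<alpha>_bounds: "0 < \<alpha>" "\<alpha> < 1"
  using H2 unfolding H2_def by blast+

lemma V_ge_1: "1 \<le> V y"
  using H2 unfolding H2_def by blast

lemma ergodic:
  assumes "bdd_borel f" "\<And>y. \<bar>f y\<bar> \<le> V y"
  shows "\<bar>(Q ^^ n) f y - (\<integral>z. f z \<partial>\<mu>)\<bar> \<le> Mc * \<alpha> ^ n * V y"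
  using H2 assms unfolding H2_def bdd_borel_def by blast

lemma sets_nu [measurable_cong, simp]: "sets nu = sets borel" and space_nu [simp]: "space nu = UNIV"
  by (simp_all add: distr_root[symmetric])

lemma prob_space_nu: "prob_space nu"
  unfolding distr_root[symmetric] by (rule prob_space_distr) simp

lemma F_cmult: "f \<in> F \<Longrightarrow> (\<lambda>y. c * f y) \<in> F"
  using H1 unfolding H1_def by simp

text \<open>Taking 1 as one of the two factors in \<open>H1\<close> extracts the marginals of the
  kernel, and their mean is \<open>Q\<close>.\<close>

lemma F_Q:
  assumes "w \<in> F"
  shows "integrable (kernel_meas p y) (\<lambda>z. w (fst z))" "integrable (kernel_meas p y) (\<lambda>z. w (snd z))" "Q w \<in> F"
proof -
  have one: "(\<lambda>_. 1) \<in> F" using H1 unfolding H1_def by blast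
  have tens: "\<And>f g y. f \<in> F \<Longrightarrow> g \<in> F \<Longrightarrow> integrable (kernel_meas p y) (\<lambda>z. f (fst z) * g (snd z))"
    "\<And>f g. f \<in> F \<Longrightarrow> g \<in> F \<Longrightarrow> kernel_op2 p (\<lambda>z. f (fst z) * g (snd z)) \<in> F"
    using H1 unfolding H1_def by blast+
  show "integrable (kernel_meas p y) (\<lambda>z. w (fst z))" "integrable (kernel_meas p y) (\<lambda>z. w (snd z))"
    using tens(1)[OF assms one] tens(1)[OF one assms] by simp_all
  have "(\<lambda>y. kernel_op2 p (\<lambda>z. w (fst z)) y + kernel_op2 p (\<lambda>z. w (snd z)) y) \<in> F"
    using tens(2)[OF assms one] tens(2)[OF one assms] H1 unfolding H1_def by simp
  then have "(\<lambda>y. (1/2) * (kernel_op2 p (\<lambda>z. w (fst z)) y + kernel_op2 p (\<lambda>z. w (snd z)) y)) \<in> F"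
    by (rule F_cmult)
  moreover have "Q w = (\<lambda>y. (1/2) * (kernel_op2 p (\<lambda>z. w (fst z)) y + kernel_op2 p (\<lambda>z. w (snd z)) y))"
    by (rule ext) (simp add: Q_op_def kernel_op2_def)
  ultimately show "Q w \<in> F" by simp
qed

lemma F_Q_power: "w \<in> F \<Longrightarrow> (Q ^^ n) w \<in> F"
  by (induction n) (auto intro: F_Q)

text \<open>The majorant may be unbounded; its integrability under the kernel comes from the
  stability of \<open>F\<close> under \<open>Q\<close>.\<close>

lemma Q_power_mono:
  assumes "bdd_borel f" "w \<in> F" "\<And>y. f y \<le> w y"
  shows "(Q ^^ n) f y \<le> (Q ^^ n) w y"
proof (induction n arbitrary: y)
  case 0 show ?case using assms(3) by simp
next
  case (Suc n)
  have f: "bdd_borel ((Q ^^ n) f)" by (rule bdd_borel_Q_power[OF assms(1)])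
  have w: "(Q ^^ n) w \<in> F" by (rule F_Q_power[OF assms(2)])
  have "integrable (kernel_meas p y) (\<lambda>z. (Q ^^ n) f (fst z))" "integrable (kernel_meas p y) (\<lambda>z. (Q ^^ n) f (snd z))"
    by (auto intro!: kernel_integrable bdd_borel_compose[OF f])
  then show ?case
    using F_Q(1,2)[OF w, of y] Suc.IH unfolding funpow.simps comp_def Q_op_def
    by (intro divide_right_mono add_mono integral_mono) auto
qed

text \<open>By \<open>H1\<close> the square of \<open>V\<close> lies in \<open>F\<close>, by
  \<open>H2\<close> its orbit under \<open>Q\<close> has a majorant \<open>g\<close> in
  \<open>F\<close>, and by \<open>H1\<close> again \<open>g\<close> is integrable for the initial
  law. The constant is the integral of \<open>g\<close>.\<close>

lemma moment_bound:
  obtains B where "0 \<le> B"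
    "\<And>w r C. bdd_borel w \<Longrightarrow> 0 \<le> C \<Longrightarrow> (\<And>y. w y \<le> C * (V y)\<^sup>2) \<Longrightarrow> expectation (S r w) \<le> C * 2 ^ r * B"
proof -
  interpret nu: prob_space nu by (rule prob_space_nu)
  have V2: "(\<lambda>y. (V y)\<^sup>2) \<in> F" using H1 H2 unfolding H1_def H2_def by blast
  then obtain g where g: "g \<in> F" "\<And>n y. \<bar>(Q ^^ n) (\<lambda>y. (V y)\<^sup>2) y\<bar> \<le> g y"
    using H2 unfolding H2_def by blast
  have ig: "integrable nu g" using H1 g(1) unfolding H1_def by blast
  have g0: "0 \<le> g y" for y using g(2)[of 0 y] by linarith
  show ?thesis
  proof (rule that[of "\<integral>y. g y \<partial>nu"])
    show "0 \<le> (\<integral>y. g y \<partial>nu)" using g0 by (intro Bochner_Integration.integral_nonneg) auto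
    fix w :: "'a \<Rightarrow> real" and r C
    assume w: "bdd_borel w" and C: "0 \<le> C" and le: "\<And>y. w y \<le> C * (V y)\<^sup>2"
    have CV: "(\<lambda>y. C * (V y)\<^sup>2) \<in> F" using V2 by (rule F_cmult)
    have "(Q ^^ r) w y \<le> C * g y" for y
    proof -
      have "(Q ^^ r) w y \<le> C * (Q ^^ r) (\<lambda>y. (V y)\<^sup>2) y"
        using Q_power_mono[OF w CV le, of r y] by (simp add: Q_power_cmult)
      also have "\<dots> \<le> C * g y" using g(2)[of r y] C by (intro mult_left_mono) auto
      finally show ?thesis .
    qed
    moreover have "integrable nu ((Q ^^ r) w)"
      using nu.integrable_bdd_borel[OF bdd_borel_Q_power[OF w, of r], of "\<lambda>y. y"] by (simp cong: measurable_cong_sets)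
    ultimately have "(\<integral>y. (Q ^^ r) w y \<partial>nu) \<le> (\<integral>y. C * g y \<partial>nu)"
      using ig by (intro integral_mono) auto
    then have "2 ^ r * (\<integral>y. (Q ^^ r) w y \<partial>nu) \<le> 2 ^ r * (C * (\<integral>y. g y \<partial>nu))" by (intro mult_left_mono) auto
    then show "expectation (S r w) \<le> C * 2 ^ r * (\<integral>y. g y \<partial>nu)"
      by (simp add: expectation_S[OF w] mult_ac)
  qed
qed

lemma integral_mu:
  assumes [measurable]: "f \<in> borel_measurable borel"
  shows "(\<integral>y. f y \<partial>\<mu>) = (\<integral>y. mu y * f y \<partial>lborel)"
  by (subst integral_density) (auto simp: mu_nonneg)

lemma integrable_mu: "bdd_borel f \<Longrightarrow> integrable \<mu> f"
  using prob_space.integrable_bdd_borel[OF mu_prob, of f "\<lambda>y. y"] by (simp cong: measurable_cong_sets)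

lemma integral_mu_abs_le:
  assumes f: "bdd_borel f" and C: "\<And>y. \<bar>f y\<bar> \<le> C" shows "\<bar>\<integral>y. f y \<partial>\<mu>\<bar> \<le> C"
proof -
  interpret mu: prob_space \<mu> by (rule mu_prob)
  have "\<bar>\<integral>y. f y \<partial>\<mu>\<bar> \<le> (\<integral>y. \<bar>f y\<bar> \<partial>\<mu>)" by (rule integral_abs_bound)
  also have "\<dots> \<le> (\<integral>y. C \<partial>\<mu>)" by (intro integral_mono integrable_abs integrable_mu f C) simp
  finally show ?thesis using mu.prob_space by simp
qed

text \<open>Invariance is a consequence of ergodicity: \<open>(Q ^^ Suc n) f\<close> and
  \<open>(Q ^^ n) (Q f)\<close> are the same sequence, and its limit is the mean of \<open>f\<close>
  as well as that of \<open>Q f\<close>. The base point \<open>undefined\<close> is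
  arbitrary.\<close>

lemma Q_invariant:
  assumes f: "bdd_borel f" shows "(\<integral>y. Q f y \<partial>\<mu>) = (\<integral>y. f y \<partial>\<mu>)"
proof -
  have lim: "(\<lambda>n. (Q ^^ n) g undefined) \<longlonglongrightarrow> (\<integral>y. g y \<partial>\<mu>)" if g: "bdd_borel g" for g
  proof -
    obtain C where C: "0 < C" "\<And>y. \<bar>g y\<bar> \<le> C" by (rule bdd_borelE[OF g]) blast
    \<comment> \<open>Ergodicity is given below \<open>V\<close>; as \<open>V \<ge> 1\<close>,
      dividing a bounded function by its bound brings it there.\<close>
    have g': "bdd_borel (\<lambda>y. 1 / C * g y)" by (rule bdd_borel_cmult[OF g])
    have "\<bar>1 / C * g y\<bar> \<le> V y" for y
    proof -
      have "\<bar>1 / C * g y\<bar> \<le> 1" using C(1) C(2)[of y] by (simp add: abs_mult divide_le_eq)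
      then show ?thesis using V_ge_1[of y] by linarith
    qed
    from ergodic[OF g' this]
    have "norm ((Q ^^ n) (\<lambda>y. 1 / C * g y) undefined - (\<integral>y. 1 / C * g y \<partial>\<mu>)) \<le> \<alpha> ^ n * (Mc * V undefined)" for n
      by (simp add: mult_ac)
    then have "(\<lambda>n. (Q ^^ n) (\<lambda>y. 1 / C * g y) undefined - (\<integral>y. 1 / C * g y \<partial>\<mu>)) \<longlonglongrightarrow> 0"
      using \<alpha>_bounds
      by (intro Lim_null_comparison[OF always_eventually tendsto_mult_left_zero[OF LIMSEQ_power_zero]]) auto
    then have "(\<lambda>n. 1 / C * (Q ^^ n) g undefined) \<longlonglongrightarrow> 1 / C * (\<integral>y. g y \<partial>\<mu>)"
      unfolding Q_power_cmult by (simp add: LIM_zero_iff)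
    then have "(\<lambda>n. C * (1 / C * (Q ^^ n) g undefined)) \<longlonglongrightarrow> C * (1 / C * (\<integral>y. g y \<partial>\<mu>))"
      by (rule tendsto_mult_left)
    moreover have "C * (1 / C * r) = r" for r using C(1) by simp
    ultimately show ?thesis by (simp only:)
  qed
  have "(\<lambda>n. (Q ^^ Suc n) f undefined) \<longlonglongrightarrow> (\<integral>y. f y \<partial>\<mu>)"
    by (rule LIMSEQ_Suc[OF lim[OF f]])
  then have "(\<lambda>n. (Q ^^ n) (Q f) undefined) \<longlonglongrightarrow> (\<integral>y. f y \<partial>\<mu>)"
    by (simp add: Q_power_Suc_right del: funpow.simps)
  then show ?thesis using lim[OF bdd_borel_Q[OF f]] LIMSEQ_unique by blast
qed

text \<open>The density of \<open>Q\<close> is at most \<open>C0\<close>, so one step turns an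
  \<open>L1\<close> bound into a uniform one. This is the source of the additional factor
  \<open>h^d\<close> for a function concentrated at scale \<open>h\<close>.\<close>

lemma Q_abs_le:
  assumes f: "bdd_borel f" and i: "integrable lborel f"
  shows "\<bar>Q f y\<bar> \<le> C0 * (\<integral>z. \<bar>f z\<bar> \<partial>lborel)"
proof -
  have fm [measurable]: "f \<in> borel_measurable borel" by (rule bdd_borel_measurable[OF f])
  have fa: "bdd_borel (\<lambda>z. \<bar>f z\<bar>)"
    using f unfolding bdd_borel_def by auto
  let ?q = "\<lambda>z::'a \<times> 'a. p y (fst z) (snd z)"
  interpret K: prob_space "kernel_meas p y" by (rule prob_space_kernel)
  have den: "integrable lborel (\<lambda>z. ?q z * g z)" if g: "bdd_borel g" for g
  proof -
    have [measurable]: "g \<in> borel_measurable borel" by (rule bdd_borel_measurable[OF g])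
    show ?thesis using kernel_integrable[OF g, of y] unfolding kernel_meas_def
      by (subst (asm) integrable_density) (auto simp: p_nonneg)
  qed
  have g1: "bdd_borel (\<lambda>z::'a \<times> 'a. \<bar>f (fst z)\<bar>)" "bdd_borel (\<lambda>z::'a \<times> 'a. \<bar>f (snd z)\<bar>)"
    by (auto intro: bdd_borel_compose[OF fa])
  define r1 where "r1 u = (\<integral>w. p y u w \<partial>lborel)" for u
  define r2 where "r2 u = (\<integral>w. p y w u \<partial>lborel)" for u
  have ip: "integrable (lborel \<Otimes>\<^sub>M lborel) (\<lambda>(u, w). p y u w)"
    using den[of "\<lambda>_. 1"] by (simp add: lborel_prod case_prod_beta')
  have ip1: "integrable (lborel \<Otimes>\<^sub>M lborel) (\<lambda>(u, w). p y u w * \<bar>f u\<bar>)"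
    using den[OF g1(1)] by (simp add: lborel_prod case_prod_beta')
  have ip2: "integrable (lborel \<Otimes>\<^sub>M lborel) (\<lambda>(w, u). p y w u * \<bar>f u\<bar>)"
    using den[OF g1(2)] by (simp add: lborel_prod case_prod_beta')
  have e1: "(\<integral>z. ?q z * \<bar>f (fst z)\<bar> \<partial>lborel) = (\<integral>u. r1 u * \<bar>f u\<bar> \<partial>lborel)"
    using lborel_pair.integral_fst'[OF ip1] unfolding lborel_prod r1_def by (simp add: case_prod_beta')
  have e2: "(\<integral>z. ?q z * \<bar>f (snd z)\<bar> \<partial>lborel) = (\<integral>u. r2 u * \<bar>f u\<bar> \<partial>lborel)"
    using lborel_pair.integral_snd[OF ip2] unfolding lborel_prod r2_def by (simp add: case_prod_beta')
  have i1: "integrable lborel (\<lambda>u. r1 u * \<bar>f u\<bar>)"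
    using lborel_pair.integrable_fst'[OF ip1] by (simp add: r1_def)
  have i2: "integrable lborel (\<lambda>u. r2 u * \<bar>f u\<bar>)"
    using lborel_pair.integrable_snd[OF ip2] by (simp add: r2_def)
  \<comment> \<open>The integral in \<open>Q_dens\<close> splits into the two marginals where both
    sections are integrable, which Fubini ensures for almost every \<open>u\<close>.\<close>
  have "AE u in lborel. integrable lborel (\<lambda>w. p y u w)"
    using lborel_pair.AE_integrable_fst'[OF ip] by simp
  moreover have "AE u in lborel. integrable lborel (\<lambda>w. p y w u)"
    using lborel_pair.AE_integrable_snd[OF ip] by simp
  ultimately have ae: "AE u in lborel. r1 u * \<bar>f u\<bar> + r2 u * \<bar>f u\<bar> \<le> 2 * C0 * \<bar>f u\<bar>"
  proof eventually_elim
    case (elim u)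
    then have "r1 u + r2 u = 2 * Q_dens p y u" by (simp add: Q_dens_def r1_def r2_def)
    also have "\<dots> \<le> 2 * C0" using density_bounds(2) by simp
    finally show ?case unfolding distrib_right[symmetric] by (intro mult_right_mono) auto
  qed
  have "\<bar>Q f y\<bar> \<le> (\<bar>\<integral>z. f (fst z) \<partial>kernel_meas p y\<bar> + \<bar>\<integral>z. f (snd z) \<partial>kernel_meas p y\<bar>) / 2"
    unfolding Q_op_def by simp
  also have "\<dots> \<le> ((\<integral>z. \<bar>f (fst z)\<bar> \<partial>kernel_meas p y) + (\<integral>z. \<bar>f (snd z)\<bar> \<partial>kernel_meas p y)) / 2"
    by (intro divide_right_mono add_mono integral_abs_bound) auto
  also have "\<dots> = (\<integral>u. r1 u * \<bar>f u\<bar> + r2 u * \<bar>f u\<bar> \<partial>lborel) / 2"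
    using i1 i2 by (simp add: kernel_integral_density e1 e2)
  also have "\<dots> \<le> (\<integral>u. 2 * C0 * \<bar>f u\<bar> \<partial>lborel) / 2"
    using i1 i2 i ae by (intro divide_right_mono integral_mono_AE) auto
  finally show ?thesis by simp
qed

text \<open>The first of the \<open>Suc j\<close> steps is spent on smoothing, after which
  \<open>Q f / e\<close> is bounded by 1 and hence by \<open>V\<close>; the other \<open>j\<close>
  steps give the geometric decay. A separate \<open>e > 0\<close> avoids dividing by an integral
  that may be zero.\<close>

lemma Q_power_centered:
  assumes f: "bdd_borel f" and i: "integrable lborel f"
    and e: "0 < e" "C0 * (\<integral>z. \<bar>f z\<bar> \<partial>lborel) \<le> e"
  shows "\<bar>(Q ^^ Suc j) (\<lambda>y. f y - (\<integral>z. f z \<partial>\<mu>)) y\<bar> \<le> e * Mc * \<alpha> ^ j * V y"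
proof -
  let ?m = "\<integral>z. f z \<partial>\<mu>"
  have cen: "(Q ^^ n) (\<lambda>y. g y - m) = (\<lambda>y. (Q ^^ n) g y - m)" if "bdd_borel g" for g m n
    using that by (induction n) (simp_all add: Q_diff bdd_borel_Q_power)
  define q where "q y = 1 / e * Q f y" for y
  have q: "bdd_borel q" unfolding q_def[abs_def] by (intro bdd_borel_cmult bdd_borel_Q f)
  have "\<bar>q y\<bar> \<le> V y" for y
  proof -
    have "\<bar>q y\<bar> \<le> 1"
      using e(1) order_trans[OF Q_abs_le[OF f i, of y] e(2)] by (simp add: q_def abs_mult divide_le_eq)
    then show ?thesis using V_ge_1[of y] by linarith
  qed
  then have "\<bar>(Q ^^ j) q y - (\<integral>z. q z \<partial>\<mu>)\<bar> \<le> Mc * \<alpha> ^ j * V y"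
    by (rule ergodic[OF q])
  moreover have "(Q ^^ j) q y - (\<integral>z. q z \<partial>\<mu>) = 1 / e * ((Q ^^ Suc j) f y - ?m)"
    unfolding q_def Q_power_cmult by (simp add: Q_invariant[OF f] Q_power_Suc_right right_diff_distrib diff_divide_distrib del: funpow.simps)
  ultimately have "\<bar>(Q ^^ Suc j) f y - ?m\<bar> / e \<le> Mc * \<alpha> ^ j * V y"
    using e(1) by (simp add: abs_mult del: funpow.simps)
  then show ?thesis
    unfolding cen[OF f] using e(1) by (simp add: divide_le_eq mult_ac del: funpow.simps)
qed

text \<open>The sum of \<open>2 ^ j * \<alpha> ^ (2 * j)\<close> behaves differently for
  \<open>2 * \<alpha>\<^sup>2\<close> below, at or above 1. Comparison with a geometric sum of ratio
  \<open>\<beta> > 1\<close> treats the three regimes at once.\<close>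

lemma S_second_moment_centered:
  assumes \<beta>: "1 < \<beta>" "2 * \<alpha>\<^sup>2 \<le> \<beta>"
  obtains D where "0 \<le> D"
    "\<And>f c e k. bdd_borel f \<Longrightarrow> integrable lborel f \<Longrightarrow> (\<And>y. \<bar>f y\<bar> \<le> c) \<Longrightarrow> 0 < e \<Longrightarrow> C0 * (\<integral>z. \<bar>f z\<bar> \<partial>lborel) \<le> e
      \<Longrightarrow> expectation (\<lambda>\<omega>. (S k (\<lambda>y. f y - (\<integral>z. f z \<partial>\<mu>)) \<omega>)\<^sup>2) \<le> D * 2 ^ k * (c\<^sup>2 + e\<^sup>2 * \<beta> ^ k)"
proof -
  obtain B where B: "0 \<le> B"
    "\<And>w r C. bdd_borel w \<Longrightarrow> 0 \<le> C \<Longrightarrow> (\<And>y. w y \<le> C * (V y)\<^sup>2) \<Longrightarrow> expectation (S r w) \<le> C * 2 ^ r * B"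
    by (rule moment_bound) blast
  \<comment> \<open>The geometric sum of \<open>\<beta> ^ j\<close> over \<open>j < k\<close> is at
    most \<open>\<beta> ^ k / (\<beta> - 1)\<close>.\<close>
  define E where "E = 2 * Mc\<^sup>2 / (\<beta> - 1)"
  have E0: "0 \<le> E" using \<beta> by (simp add: E_def)
  show ?thesis
  proof (rule that[of "2 * B * (4 + E)"])
    show "0 \<le> 2 * B * (4 + E)" using B(1) E0 by simp
    fix f :: "'a \<Rightarrow> real" and c e k
    assume f: "bdd_borel f" and i: "integrable lborel f" and c: "\<And>y. \<bar>f y\<bar> \<le> c"
      and e: "0 < e" "C0 * (\<integral>z. \<bar>f z\<bar> \<partial>lborel) \<le> e"
    let ?m = "\<integral>z. f z \<partial>\<mu>"
    let ?f = "\<lambda>y. f y - ?m"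
    \<comment> \<open>At \<open>j = 0\<close> no smoothing has taken place, and only the uniform
      bound is available: \<open>c\<close> for \<open>f\<close> and again \<open>c\<close> for its
      mean.\<close>
    define cj where "cj j = (case j of 0 \<Rightarrow> 2 * c | Suc j \<Rightarrow> e * Mc * \<alpha> ^ j)" for j
    have f': "bdd_borel ?f" by (intro bdd_borel_diff f) simp
    have c0: "0 \<le> c" using c[of undefined] by linarith
    have "\<bar>(Q ^^ j) ?f y\<bar> \<le> cj j * V y" for j y
    proof (cases j)
      case 0
      have "\<bar>f y - ?m\<bar> \<le> 2 * c * 1" using c[of y] integral_mu_abs_le[OF f c] by linarith
      also have "\<dots> \<le> 2 * c * V y" using V_ge_1[of y] c0 by (intro mult_left_mono) auto
      finally show ?thesis using 0 by (simp add: cj_def)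
    next
      case (Suc j')
      then show ?thesis using Q_power_centered[OF f i e, of j' y] by (simp add: cj_def del: funpow.simps)
    qed
    then have "expectation (\<lambda>\<omega>. (S k ?f \<omega>)\<^sup>2) \<le> 2 ^ Suc k * B * (\<Sum>j\<le>k. 2 ^ j * (cj j)\<^sup>2)"
      by (intro second_moment_bound[where V = V] B(2) f')
    also have "\<dots> \<le> 2 ^ Suc k * B * ((4 + E) * (c\<^sup>2 + e\<^sup>2 * \<beta> ^ k))"
    proof (intro mult_left_mono)
      have "(\<Sum>j\<le>k. 2 ^ j * (cj j)\<^sup>2) = 4 * c\<^sup>2 + (\<Sum>j<k. 2 ^ Suc j * (e * Mc * \<alpha> ^ j)\<^sup>2)"
        by (simp add: lessThan_Suc_atMost[symmetric] sum.lessThan_Suc_shift cj_def power_mult_distrib del: sum.lessThan_Suc power_Suc)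
      also have "(\<Sum>j<k. 2 ^ Suc j * (e * Mc * \<alpha> ^ j)\<^sup>2) \<le> E * (e\<^sup>2 * \<beta> ^ k)"
      proof -
        have "(\<Sum>j<k. 2 ^ Suc j * (e * Mc * \<alpha> ^ j)\<^sup>2) = 2 * e\<^sup>2 * Mc\<^sup>2 * (\<Sum>j<k. (2 * \<alpha>\<^sup>2) ^ j)"
          unfolding sum_distrib_left by (intro sum.cong refl) (simp add: power_mult_distrib power_mult[symmetric] mult_ac)
        also have "\<dots> \<le> 2 * e\<^sup>2 * Mc\<^sup>2 * (\<Sum>j<k. \<beta> ^ j)"
          using \<beta> by (intro mult_left_mono sum_mono power_mono) auto
        also have "\<dots> \<le> 2 * e\<^sup>2 * Mc\<^sup>2 * (\<beta> ^ k / (\<beta> - 1))"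
          using \<beta> by (intro mult_left_mono) (subst geometric_sum, auto intro: divide_right_mono)
        finally show ?thesis by (simp add: E_def mult_ac)
      qed
      finally have "(\<Sum>j\<le>k. 2 ^ j * (cj j)\<^sup>2) \<le> 4 * c\<^sup>2 + E * (e\<^sup>2 * \<beta> ^ k)"
        by simp
      also have "\<dots> \<le> (4 + E) * (c\<^sup>2 + e\<^sup>2 * \<beta> ^ k)"
        using E0 \<beta> by (simp add: algebra_simps)
      finally show "(\<Sum>j\<le>k. 2 ^ j * (cj j)\<^sup>2) \<le> (4 + E) * (c\<^sup>2 + e\<^sup>2 * \<beta> ^ k)" .
    qed (use B(1) in simp)
    finally show "expectation (\<lambda>\<omega>. (S k ?f \<omega>)\<^sup>2) \<le> 2 * B * (4 + E) * 2 ^ k * (c\<^sup>2 + e\<^sup>2 * \<beta> ^ k)"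
      by (simp only: power_Suc mult_ac)
  qed
qed

lemma expectation_abs_le_sqrt:
  assumes f: "bdd_borel f" shows "expectation (\<lambda>\<omega>. \<bar>S k f \<omega>\<bar>) \<le> sqrt (expectation (\<lambda>\<omega>. (S k f \<omega>)\<^sup>2))"
proof (rule real_le_rsqrt)
  have i: "integrable M (\<lambda>\<omega>. \<bar>S k f \<omega>\<bar>)" by (intro integrable_abs integrable_S f)
  have i2: "integrable M (\<lambda>\<omega>. \<bar>S k f \<omega>\<bar>\<^sup>2)" using integrable_S_power2[OF f] by simp
  show "(expectation (\<lambda>\<omega>. \<bar>S k f \<omega>\<bar>))\<^sup>2 \<le> expectation (\<lambda>\<omega>. (S k f \<omega>)\<^sup>2)"
    using variance_positive[of "\<lambda>\<omega>. \<bar>S k f \<omega>\<bar>"] variance_eq[OF i i2] by simp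
qed

text \<open>The bounds for single generations grow like \<open>sqrt 2 ^ k\<close>, so their sum is
  comparable to the last one. The whole tree therefore costs only the constant
  \<open>sqrt 2 / (sqrt 2 - 1)\<close> more than generation \<open>n\<close>.\<close>

lemma sum_S_centered_L1:
  assumes \<beta>: "1 < \<beta>" "2 * \<alpha>\<^sup>2 \<le> \<beta>"
  obtains D where "0 \<le> D"
    "\<And>f c e n. bdd_borel f \<Longrightarrow> integrable lborel f \<Longrightarrow> (\<And>y. \<bar>f y\<bar> \<le> c) \<Longrightarrow> 0 < e \<Longrightarrow> C0 * (\<integral>z. \<bar>f z\<bar> \<partial>lborel) \<le> e
      \<Longrightarrow> (\<Sum>k\<le>n. expectation (\<lambda>\<omega>. \<bar>S k (\<lambda>y. f y - (\<integral>z. f z \<partial>\<mu>)) \<omega>\<bar>)) \<le> D * sqrt (2 ^ n) * (c + e * sqrt (\<beta> ^ n))"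
proof -
  obtain D where D: "0 \<le> D"
    "\<And>f c e k. bdd_borel f \<Longrightarrow> integrable lborel f \<Longrightarrow> (\<And>y. \<bar>f y\<bar> \<le> c) \<Longrightarrow> 0 < e \<Longrightarrow> C0 * (\<integral>z. \<bar>f z\<bar> \<partial>lborel) \<le> e
      \<Longrightarrow> expectation (\<lambda>\<omega>. (S k (\<lambda>y. f y - (\<integral>z. f z \<partial>\<mu>)) \<omega>)\<^sup>2) \<le> D * 2 ^ k * (c\<^sup>2 + e\<^sup>2 * \<beta> ^ k)"
    by (rule S_second_moment_centered[OF \<beta>]) blast
  let ?C = "sqrt 2 / (sqrt 2 - 1)"
  show ?thesis
  proof (rule that[of "?C * sqrt D"])
    show "0 \<le> ?C * sqrt D" using D(1) by simp
    fix f :: "'a \<Rightarrow> real" and c e n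
    assume f: "bdd_borel f" and i: "integrable lborel f" and c: "\<And>y. \<bar>f y\<bar> \<le> c"
      and e: "0 < e" "C0 * (\<integral>z. \<bar>f z\<bar> \<partial>lborel) \<le> e"
    have c0: "0 \<le> c" using c[of undefined] by linarith
    let ?r = "sqrt D * (c + e * sqrt (\<beta> ^ n))"
    have r0: "0 \<le> ?r" using D(1) c0 e(1) \<beta>(1) by simp
    have "expectation (\<lambda>\<omega>. \<bar>S k (\<lambda>y. f y - (\<integral>z. f z \<partial>\<mu>)) \<omega>\<bar>) \<le> ?r * sqrt 2 ^ k" if k: "k \<le> n" for k
    proof -
      have "expectation (\<lambda>\<omega>. \<bar>S k (\<lambda>y. f y - (\<integral>z. f z \<partial>\<mu>)) \<omega>\<bar>)
         \<le> sqrt (expectation (\<lambda>\<omega>. (S k (\<lambda>y. f y - (\<integral>z. f z \<partial>\<mu>)) \<omega>)\<^sup>2))"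
        by (intro expectation_abs_le_sqrt bdd_borel_diff f) simp
      also have "\<dots> \<le> sqrt (D * 2 ^ k * (c\<^sup>2 + e\<^sup>2 * \<beta> ^ k))"
        by (intro real_sqrt_le_mono D(2) f i c e)
      also have "\<dots> = sqrt D * sqrt 2 ^ k * sqrt (c\<^sup>2 + e\<^sup>2 * \<beta> ^ k)"
        by (simp add: real_sqrt_mult real_sqrt_power)
      also have "\<dots> \<le> sqrt D * sqrt 2 ^ k * (c + e * sqrt (\<beta> ^ n))"
      proof (intro mult_left_mono)
        have "sqrt (c\<^sup>2 + e\<^sup>2 * \<beta> ^ k) \<le> sqrt (c\<^sup>2 + e\<^sup>2 * \<beta> ^ n)"
          using \<beta>(1) k by (intro real_sqrt_le_mono add_left_mono mult_left_mono power_increasing) auto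
        also have "\<dots> \<le> sqrt (c\<^sup>2) + sqrt (e\<^sup>2 * \<beta> ^ n)"
          using \<beta>(1) by (intro sqrt_add_le_add_sqrt) auto
        also have "\<dots> = c + e * sqrt (\<beta> ^ n)" using c0 e(1) by (simp add: real_sqrt_mult)
        finally show "sqrt (c\<^sup>2 + e\<^sup>2 * \<beta> ^ k) \<le> c + e * sqrt (\<beta> ^ n)" .
      qed (use D(1) in simp)
      finally show ?thesis by (simp add: mult_ac)
    qed
    then have "(\<Sum>k\<le>n. expectation (\<lambda>\<omega>. \<bar>S k (\<lambda>y. f y - (\<integral>z. f z \<partial>\<mu>)) \<omega>\<bar>)) \<le> (\<Sum>k\<le>n. ?r * sqrt 2 ^ k)"
      by (intro sum_mono) auto
    also have "\<dots> = ?r * ((sqrt 2 ^ Suc n - 1) / (sqrt 2 - 1))"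
      unfolding sum_distrib_left[symmetric] lessThan_Suc_atMost[symmetric] by (subst geometric_sum) auto
    also have "\<dots> \<le> ?r * (sqrt 2 ^ Suc n / (sqrt 2 - 1))"
      by (intro mult_left_mono divide_right_mono r0) auto
    finally show "(\<Sum>k\<le>n. expectation (\<lambda>\<omega>. \<bar>S k (\<lambda>y. f y - (\<integral>z. f z \<partial>\<mu>)) \<omega>\<bar>))
        \<le> ?C * sqrt D * sqrt (2 ^ n) * (c + e * sqrt (\<beta> ^ n))"
      by (simp add: real_sqrt_power mult_ac)
  qed
qed

end

subsection \<open>Characteristic functions of quotients and product kernels\<close>

lemma cmod_iexp_diff_le: "cmod (iexp a - iexp b) \<le> \<bar>a - b\<bar>"
proof -
  have "iexp a - iexp b = iexp b * (iexp (a - b) - 1)"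
    by (simp add: algebra_simps exp_add[symmetric])
  also have "cmod \<dots> = cmod (iexp (a - b) - 1)" by (simp add: norm_mult)
  also have "\<dots> \<le> \<bar>a - b\<bar>" using iexp_approx1[of "a - b" 0] by simp
  finally show ?thesis .
qed

lemma (in prob_space) cmod_char_diff_le:
  assumes [measurable]: "Y \<in> borel_measurable M" "Z \<in> borel_measurable M"
    and D: "integrable M D" and le: "\<And>\<omega>. cmod (iexp (t * Y \<omega>) - iexp (t * Z \<omega>)) \<le> D \<omega>"
  shows "cmod ((CLINT \<omega>|M. iexp (t * Y \<omega>)) - (CLINT \<omega>|M. iexp (t * Z \<omega>))) \<le> expectation D"
proof -
  have i: "integrable M (\<lambda>\<omega>. iexp (t * Y \<omega>))" "integrable M (\<lambda>\<omega>. iexp (t * Z \<omega>))"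
    by (auto intro!: integrable_const_bound[where B = 1])
  have "cmod ((CLINT \<omega>|M. iexp (t * Y \<omega>)) - (CLINT \<omega>|M. iexp (t * Z \<omega>))) 
     = cmod (CLINT \<omega>|M. iexp (t * Y \<omega>) - iexp (t * Z \<omega>))"
    using i by simp
  also have "\<dots> \<le> expectation (\<lambda>\<omega>. cmod (iexp (t * Y \<omega>) - iexp (t * Z \<omega>)))"
    by (rule integral_norm_bound)
  also have "\<dots> \<le> expectation D" using i D le by (intro integral_mono) auto
  finally show ?thesis .
qed

lemma abs_ratio_diff_le:
  fixes N U u :: real
  assumes u: "0 < u" and U: "\<bar>U - u\<bar> \<le> u / 2" shows "\<bar>N / U - N / u\<bar> \<le> 2 / u\<^sup>2 * (\<bar>N\<bar> * \<bar>U - u\<bar>)"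
proof -
  have U0: "u / 2 \<le> U" using U by linarith
  have "\<bar>N / U - N / u\<bar> = \<bar>N\<bar> * \<bar>U - u\<bar> / (U * u)"
    using u U0 by (simp add: diff_frac_eq abs_mult[symmetric] right_diff_distrib abs_minus_commute mult.commute)
  also have "\<dots> \<le> \<bar>N\<bar> * \<bar>U - u\<bar> / (u / 2 * u)"
    using u U0 by (intro divide_left_mono mult_right_mono) auto
  finally show ?thesis by (simp add: power2_eq_square mult_ac)
qed

text \<open>Slutsky's theorem for quotients. Nothing is assumed about \<open>Y n\<close> where \<open>U n = 0\<close>: there the estimator takes
  its junk value, but \<open>U n\<close> is close to \<open>u > 0\<close> with high probability.\<close>
lemma (in prob_space) char_quotient_tendsto:
  fixes Y N Z U :: "nat \<Rightarrow> 'a \<Rightarrow> real" and \<phi> :: "real \<Rightarrow> complex"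
  assumes meas [measurable]: "\<And>n. Y n \<in> borel_measurable M" "\<And>n. N n \<in> borel_measurable M"
      "\<And>n. Z n \<in> borel_measurable M" "\<And>n. U n \<in> borel_measurable M"
    and quot: "\<And>n \<omega>. U n \<omega> \<noteq> 0 \<Longrightarrow> Y n \<omega> = N n \<omega> / U n \<omega>"
    and iN: "\<And>n. integrable M (N n)" and B: "\<And>n. expectation (\<lambda>\<omega>. \<bar>N n \<omega>\<bar>) \<le> B"
    and iU: "\<And>n. integrable M (U n)" and u: "0 < u" and U: "(\<lambda>n. expectation (\<lambda>\<omega>. \<bar>U n \<omega> - u\<bar>)) \<longlonglongrightarrow> 0"
    and iZ: "\<And>n. integrable M (Z n)" and NZ: "(\<lambda>n. expectation (\<lambda>\<omega>. \<bar>N n \<omega> - Z n \<omega>\<bar>)) \<longlonglongrightarrow> 0"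
    and Z: "\<And>t. (\<lambda>n. CLINT \<omega>|M. iexp (t * Z n \<omega>)) \<longlonglongrightarrow> \<phi> t"
  shows "(\<lambda>n. CLINT \<omega>|M. iexp (t * Y n \<omega>)) \<longlonglongrightarrow> \<phi> (t / u)"
proof -
  define e where "e n = expectation (\<lambda>\<omega>. \<bar>U n \<omega> - u\<bar>)" for n
  \<comment> \<open>By Markov's inequality \<open>U n\<close> deviates from \<open>u\<close> by more
    than \<open>\<delta> n\<close> with probability at most
    \<open>e n / \<delta> n \<le> \<delta> n\<close>. The added inverse keeps
    \<open>\<delta> n\<close> positive when \<open>e n = 0\<close>.\<close>
  define \<delta> where "\<delta> n = sqrt (e n + inverse (real (Suc n)))" for n
  have e0: "0 \<le> e n" for n unfolding e_def by simp
  have \<delta>0: "0 < \<delta> n" for n using e0[of n] by (simp add: \<delta>_def add_nonneg_pos)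
  have "\<delta> \<longlonglongrightarrow> sqrt (0 + 0)"
    unfolding \<delta>_def e_def by (intro tendsto_intros U LIMSEQ_inverse_real_of_nat)
  then have \<delta>: "\<delta> \<longlonglongrightarrow> 0" by simp
  have e_le: "e n / \<delta> n \<le> \<delta> n" for n
  proof -
    have "e n \<le> \<delta> n * \<delta> n" using e0[of n] by (simp add: \<delta>_def)
    then show ?thesis using \<delta>0[of n] by (simp add: divide_le_eq)
  qed
  have diff1: "cmod ((CLINT \<omega>|M. iexp (t * Y n \<omega>)) - (CLINT \<omega>|M. iexp (t * (N n \<omega> / u))))
      \<le> \<bar>t\<bar> * (2 / u\<^sup>2) * \<delta> n * B + 2 * \<delta> n" if n: "\<delta> n \<le> u / 2" for n
  proof -
    \<comment> \<open>The first summand dominates when \<open>U n\<close> is within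
      \<open>\<delta> n\<close> of \<open>u\<close>; otherwise the second exceeds 2, the trivial
      bound for a difference of two unimodular numbers.\<close>
    let ?D = "\<lambda>\<omega>. \<bar>t\<bar> * (2 / u\<^sup>2) * \<delta> n * \<bar>N n \<omega>\<bar> + 2 / \<delta> n * \<bar>U n \<omega> - u\<bar>"
    have "cmod ((CLINT \<omega>|M. iexp (t * Y n \<omega>)) - (CLINT \<omega>|M. iexp (t * (N n \<omega> / u)))) \<le> expectation ?D"
    proof (rule cmod_char_diff_le)
      show "integrable M ?D" using iN iU by auto
      fix \<omega>
      show "cmod (iexp (t * Y n \<omega>) - iexp (t * (N n \<omega> / u))) \<le> ?D \<omega>"
      proof (cases "\<bar>U n \<omega> - u\<bar> \<le> \<delta> n")
        case True
        then have near: "\<bar>U n \<omega> - u\<bar> \<le> u / 2" using n by linarith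
        then have "U n \<omega> \<noteq> 0" using u by linarith
        then have "\<bar>Y n \<omega> - N n \<omega> / u\<bar> \<le> 2 / u\<^sup>2 * (\<bar>N n \<omega>\<bar> * \<bar>U n \<omega> - u\<bar>)"
          using abs_ratio_diff_le[OF u near] by (simp add: quot)
        also have "\<dots> \<le> 2 / u\<^sup>2 * (\<bar>N n \<omega>\<bar> * \<delta> n)" using True by (intro mult_left_mono) auto
        finally have "\<bar>t\<bar> * \<bar>Y n \<omega> - N n \<omega> / u\<bar> \<le> \<bar>t\<bar> * (2 / u\<^sup>2 * (\<bar>N n \<omega>\<bar> * \<delta> n))"
          by (rule mult_left_mono) simp
        moreover have "cmod (iexp (t * Y n \<omega>) - iexp (t * (N n \<omega> / u))) \<le> \<bar>t\<bar> * \<bar>Y n \<omega> - N n \<omega> / u\<bar>"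
          using cmod_iexp_diff_le[of "t * Y n \<omega>" "t * (N n \<omega> / u)"]
          by (simp only: right_diff_distrib[symmetric] abs_mult)
        moreover have "0 \<le> 2 / \<delta> n * \<bar>U n \<omega> - u\<bar>" using \<delta>0[of n] by simp
        ultimately show ?thesis by (simp add: mult_ac)
      next
        case False
        then have "1 \<le> \<bar>U n \<omega> - u\<bar> / \<delta> n" using \<delta>0[of n] by simp
        moreover have "cmod (iexp (t * Y n \<omega>) - iexp (t * (N n \<omega> / u))) \<le> 1 + 1"
          by (rule order_trans[OF norm_triangle_ineq4]) (intro add_mono, simp_all)
        moreover have "0 \<le> \<bar>t\<bar> * (2 / u\<^sup>2) * \<delta> n * \<bar>N n \<omega>\<bar>" using \<delta>0[of n] by simp
        ultimately show ?thesis by simp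
      qed
    qed measurable
    also have "expectation ?D = \<bar>t\<bar> * (2 / u\<^sup>2) * \<delta> n * expectation (\<lambda>\<omega>. \<bar>N n \<omega>\<bar>) + 2 * (e n / \<delta> n)"
      using iN iU by (simp add: e_def)
    also have "\<dots> \<le> \<bar>t\<bar> * (2 / u\<^sup>2) * \<delta> n * B + 2 * \<delta> n"
      using \<delta>0[of n] e_le by (intro add_mono mult_left_mono B) auto
    finally show ?thesis .
  qed
  have "(\<lambda>n. (CLINT \<omega>|M. iexp (t * Y n \<omega>)) - (CLINT \<omega>|M. iexp (t * (N n \<omega> / u)))) \<longlonglongrightarrow> 0"
  proof (rule Lim_null_comparison)
    have "eventually (\<lambda>n. \<delta> n < u / 2) sequentially" using \<delta> u by (intro order_tendstoD(2)) auto
    then show "eventually (\<lambda>n. cmod ((CLINT \<omega>|M. iexp (t * Y n \<omega>)) - (CLINT \<omega>|M. iexp (t * (N n \<omega> / u))))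
        \<le> \<bar>t\<bar> * (2 / u\<^sup>2) * \<delta> n * B + 2 * \<delta> n) sequentially"
      by eventually_elim (rule diff1, simp)
    have "(\<lambda>n. \<bar>t\<bar> * (2 / u\<^sup>2) * \<delta> n * B + 2 * \<delta> n) \<longlonglongrightarrow> \<bar>t\<bar> * (2 / u\<^sup>2) * 0 * B + 2 * 0"
      by (intro tendsto_intros \<delta>)
    then show "(\<lambda>n. \<bar>t\<bar> * (2 / u\<^sup>2) * \<delta> n * B + 2 * \<delta> n) \<longlonglongrightarrow> 0" by simp
  qed
  moreover have "(\<lambda>n. (CLINT \<omega>|M. iexp (t / u * N n \<omega>)) - (CLINT \<omega>|M. iexp (t / u * Z n \<omega>))) \<longlonglongrightarrow> 0"
  proof (rule Lim_null_comparison[OF always_eventually])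
    show "\<forall>n. cmod ((CLINT \<omega>|M. iexp (t / u * N n \<omega>)) - (CLINT \<omega>|M. iexp (t / u * Z n \<omega>)))
        \<le> \<bar>t / u\<bar> * expectation (\<lambda>\<omega>. \<bar>N n \<omega> - Z n \<omega>\<bar>)"
    proof
      fix n
      have "cmod ((CLINT \<omega>|M. iexp (t / u * N n \<omega>)) - (CLINT \<omega>|M. iexp (t / u * Z n \<omega>)))
        \<le> expectation (\<lambda>\<omega>. \<bar>t / u\<bar> * \<bar>N n \<omega> - Z n \<omega>\<bar>)"
      proof (rule cmod_char_diff_le)
        show "cmod (iexp (t / u * N n \<omega>) - iexp (t / u * Z n \<omega>)) \<le> \<bar>t / u\<bar> * \<bar>N n \<omega> - Z n \<omega>\<bar>" for \<omega>
          using cmod_iexp_diff_le[of "t / u * N n \<omega>" "t / u * Z n \<omega>"]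
          by (simp only: right_diff_distrib[symmetric] abs_mult)
      qed (use iN iZ in auto)
      then show "cmod ((CLINT \<omega>|M. iexp (t / u * N n \<omega>)) - (CLINT \<omega>|M. iexp (t / u * Z n \<omega>)))
        \<le> \<bar>t / u\<bar> * expectation (\<lambda>\<omega>. \<bar>N n \<omega> - Z n \<omega>\<bar>)" by simp
    qed
    show "(\<lambda>n. \<bar>t / u\<bar> * expectation (\<lambda>\<omega>. \<bar>N n \<omega> - Z n \<omega>\<bar>)) \<longlonglongrightarrow> 0"
      using tendsto_mult_left[OF NZ, of "\<bar>t / u\<bar>"] by simp
  qed
  ultimately have "(\<lambda>n. ((CLINT \<omega>|M. iexp (t * Y n \<omega>)) - (CLINT \<omega>|M. iexp (t * (N n \<omega> / u))))
      + ((CLINT \<omega>|M. iexp (t / u * N n \<omega>)) - (CLINT \<omega>|M. iexp (t / u * Z n \<omega>)))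
      + (CLINT \<omega>|M. iexp (t / u * Z n \<omega>))) \<longlonglongrightarrow> 0 + 0 + \<phi> (t / u)"
    by (intro tendsto_add Z)
  then show ?thesis by simp
qed

section \<open>Centered Gaussian laws, including the degenerate one\<close>

lemma real_distribution_centered_gaussian:
  assumes "0 \<le> v" shows "real_distribution (centered_gaussian v)"
proof (cases "v = 0")
  case True
  then show ?thesis unfolding centered_gaussian_def real_distribution_def real_distribution_axioms_def
    by (simp add: prob_space_return)
next
  case False
  then show ?thesis using assms unfolding centered_gaussian_def real_distribution_def real_distribution_axioms_def
    by (simp add: prob_space_normal_density)
qed

lemma char_centered_gaussian:
  assumes v: "0 \<le> v" shows "char (centered_gaussian v) t = exp (- (t\<^sup>2 * v / 2))"
proof (cases "v = 0")
  case True
  then show ?thesis unfolding char_def centered_gaussian_def by (simp add: integral_return)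
next
  case False
  then have s: "0 < sqrt v" using v by simp
  let ?s = "sqrt v"
  have "char (centered_gaussian v) t = (CLINT x|lborel. normal_density 0 ?s x *\<^sub>R iexp (t * x))"
    using False unfolding char_def centered_gaussian_def by (simp add: integral_density)
  also have "\<dots> = \<bar>?s\<bar> *\<^sub>R (CLINT x|lborel. normal_density 0 ?s (0 + ?s * x) *\<^sub>R iexp (t * (0 + ?s * x)))"
    using s by (intro lborel_integral_real_affine) simp
  also have "\<dots> = (CLINT x|lborel. \<bar>?s\<bar> *\<^sub>R (normal_density 0 ?s (0 + ?s * x) *\<^sub>R iexp (t * (0 + ?s * x))))"
    by (rule integral_scaleR_right[symmetric])
  also have "\<dots> = (CLINT x|lborel. std_normal_density x *\<^sub>R iexp ((t * ?s) * x))"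
    using s v by (intro Bochner_Integration.integral_cong refl)
      (simp add: normal_density_def real_sqrt_mult power_mult_distrib mult_ac)
  also have "\<dots> = char std_normal_distribution (t * ?s)"
    unfolding char_def by (simp add: integral_density)
  also have "\<dots> = exp (- (t\<^sup>2 * v / 2))" using v by (simp add: char_std_normal_distribution power_mult_distrib)
  finally show ?thesis .
qed

section \<open>Integrals and moments of tensor product kernels\<close>

lemma lborel_integral_product:
  fixes f :: "'b::euclidean_space \<Rightarrow> real" and g :: "'c::euclidean_space \<Rightarrow> real"
  assumes f: "integrable lborel f" and g: "integrable lborel g"
  shows "integrable lborel (\<lambda>z. f (fst z) * g (snd z))"
    and "(\<integral>z. f (fst z) * g (snd z) \<partial>lborel) = (\<integral>y. f y \<partial>lborel) * (\<integral>y. g y \<partial>lborel)"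
proof -
  have [measurable]: "f \<in> borel_measurable borel" "g \<in> borel_measurable borel"
    using f g by (auto dest: borel_measurable_integrable)
  have i: "integrable (lborel \<Otimes>\<^sub>M lborel) (\<lambda>(y, z). f y * g z)"
  proof (rule lborel_pair.Fubini_integrable)
    show "integrable lborel (\<lambda>y. \<integral>z. norm (case (y, z) of (y, z) \<Rightarrow> f y * g z) \<partial>lborel)"
      using f by (simp add: abs_mult)
    show "AE y in lborel. integrable lborel (\<lambda>z. case (y, z) of (y, z) \<Rightarrow> f y * g z)"
      using g by simp
  qed measurable
  then show "integrable lborel (\<lambda>z. f (fst z) * g (snd z))"
    by (simp add: lborel_prod case_prod_beta')
  show "(\<integral>z. f (fst z) * g (snd z) \<partial>lborel) = (\<integral>y. f y \<partial>lborel) * (\<integral>y. g y \<partial>lborel)"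
    using lborel_pair.integral_fst'[OF i] by (simp add: lborel_prod case_prod_beta')
qed

lemma Ktens_product: "Ktens K z = K (fst z) * (K (fst (snd z)) * K (snd (snd z)))"
  by (simp add: Ktens_def mult.assoc)

lemma Ktens_integral:
  assumes "integrable lborel K"
  shows "integrable lborel (Ktens K)" and "(\<integral>z. Ktens K z \<partial>lborel) = (\<integral>y. K y \<partial>lborel) ^ 3"
  unfolding Ktens_product[abs_def]
  using lborel_integral_product[OF assms lborel_integral_product(1)[OF assms assms]]
    lborel_integral_product(2)[OF assms assms]
  by (simp_all add: power3_eq_cube mult.assoc)

lemma Ktens_measurable [measurable]:
  fixes K :: "'a::euclidean_space \<Rightarrow> real"
  assumes [measurable]: "K \<in> borel_measurable borel"
  shows "Ktens K \<in> borel_measurable borel"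
  unfolding Ktens_def[abs_def] by measurable

lemma Basis_triple_cases:
  assumes "b \<in> (Basis :: ('a::euclidean_space \<times> 'a \<times> 'a) set)"
  obtains u where "u \<in> Basis" "b = (u, 0, 0)" | u where "u \<in> Basis" "b = (0, u, 0)" | u where "u \<in> Basis" "b = (0, 0, u)"
  using assms unfolding Basis_prod_def by (auto simp: zero_prod_def)

text \<open>Along a coordinate line only one of the three factors varies; the other two form the
  constant \<open>c\<close> in front of a moment of \<open>K\<close>.\<close>

lemma kernel_moments_Ktens:
  fixes K :: "'a::euclidean_space \<Rightarrow> real"
  assumes K: "kernel_moments s K" shows "kernel_moments s (Ktens K)"
  unfolding kernel_moments_def
proof (intro ballI allI)
  fix b z :: "'a \<times> 'a \<times> 'a" and k
  assume b: "b \<in> Basis" and k: "k \<in> {1..nat \<lfloor>s\<rfloor>}"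
  obtain z0 z1 z2 where z: "z = (z0, z1, z2)" by (cases z) auto
  have line: "integrable lborel (\<lambda>t. t ^ k * K (w + (t - w \<bullet> u) *\<^sub>R u))" 
     "(\<integral>t. t ^ k * K (w + (t - w \<bullet> u) *\<^sub>R u) \<partial>lborel) = 0" if "u \<in> Basis" for w u
    using K that k unfolding kernel_moments_def by blast+
  have aux: "integrable lborel (\<lambda>t. t ^ k * Ktens K (z + (t - z \<bullet> b) *\<^sub>R b)) \<and>
        (\<integral>t. t ^ k * Ktens K (z + (t - z \<bullet> b) *\<^sub>R b) \<partial>lborel) = 0"
    if u: "u \<in> Basis" and eq: "\<And>t. Ktens K (z + (t - z \<bullet> b) *\<^sub>R b) = c * K (w + (t - w \<bullet> u) *\<^sub>R u)" for u w c
  proof -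
    have eq': "(\<lambda>t. t ^ k * Ktens K (z + (t - z \<bullet> b) *\<^sub>R b)) = (\<lambda>t. c * (t ^ k * K (w + (t - w \<bullet> u) *\<^sub>R u)))"
      by (rule ext) (simp add: eq)
    show ?thesis unfolding eq' using line[OF u, of w] by simp
  qed
  show "integrable lborel (\<lambda>t. t ^ k * Ktens K (z + (t - z \<bullet> b) *\<^sub>R b)) \<and>
        (\<integral>t. t ^ k * Ktens K (z + (t - z \<bullet> b) *\<^sub>R b) \<partial>lborel) = 0"
    using b
  proof (cases rule: Basis_triple_cases)
    case (1 u) then show ?thesis by (intro aux[of u "K z1 * K z2" z0]) (simp_all add: z Ktens_def)
  next
    case (2 u) then show ?thesis by (intro aux[of u "K z0 * K z2" z1]) (simp_all add: z Ktens_def)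
  next
    case (3 u) then show ?thesis by (intro aux[of u "K z0 * K z1" z2]) (simp_all add: z Ktens_def)
  qed
qed

lemma coordinate_moment_integrable:
  fixes K :: "'b::euclidean_space \<Rightarrow> real"
  assumes [measurable]: "K \<in> borel_measurable borel"
    and i: "integrable lborel (\<lambda>z. norm z powr s * \<bar>K z\<bar>)" and s: "0 \<le> s" and b: "b \<in> Basis"
  shows "integrable lborel (\<lambda>z. \<bar>z \<bullet> b\<bar> powr s * \<bar>K z\<bar>)"
proof (rule Bochner_Integration.integrable_bound[OF i])
  have "\<bar>z \<bullet> b\<bar> powr s * \<bar>K z\<bar> \<le> norm z powr s * \<bar>K z\<bar>" for z
    using s Basis_le_norm[OF b, of z] by (intro mult_right_mono powr_mono2) auto
  then show "AE z in lborel. norm (\<bar>z \<bullet> b\<bar> powr s * \<bar>K z\<bar>) \<le> norm (norm z powr s * \<bar>K z\<bar>)" by simp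
qed measurable

lemma coordinate_moment_integrable_Ktens:
  assumes [measurable]: "K \<in> borel_measurable borel" and K: "integrable lborel K"
    and i: "integrable lborel (\<lambda>z. norm z powr s * \<bar>K z\<bar>)" and s: "0 \<le> s" and b: "b \<in> Basis"
  shows "integrable lborel (\<lambda>z. \<bar>z \<bullet> b\<bar> powr s * \<bar>Ktens K z\<bar>)"
proof -
  have aK: "integrable lborel (\<lambda>z. \<bar>K z\<bar>)" using K by auto
  note cm = coordinate_moment_integrable[OF assms(1) i s]
  note prod3 = lborel_integral_product(1)[OF _ lborel_integral_product(1)]
  show ?thesis using b
  proof (cases rule: Basis_triple_cases)
    case (1 u) then show ?thesis
      using prod3[OF cm[OF 1(1)] aK aK] by (simp add: Ktens_product abs_mult mult_ac inner_prod_def)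
  next
    case (2 u) then show ?thesis
      using prod3[OF aK cm[OF 2(1)] aK] by (simp add: Ktens_product abs_mult mult_ac inner_prod_def)
  next
    case (3 u) then show ?thesis
      using prod3[OF aK aK cm[OF 3(1)]] by (simp add: Ktens_product abs_mult mult_ac inner_prod_def)
  qed
qed

subsection \<open>Localized functions and rates\<close>

context ergodic_bmc begin

lemma bdd_borel_Ktens:
  assumes "bdd_borel \<phi>" shows "bdd_borel (Ktens (\<phi> :: 'a \<Rightarrow> real))"
  unfolding Ktens_def[abs_def]
  by (intro bdd_borel_mult bdd_borel_compose[OF assms]) auto

lemma bdd_borel_rescale:
  "bdd_borel \<phi> \<Longrightarrow> bdd_borel (\<lambda>z. \<phi> ((1 / \<eta>) *\<^sub>R (x - z)))" for \<phi> :: "'b::euclidean_space \<Rightarrow> real"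
  by (erule bdd_borel_compose) auto

text \<open>Bounding the kernel density by \<open>C0\<close> leaves two integrals over the children,
  each worth \<open>\<eta> ^ DIM('a)\<close>. The factor at the parent stays pointwise and keeps the
  result concentrated near \<open>x\<close>.\<close>

lemma P_Ktens_le:
  assumes \<phi>: "bdd_borel \<phi>" and i: "integrable lborel \<phi>" and \<eta>: "0 < \<eta>"
  shows "\<bar>P (\<lambda>z. Ktens \<phi> ((1 / \<eta>) *\<^sub>R ((x, x0, x1) - z))) y\<bar>
    \<le> C0 * (\<integral>z. \<bar>\<phi> z\<bar> \<partial>lborel)\<^sup>2 * \<eta> ^ (2 * DIM('a)) * \<bar>\<phi> ((1 / \<eta>) *\<^sub>R (x - y))\<bar>"
proof -
  have [measurable]: "\<phi> \<in> borel_measurable borel" by (rule bdd_borel_measurable[OF \<phi>])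
  let ?\<psi> = "\<lambda>v z. \<phi> ((1 / \<eta>) *\<^sub>R (v - z))"
  let ?w = "\<lambda>z::'a \<times> 'a. ?\<psi> x0 (fst z) * ?\<psi> x1 (snd z)"
  have G: "bdd_borel (\<lambda>z. Ktens \<phi> ((1 / \<eta>) *\<^sub>R ((x, x0, x1) - z)))"
    by (intro bdd_borel_rescale bdd_borel_Ktens \<phi>)
  have ia: "integrable lborel (\<lambda>z. \<bar>?\<psi> v z\<bar>)" for v
    using lborel_integrable_rescale[OF i \<eta>] by auto
  have ea: "(\<integral>z. \<bar>?\<psi> v z\<bar> \<partial>lborel) = \<eta> ^ DIM('a) * (\<integral>z. \<bar>\<phi> z\<bar> \<partial>lborel)" for v
    using lborel_integral_rescale[of "\<lambda>z. \<bar>\<phi> z\<bar>" \<eta> v] \<eta> by simp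
  have iw: "integrable lborel (\<lambda>z. \<bar>?w z\<bar>)"
    using lborel_integral_product(1)[OF ia ia] by (simp add: abs_mult)
  let ?D = "\<lambda>z. C0 * \<bar>?\<psi> x y\<bar> * \<bar>?w z\<bar>"
  have le: "\<bar>p y (fst z) (snd z) * (?\<psi> x y * ?w z)\<bar> \<le> ?D z" for z
    unfolding abs_mult[of "p y (fst z) (snd z)"] abs_mult[of "?\<psi> x y"] mult.assoc
    using density_bounds(3) p_nonneg by (intro mult_right_mono) auto
  have iD: "integrable lborel ?D" using iw by auto
  have iL: "integrable lborel (\<lambda>z. p y (fst z) (snd z) * (?\<psi> x y * ?w z))"
    by (rule Bochner_Integration.integrable_bound[OF iD])
       (use order_trans[OF le abs_ge_self] in \<open>simp_all\<close>)
  have eq: "P (\<lambda>z. Ktens \<phi> ((1 / \<eta>) *\<^sub>R ((x, x0, x1) - z))) y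
     = (\<integral>z. p y (fst z) (snd z) * (?\<psi> x y * ?w z) \<partial>lborel)"
    unfolding P_eq_lborel[OF bdd_borel_measurable[OF G]]
    by (intro Bochner_Integration.integral_cong refl) (simp add: Ktens_def)
  have "\<bar>\<integral>z. p y (fst z) (snd z) * (?\<psi> x y * ?w z) \<partial>lborel\<bar>
     \<le> (\<integral>z. \<bar>p y (fst z) (snd z) * (?\<psi> x y * ?w z)\<bar> \<partial>lborel)"
    by (rule integral_abs_bound)
  also have "\<dots> \<le> (\<integral>z. ?D z \<partial>lborel)"
    by (rule integral_mono[OF integrable_abs[OF iL] iD le])
  also have "(\<integral>z. ?D z \<partial>lborel) = C0 * \<bar>?\<psi> x y\<bar> * ((\<integral>z. \<bar>?\<psi> x0 z\<bar> \<partial>lborel) * (\<integral>z. \<bar>?\<psi> x1 z\<bar> \<partial>lborel))"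
    using lborel_integral_product(2)[OF ia[of x0] ia[of x1]] by (simp add: abs_mult)
  finally have "\<bar>\<integral>z. p y (fst z) (snd z) * (?\<psi> x y * ?w z) \<partial>lborel\<bar>
    \<le> C0 * \<bar>?\<psi> x y\<bar> * ((\<integral>z. \<bar>?\<psi> x0 z\<bar> \<partial>lborel) * (\<integral>z. \<bar>?\<psi> x1 z\<bar> \<partial>lborel))" .
  moreover have "\<eta> ^ (2 * DIM('a)) = \<eta> ^ DIM('a) * \<eta> ^ DIM('a)" by (simp add: power_add[symmetric] mult_2)
  ultimately show ?thesis unfolding eq ea by (simp only: power2_eq_square mult_ac)
qed

lemma mu_tri_measurable [measurable]: "mu_tri mu p \<in> borel_measurable borel"
  unfolding mu_tri_def[abs_def] by measurable

lemma mu_tri_bounds: "0 \<le> mu_tri mu p z" "\<bar>mu_tri mu p z\<bar> \<le> C0 * C0"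
  using density_bounds mu_nonneg p_nonneg by (auto simp: mu_tri_def abs_mult intro!: mult_mono)

text \<open>In equilibrium \<open>mu_tri\<close> is the joint density of a vertex and its two
  children.\<close>

lemma integral_mu_P:
  assumes G: "bdd_borel G"
  shows "(\<integral>y. P G y \<partial>\<mu>) = (\<integral>z. mu_tri mu p z * G z \<partial>lborel)"
proof -
  have [measurable]: "G \<in> borel_measurable borel" by (rule bdd_borel_measurable[OF G])
  have Ga: "bdd_borel (\<lambda>z. \<bar>G z\<bar>)" using G unfolding bdd_borel_def by auto
  have norm: "(\<integral>z. norm (mu_tri mu p (y, z) * G (y, z)) \<partial>lborel) = mu y * P (\<lambda>z. \<bar>G z\<bar>) y" for y
    by (simp add: P_eq_lborel mu_tri_def abs_mult mu_nonneg p_nonneg mult.assoc)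
  have i: "integrable (lborel \<Otimes>\<^sub>M lborel) (\<lambda>(y, z). mu_tri mu p (y, z) * G (y, z))"
  proof (rule lborel_pair.Fubini_integrable)
    have "integrable \<mu> (P (\<lambda>z. \<bar>G z\<bar>))" by (intro integrable_mu bdd_borel_P Ga)
    then have "integrable lborel (\<lambda>y. mu y * P (\<lambda>z. \<bar>G z\<bar>) y)"
      by (subst (asm) integrable_density) (auto simp: mu_nonneg bdd_borel_measurable[OF bdd_borel_P[OF Ga]])
    then show "integrable lborel (\<lambda>y. \<integral>z. norm (case (y, z) of (y, z) \<Rightarrow> mu_tri mu p (y, z) * G (y, z)) \<partial>lborel)"
      using norm by simp
    have "integrable lborel (\<lambda>z. p y (fst z) (snd z) * G (y, z))" for y
      using kernel_integrable3[OF G, of y] unfolding kernel_meas_def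
      by (subst (asm) integrable_density) (auto simp: p_nonneg)
    then show "AE y in lborel. integrable lborel (\<lambda>z. case (y, z) of (y, z) \<Rightarrow> mu_tri mu p (y, z) * G (y, z))"
      by (simp add: mu_tri_def mult.assoc)
  qed (simp add: lborel_prod case_prod_beta')
  have "(\<integral>y. P G y \<partial>\<mu>) = (\<integral>y. mu y * P G y \<partial>lborel)"
    by (rule integral_mu) (rule bdd_borel_measurable[OF bdd_borel_P[OF G]])
  also have "\<dots> = (\<integral>y. (\<integral>z. mu_tri mu p (y, z) * G (y, z) \<partial>lborel) \<partial>lborel)"
    by (simp add: P_eq_lborel mu_tri_def mult.assoc)
  also have "\<dots> = (\<integral>z. mu_tri mu p z * G z \<partial>lborel)"
    using lborel_pair.integral_fst'[OF i] by (simp add: lborel_prod case_prod_beta')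
  finally show ?thesis .
qed

lemma integral_mu_P_Ktens:
  assumes \<phi>: "bdd_borel \<phi>" and \<eta>: "0 < \<eta>"
  shows "(\<integral>y. P (\<lambda>z. Ktens \<phi> ((1 / \<eta>) *\<^sub>R (xx - z))) y \<partial>\<mu>)
    = \<eta> ^ (3 * DIM('a)) * (\<integral>w. Ktens \<phi> w * mu_tri mu p (xx - \<eta> *\<^sub>R w) \<partial>lborel)"
proof -
  have [measurable]: "\<phi> \<in> borel_measurable borel" by (rule bdd_borel_measurable[OF \<phi>])
  have "(\<integral>y. P (\<lambda>z. Ktens \<phi> ((1 / \<eta>) *\<^sub>R (xx - z))) y \<partial>\<mu>)
     = (\<integral>z. mu_tri mu p z * Ktens \<phi> ((1 / \<eta>) *\<^sub>R (xx - z)) \<partial>lborel)"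
    by (intro integral_mu_P bdd_borel_rescale bdd_borel_Ktens \<phi>)
  also have "\<dots> = (\<integral>z. (\<lambda>w. Ktens \<phi> w * mu_tri mu p (xx - \<eta> *\<^sub>R w)) ((1 / \<eta>) *\<^sub>R (xx - z)) \<partial>lborel)"
    using \<eta> by (simp add: mult.commute)
  also have "\<dots> = \<eta> ^ DIM('a \<times> 'a \<times> 'a) * (\<integral>w. Ktens \<phi> w * mu_tri mu p (xx - \<eta> *\<^sub>R w) \<partial>lborel)"
    by (rule lborel_integral_rescale) (use \<eta> in measurable)
  finally show ?thesis by (simp add: numeral_3_eq_3)
qed

lemma integral_mu_rescale:
  assumes [measurable]: "\<phi> \<in> borel_measurable borel" and \<eta>: "0 < \<eta>"
  shows "(\<integral>y. \<phi> ((1 / \<eta>) *\<^sub>R (x - y)) \<partial>\<mu>) = \<eta> ^ DIM('a) * (\<integral>w. \<phi> w * mu (x - \<eta> *\<^sub>R w) \<partial>lborel)"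
proof -
  have "(\<integral>y. \<phi> ((1 / \<eta>) *\<^sub>R (x - y)) \<partial>\<mu>) = (\<integral>y. (\<lambda>w. \<phi> w * mu (x - \<eta> *\<^sub>R w)) ((1 / \<eta>) *\<^sub>R (x - y)) \<partial>lborel)"
    using \<eta> by (simp add: integral_mu mult.commute)
  also have "\<dots> = \<eta> ^ DIM('a) * (\<integral>w. \<phi> w * mu (x - \<eta> *\<^sub>R w) \<partial>lborel)"
    by (rule lborel_integral_rescale) (use \<eta> in measurable)
  finally show ?thesis .
qed

end

text \<open>Powers of the bandwidth are geometric in \<open>n\<close>; the rates below thus amount
  to comparing a ratio with 1.\<close>

lemma bandwidth_power: "bandwidth \<gamma> n ^ k = (2 powr (- (real k * \<gamma>))) ^ n"
  by (simp add: bandwidth_def powr_realpow[symmetric] powr_powr powr_power mult_ac)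

lemma bandwidth_powr: "bandwidth \<gamma> n powr s = (2 powr (- (s * \<gamma>))) ^ n"
  by (simp add: bandwidth_def powr_powr powr_power mult_ac)

text \<open>\<open>I n\<close> is the set of generations that are observed: \<open>{n}\<close> for \<open>Gen n\<close> and \<open>{..n}\<close> for \<open>Tree n\<close>.\<close>
locale kernel_estimation = ergodic_bmc p M X nu F mu V \<alpha> Mc C0
  for p :: "'a::euclidean_space \<Rightarrow> 'a \<Rightarrow> 'a \<Rightarrow> real"
    and M :: "'w measure" and X and nu and F and mu V and \<alpha> Mc C0 :: real +
  fixes K0 :: "'a \<Rightarrow> real" and s L \<gamma> :: real and x x0 x1 :: 'a and I :: "nat \<Rightarrow> nat set"
  assumes \<gamma>: "0 < \<gamma>" "\<gamma> < 1 / (3 * real DIM('a))" and \<alpha>_\<gamma>: "2 * \<alpha>\<^sup>2 < 2 powr (3 * real DIM('a) * \<gamma>)"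
    and K0_measurable [measurable]: "K0 \<in> borel_measurable borel" and K0_bounded: "bounded (range K0)"
    and K0_integrable: "integrable lborel K0" and K0_integral: "(\<integral>z. K0 z \<partial>lborel) = 1"
    and s: "0 < s" and smooth: "holder_smooth s L (mu_tri mu p)" "holder_smooth s L mu"
    and K0_tail: "integrable lborel (\<lambda>z. norm z powr s * \<bar>K0 z\<bar>)" and K0_moments: "kernel_moments s K0"
    and \<gamma>_s: "1 / (2 * s + 3 * real DIM('a)) < \<gamma>"
    and I: "n \<in> I n" "I n \<subseteq> {..n}" and mu_x: "0 < mu x"
begin

abbreviation "xx \<equiv> (x, x0, x1)"

definition h :: "nat \<Rightarrow> real" where "h n = bandwidth \<gamma> n"
text \<open>The number of observed vertices. Correspondingly \<open>sqrt (a n)\<close> is the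
  normalisation of the estimator.\<close>

definition N :: "nat \<Rightarrow> real" where "N n = (\<Sum>k\<in>I n. 2 ^ k)"
definition a :: "nat \<Rightarrow> real" where "a n = N n * h n ^ (3 * DIM('a))"

lemma finite_I [simp]: "finite (I n)"
  using I(2) finite_subset by blast

lemma h_pos [simp]: "0 < h n"
  by (simp add: h_def bandwidth_def)

lemma h_nonzero [simp]: "h n \<noteq> 0"
  using less_imp_neq[OF h_pos] by metis

lemma h_power_pos [simp]: "0 < h n ^ k" "0 \<le> h n ^ k"
  using h_pos[of n] by (auto simp: less_imp_le)

lemma h_tendsto: "h \<longlonglongrightarrow> 0"
proof -
  have "(2::real) powr (- \<gamma>) < 2 powr 0" using \<gamma>(1) by (intro powr_less_mono) auto
  then have "(\<lambda>n. (2 powr (- \<gamma>)) ^ n) \<longlonglongrightarrow> (0::real)" by (intro LIMSEQ_power_zero) simp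
  moreover have "h = (\<lambda>n. (2 powr (- \<gamma>)) ^ n)"
    using bandwidth_power[of \<gamma> _ 1] by (simp add: h_def fun_eq_iff)
  ultimately show ?thesis by simp
qed

lemma N_bounds: "2 ^ n \<le> N n" "N n \<le> 2 * 2 ^ n" "0 < N n"
proof -
  show 1: "2 ^ n \<le> N n"
    unfolding N_def using I(1)[of n] by (intro member_le_sum) auto
  have "N n \<le> (\<Sum>k\<in>{..n}. 2 ^ k)" unfolding N_def using I(2) by (intro sum_mono2) auto
  also have "\<dots> \<le> 2 * 2 ^ n"
    unfolding lessThan_Suc_atMost[symmetric] by (subst geometric_sum) auto
  finally show "N n \<le> 2 * 2 ^ n" .
  show "0 < N n" using 1 by (rule less_le_trans[rotated]) simp
qed

lemma a_pos [simp]: "0 < a n"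
  using N_bounds(3) by (simp add: a_def)

lemma abs_a [simp]: "\<bar>a n\<bar> = a n"
  by (rule abs_of_pos) (rule a_pos)

lemma a_ge: "2 ^ n * h n ^ (3 * DIM('a)) \<le> a n"
  unfolding a_def using N_bounds(1) h_pos[of n] by (intro mult_right_mono) auto

text \<open>Here \<open>\<gamma> < 1 / (3 d)\<close> enters: \<open>a n\<close> dominates
  \<open>\<rho> ^ n\<close> with \<open>\<rho> = 2 powr (1 - 3 d \<gamma>) > 1\<close>.\<close>

lemma inverse_sqrt_a_tendsto: "(\<lambda>n. 1 / sqrt (a n)) \<longlonglongrightarrow> 0"
proof -
  define \<rho> :: real where "\<rho> = 2 * 2 powr (- (real (3 * DIM('a)) * \<gamma>))"
  have "real (3 * DIM('a)) * \<gamma> < 1" using \<gamma>(2) by (simp add: field_simps)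
  then have "(2::real) powr (-1) < 2 powr (- (real (3 * DIM('a)) * \<gamma>))" by (intro powr_less_mono) auto
  then have \<rho>: "1 < \<rho>" by (simp add: \<rho>_def powr_minus field_simps)
  have le: "\<rho> ^ n \<le> a n" for n
    using a_ge[of n] by (simp add: \<rho>_def h_def bandwidth_power power_mult_distrib)
  have le': "norm (1 / sqrt (a n)) \<le> (1 / sqrt \<rho>) ^ n" for n
  proof -
    have "1 / sqrt (a n) \<le> 1 / sqrt (\<rho> ^ n)"
      using \<rho> le[of n] by (intro frac_le real_sqrt_le_mono) auto
    then show ?thesis using a_pos[of n] by (simp add: power_divide real_sqrt_power less_imp_le del: a_pos)
  qed
  show ?thesis
    by (rule Lim_null_comparison[OF always_eventually[OF allI[OF le']]]) (use \<rho> in \<open>simp add: LIMSEQ_power_zero\<close>)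
qed

text \<open>Here \<open>\<gamma> > 1 / (2 s + 3 d)\<close> enters: squaring gives at most
  \<open>2 * \<rho> ^ n\<close> with
  \<open>\<rho> = 2 powr (1 - (2 s + 3 d) \<gamma>) < 1\<close>.\<close>

lemma bias_rate_tendsto: "(\<lambda>n. sqrt (a n) * h n powr s) \<longlonglongrightarrow> 0"
proof -
  define \<rho> :: real where "\<rho> = 2 * 2 powr (- (real (3 * DIM('a)) * \<gamma>)) * (2 powr (- (s * \<gamma>)))\<^sup>2"
  have "1 < (2 * s + 3 * real DIM('a)) * \<gamma>"
    using \<gamma>_s s by (simp add: divide_less_eq mult.commute add_pos_pos)
  then have "(2::real) powr (1 - (2 * s + 3 * real DIM('a)) * \<gamma>) < 2 powr 0" by (intro powr_less_mono) auto
  moreover have "\<rho> = 2 powr (1 - (2 * s + 3 * real DIM('a)) * \<gamma>)"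
  proof -
    have "\<rho> = 2 powr 1 * 2 powr (- (real (3 * DIM('a)) * \<gamma>)) * (2 powr (- (s * \<gamma>)) * 2 powr (- (s * \<gamma>)))"
      by (simp add: \<rho>_def power2_eq_square)
    then show ?thesis unfolding powr_add[symmetric] by (simp add: algebra_simps)
  qed
  ultimately have \<rho>: "0 \<le> \<rho>" "\<rho> < 1" by auto
  have eq: "2 ^ n * h n ^ (3 * DIM('a)) * (h n powr s)\<^sup>2 = \<rho> ^ n" for n
    by (simp add: \<rho>_def h_def bandwidth_power bandwidth_powr power_mult_distrib power_mult[symmetric] mult.commute)
  have le: "norm (a n * (h n powr s)\<^sup>2) \<le> 2 * \<rho> ^ n" for n
  proof -
    have "a n * (h n powr s)\<^sup>2 \<le> 2 * 2 ^ n * h n ^ (3 * DIM('a)) * (h n powr s)\<^sup>2"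
      unfolding a_def using N_bounds(2) h_pos[of n] by (intro mult_right_mono) auto
    also have "\<dots> = 2 * \<rho> ^ n" unfolding eq[symmetric] by (simp only: mult.assoc)
    finally show ?thesis using less_imp_le[OF a_pos[of n]] by (simp only: real_norm_def abs_of_nonneg mult_nonneg_nonneg zero_le_power2)
  qed
  have "(\<lambda>n. a n * (h n powr s)\<^sup>2) \<longlonglongrightarrow> 0"
    by (rule Lim_null_comparison[OF always_eventually[OF allI[OF le]]])
       (use \<rho> in \<open>simp add: tendsto_mult_right_zero LIMSEQ_power_zero\<close>)
  then have "(\<lambda>n. sqrt (a n * (h n powr s)\<^sup>2)) \<longlonglongrightarrow> sqrt 0" by (rule tendsto_real_sqrt)
  then show ?thesis by (simp add: real_sqrt_mult)
qed

lemma bdd_borel_K0: "bdd_borel K0"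
  using K0_bounded unfolding bdd_borel_def bounded_iff by auto

lemma K0_power2_integrable: "integrable lborel (\<lambda>z. (K0 z)\<^sup>2)"
proof -
  obtain C where C: "0 < C" "\<And>z. \<bar>K0 z\<bar> \<le> C" by (rule bdd_borelE[OF bdd_borel_K0]) blast
  show ?thesis
  proof (rule Bochner_Integration.integrable_bound[of _ "\<lambda>z. C * \<bar>K0 z\<bar>"])
    have "\<bar>K0 z\<bar> * \<bar>K0 z\<bar> \<le> C * \<bar>K0 z\<bar>" for z using C(2) by (intro mult_right_mono) auto
    then show "AE z in lborel. norm ((K0 z)\<^sup>2) \<le> norm (C * \<bar>K0 z\<bar>)"
      using C(1) by (simp add: power2_eq_square abs_mult)
  qed (use K0_integrable in auto)
qed

text \<open>Used for the drift of the numerator, for the terms of the density estimate and for the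
  conditional variances, which all have this size and localization. After normalisation there remain
  \<open>sqrt (h^d)\<close> and \<open>sqrt (h^3d * \<beta> ^ n)\<close>.\<close>

lemma localized_sums_vanish:
  assumes f: "\<And>n. f n \<in> borel_measurable borel"
    and C: "\<And>n y. \<bar>f n y\<bar> \<le> C * h n ^ (2 * DIM('a)) * \<bar>K0 ((1 / h n) *\<^sub>R (x - y))\<bar>"
  shows "(\<lambda>n. (\<Sum>k\<in>I n. expectation (\<lambda>\<omega>. \<bar>S k (\<lambda>y. f n y - (\<integral>z. f n z \<partial>\<mu>)) \<omega>\<bar>)) / sqrt (a n)) \<longlonglongrightarrow> 0"
proof -
  obtain \<kappa> where \<kappa>: "0 < \<kappa>" "\<And>z. \<bar>K0 z\<bar> \<le> \<kappa>" by (rule bdd_borelE[OF bdd_borel_K0]) blast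
  define B where "B = (2::real) powr (3 * real DIM('a) * \<gamma>)"
  \<comment> \<open>The ratio must exceed 1, be at least \<open>2 * \<alpha>\<^sup>2\<close> and
    stay below \<open>B\<close>. The midpoint of 1 and \<open>B\<close> takes over when
    \<open>2 * \<alpha>\<^sup>2\<close> is small.\<close>
  define \<beta> where "\<beta> = max (2 * \<alpha>\<^sup>2) ((1 + B) / 2)"
  have "(2::real) powr 0 < B" unfolding B_def using \<gamma>(1) by (intro powr_less_mono) auto
  then have "1 < (1 + B) / 2" by simp
  then have "1 < \<beta>" unfolding \<beta>_def by (rule less_le_trans) simp
  moreover have "2 * \<alpha>\<^sup>2 \<le> \<beta>" by (simp add: \<beta>_def)
  moreover have "\<beta> < B" using \<alpha>_\<gamma> \<open>1 < (1 + B) / 2\<close> by (simp add: \<beta>_def B_def)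
  ultimately have \<beta>: "1 < \<beta>" "2 * \<alpha>\<^sup>2 \<le> \<beta>" "\<beta> < B" by auto
  obtain D where D: "0 \<le> D"
    "\<And>f c e n. bdd_borel f \<Longrightarrow> integrable lborel f \<Longrightarrow> (\<And>y. \<bar>f y\<bar> \<le> c) \<Longrightarrow> 0 < e \<Longrightarrow> C0 * (\<integral>z. \<bar>f z\<bar> \<partial>lborel) \<le> e
      \<Longrightarrow> (\<Sum>k\<le>n. expectation (\<lambda>\<omega>. \<bar>S k (\<lambda>y. f y - (\<integral>z. f z \<partial>\<mu>)) \<omega>\<bar>)) \<le> D * sqrt (2 ^ n) * (c + e * sqrt (\<beta> ^ n))"
    by (rule sum_S_centered_L1[OF \<beta>(1,2)]) blast
  let ?K = "\<lambda>n y. \<bar>K0 ((1 / h n) *\<^sub>R (x - y))\<bar>"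
  define J where "J = (\<integral>z. \<bar>K0 z\<bar> \<partial>lborel)"
  have J0: "0 \<le> J" unfolding J_def by simp
  have C': "\<bar>f n y\<bar> \<le> \<bar>C\<bar> * h n ^ (2 * DIM('a)) * ?K n y" for n y
    by (rule order_trans[OF C]) (intro mult_right_mono, auto simp: less_imp_le)
  define c where "c n = \<bar>C\<bar> * h n ^ (2 * DIM('a)) * \<kappa>" for n
  \<comment> \<open>The summand 1 makes \<open>e\<close> strictly positive, as the moment bound
    requires.\<close>
  define E where "E = C0 * \<bar>C\<bar> * J + 1"
  have E0: "0 < E" using density_bounds(4) J0 by (simp add: E_def add_nonneg_pos)
  have iK: "integrable lborel (?K n)" for n
    using lborel_integrable_rescale[OF K0_integrable h_pos[of n], of x] by auto
  have JK: "(\<integral>y. ?K n y \<partial>lborel) = h n ^ DIM('a) * J" for n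
    using lborel_integral_rescale[of "\<lambda>z. \<bar>K0 z\<bar>" "h n" x] by (simp add: J_def)
  have fc: "\<bar>f n y\<bar> \<le> c n" for n y
    unfolding c_def by (rule order_trans[OF C']) (intro mult_left_mono \<kappa>(2), auto simp: less_imp_le)
  have fb: "bdd_borel (f n)" for n by (rule bdd_borelI[OF f fc])
  have fi: "integrable lborel (f n)" for n
    by (rule Bochner_Integration.integrable_bound[of _ "\<lambda>y. \<bar>C\<bar> * h n ^ (2 * DIM('a)) * ?K n y"])
       (use iK f order_trans[OF C' abs_ge_self] in auto)
  have fe: "C0 * (\<integral>z. \<bar>f n z\<bar> \<partial>lborel) \<le> E * h n ^ (3 * DIM('a))" for n
  proof -
    have "(\<integral>z. \<bar>f n z\<bar> \<partial>lborel) \<le> (\<integral>z. \<bar>C\<bar> * h n ^ (2 * DIM('a)) * ?K n z \<partial>lborel)"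
      using iK fi C' by (intro integral_mono) auto
    also have "\<dots> = \<bar>C\<bar> * J * h n ^ (3 * DIM('a))" by (simp add: JK power_add[symmetric])
    finally have "C0 * (\<integral>z. \<bar>f n z\<bar> \<partial>lborel) \<le> C0 * (\<bar>C\<bar> * J * h n ^ (3 * DIM('a)))"
      using density_bounds(4) by (rule mult_left_mono)
    also have "\<dots> \<le> E * h n ^ (3 * DIM('a))" by (simp add: E_def algebra_simps less_imp_le)
    finally show ?thesis .
  qed
  define R where "R n = (\<Sum>k\<in>I n. expectation (\<lambda>\<omega>. \<bar>S k (\<lambda>y. f n y - (\<integral>z. f n z \<partial>\<mu>)) \<omega>\<bar>))" for n
  have R0: "0 \<le> R n" for n unfolding R_def by (intro sum_nonneg) simp
  have R: "R n \<le> D * sqrt (2 ^ n) * (c n + E * h n ^ (3 * DIM('a)) * sqrt (\<beta> ^ n))" for n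
  proof -
    have "R n \<le> (\<Sum>k\<le>n. expectation (\<lambda>\<omega>. \<bar>S k (\<lambda>y. f n y - (\<integral>z. f n z \<partial>\<mu>)) \<omega>\<bar>))"
      unfolding R_def using I(2) by (intro sum_mono2) auto
    also have "\<dots> \<le> D * sqrt (2 ^ n) * (c n + E * h n ^ (3 * DIM('a)) * sqrt (\<beta> ^ n))"
      using E0 by (intro D(2) fb fi fc fe) simp
    finally show ?thesis .
  qed
  have le: "norm (R n / sqrt (a n)) \<le> D * (\<bar>C\<bar> * \<kappa> * sqrt (h n ^ DIM('a)) + E * sqrt (h n ^ (3 * DIM('a)) * \<beta> ^ n))" for n
  proof -
    \<comment> \<open>The normalisation absorbs \<open>sqrt (h^3d)\<close>; this leaves
      \<open>sqrt (h^d)\<close> out of \<open>h^2d\<close>.\<close>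
    have "h n ^ (3 * DIM('a)) * h n ^ DIM('a) = (h n ^ (2 * DIM('a)))\<^sup>2"
      by (simp add: power_mult[symmetric] power_add[symmetric])
    then have sq: "sqrt (h n ^ (3 * DIM('a))) * sqrt (h n ^ DIM('a)) = h n ^ (2 * DIM('a))"
      by (simp add: real_sqrt_mult[symmetric])
    have sq': "sqrt (h n ^ (3 * DIM('a))) * sqrt (h n ^ (3 * DIM('a))) = h n ^ (3 * DIM('a))"
      by simp
    have "norm (R n / sqrt (a n)) \<le> R n / sqrt (2 ^ n * h n ^ (3 * DIM('a)))"
    proof -
      have "norm (R n / sqrt (a n)) = R n / sqrt (a n)"
        using R0[of n] less_imp_le[OF a_pos[of n]] by (simp del: a_pos)
      also have "\<dots> \<le> R n / sqrt (2 ^ n * h n ^ (3 * DIM('a)))"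
        using R0[of n] a_ge[of n] by (intro divide_left_mono real_sqrt_le_mono) auto
      finally show ?thesis .
    qed
    also have "\<dots> \<le> D * sqrt (2 ^ n) * (c n + E * h n ^ (3 * DIM('a)) * sqrt (\<beta> ^ n)) / sqrt (2 ^ n * h n ^ (3 * DIM('a)))"
      by (intro divide_right_mono R) (simp add: less_imp_le)
    also have "\<dots> = D * (\<bar>C\<bar> * \<kappa> * sqrt (h n ^ DIM('a)) + E * sqrt (h n ^ (3 * DIM('a)) * \<beta> ^ n))"
    proof -
      have "c n + E * h n ^ (3 * DIM('a)) * sqrt (\<beta> ^ n)
        = sqrt (h n ^ (3 * DIM('a))) * (\<bar>C\<bar> * \<kappa> * sqrt (h n ^ DIM('a)) + E * sqrt (h n ^ (3 * DIM('a)) * \<beta> ^ n))"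
        unfolding c_def real_sqrt_mult distrib_left
        by (subst sq[symmetric], subst sq'[symmetric]) (simp only: mult_ac)
      then show ?thesis by (simp add: real_sqrt_mult)
    qed
    finally show ?thesis .
  qed
  have "(\<lambda>n. (2 powr (- (real (3 * DIM('a)) * \<gamma>)) * \<beta>) ^ n) \<longlonglongrightarrow> (0::real)"
  proof (rule LIMSEQ_power_zero)
    have "2 powr (- (real (3 * DIM('a)) * \<gamma>)) * \<beta> < 2 powr (- (real (3 * DIM('a)) * \<gamma>)) * B"
      using \<beta>(3) by (intro mult_strict_left_mono) auto
    also have "\<dots> = 1" by (simp add: B_def powr_add[symmetric])
    finally show "norm (2 powr (- (real (3 * DIM('a)) * \<gamma>)) * \<beta>) < 1" using \<beta>(1) by simp
  qed
  then have l1: "(\<lambda>n. h n ^ (3 * DIM('a)) * \<beta> ^ n) \<longlonglongrightarrow> 0"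
    by (simp add: h_def bandwidth_power power_mult_distrib)
  have "(\<lambda>n. h n ^ DIM('a)) \<longlonglongrightarrow> 0 ^ DIM('a)" by (intro tendsto_power h_tendsto)
  moreover have "(0::real) ^ DIM('a) = 0" by simp
  ultimately have l2: "(\<lambda>n. h n ^ DIM('a)) \<longlonglongrightarrow> 0" by (simp only:)
  have "(\<lambda>n. D * (\<bar>C\<bar> * \<kappa> * sqrt (h n ^ DIM('a)) + E * sqrt (h n ^ (3 * DIM('a)) * \<beta> ^ n)))
     \<longlonglongrightarrow> D * (\<bar>C\<bar> * \<kappa> * sqrt 0 + E * sqrt 0)"
    by (intro tendsto_intros l1 l2)
  then have lim: "(\<lambda>n. D * (\<bar>C\<bar> * \<kappa> * sqrt (h n ^ DIM('a)) + E * sqrt (h n ^ (3 * DIM('a)) * \<beta> ^ n))) \<longlonglongrightarrow> 0"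
    by simp
  show ?thesis
    unfolding R_def[symmetric] by (rule Lim_null_comparison[OF always_eventually[OF allI[OF le]] lim])
qed

end

subsection \<open>The central limit theorem\<close>

context kernel_estimation begin

lemma S_diff_const: "S k (\<lambda>y. f y - m) \<omega> = S k f \<omega> - 2 ^ k * m"
  by (simp add: gen_sum_def sum_subtractf)

lemma cond_var_cmult: "cond_var (\<lambda>z. c * g z) = (\<lambda>y. c\<^sup>2 * cond_var g y)"
  by (rule ext) (simp add: cond_var_def P_cmult power_mult_distrib right_diff_distrib)

lemma mart_incr_cmult: "mart_incr k (\<lambda>z. c * g z) \<omega> = c * mart_incr k g \<omega>"
  by (simp add: mart_incr_def centered_def P_cmult sum_distrib_left right_diff_distrib)

section \<open>The weighted martingale and its conditional variance\<close>

definition g :: "nat \<Rightarrow> 'a \<times> 'a \<times> 'a \<Rightarrow> real" where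
  "g n z = Ktens K0 ((1 / h n) *\<^sub>R (xx - z))"

text \<open>The factor \<open>h^2d\<close> brings the terms of the density estimate to the
  normalisation \<open>a n\<close> of the triple estimate, so that the two can be subtracted term by
  term.\<close>

definition loc_kernel :: "nat \<Rightarrow> 'a \<Rightarrow> real" where
  "loc_kernel n y = h n ^ (2 * DIM('a)) * K0 ((1 / h n) *\<^sub>R (x - y))"

text \<open>Limiting variance of the numerator; division by \<open>(mu x)\<^sup>2\<close> produces
  the variance of the theorem.\<close>

definition \<sigma>2 :: real where "\<sigma>2 = (\<integral>z. (K0 z)\<^sup>2 \<partial>lborel) ^ 3 * mu_tri mu p xx"

text \<open>Unobserved generations receive weight 0. A single generation and the whole tree then
  give martingales over the same index range \<open>{..n}\<close>.\<close>

definition weight :: "nat \<Rightarrow> nat \<Rightarrow> real" where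
  "weight n k = (if k \<in> I n then 1 / sqrt (a n) else 0)"

definition mart :: "nat \<Rightarrow> 'w \<Rightarrow> real" where
  "mart n \<omega> = (\<Sum>k<Suc n. mart_incr k (\<lambda>z. weight n k * g n z) \<omega>)"

text \<open>Deterministic proxy for the conditional variance: each observed generation gets a share
  of \<open>\<sigma>2\<close> proportional to its size.\<close>

definition target :: "nat \<Rightarrow> nat \<Rightarrow> real" where
  "target n k = (if k \<in> I n then 2 ^ k / N n * \<sigma>2 else 0)"

definition var_error :: "nat \<Rightarrow> real" where
  "var_error n = (\<Sum>k<Suc n. expectation (\<lambda>\<omega>. \<bar>S k (cond_var (\<lambda>z. weight n k * g n z)) \<omega> - target n k\<bar>))"

lemma sum_I: "(\<Sum>k<Suc n. if k \<in> I n then f k else 0) = (\<Sum>k\<in>I n. f k)"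
proof -
  have "{..<Suc n} \<inter> I n = I n" using I(2)[of n] by auto
  then show ?thesis by (simp add: sum.inter_restrict[symmetric] del: sum.lessThan_Suc)
qed

lemma bdd_borel_g: "bdd_borel (g n)"
  unfolding g_def[abs_def] by (intro bdd_borel_rescale bdd_borel_Ktens bdd_borel_K0)

lemma bdd_borel_wg: "bdd_borel (\<lambda>z. weight n k * g n z)"
  by (intro bdd_borel_cmult bdd_borel_g)

lemma bdd_borel_loc_kernel: "bdd_borel (loc_kernel n)"
  unfolding loc_kernel_def[abs_def] by (intro bdd_borel_cmult bdd_borel_rescale bdd_borel_K0)

lemma P_g_le: 
  obtains C where "0 \<le> C" "\<And>n y. \<bar>P (g n) y\<bar> \<le> C * h n ^ (2 * DIM('a)) * \<bar>K0 ((1 / h n) *\<^sub>R (x - y))\<bar>"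
proof (rule that[of "C0 * (\<integral>z. \<bar>K0 z\<bar> \<partial>lborel)\<^sup>2"])
  show "0 \<le> C0 * (\<integral>z. \<bar>K0 z\<bar> \<partial>lborel)\<^sup>2" using density_bounds(4) by simp
  show "\<bar>P (g n) y\<bar> \<le> C0 * (\<integral>z. \<bar>K0 z\<bar> \<partial>lborel)\<^sup>2 * h n ^ (2 * DIM('a)) * \<bar>K0 ((1 / h n) *\<^sub>R (x - y))\<bar>" for n y
    unfolding g_def[abs_def] by (rule P_Ktens_le[OF bdd_borel_K0 K0_integrable h_pos])
qed

lemma g_power2: "(g n z)\<^sup>2 = Ktens (\<lambda>u. (K0 u)\<^sup>2) ((1 / h n) *\<^sub>R (xx - z))"
  by (simp add: g_def Ktens_def power_mult_distrib)

text \<open>The squared kernel leaves two factors \<open>K0\<close> at the parent; bounding one by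
  \<open>\<kappa>\<close> restores the form that \<open>localized_sums_vanish\<close>
  accepts.\<close>

lemma cond_var_g_le:
  obtains C where "\<And>n y. \<bar>cond_var (g n) y\<bar> \<le> C * h n ^ (2 * DIM('a)) * \<bar>K0 ((1 / h n) *\<^sub>R (x - y))\<bar>"
proof -
  obtain \<kappa> where \<kappa>: "0 < \<kappa>" "\<And>z. \<bar>K0 z\<bar> \<le> \<kappa>" by (rule bdd_borelE[OF bdd_borel_K0]) blast
  let ?c = "C0 * (\<integral>z. \<bar>(K0 z)\<^sup>2\<bar> \<partial>lborel)\<^sup>2"
  have c0: "0 \<le> ?c" using density_bounds(4) by simp
  show ?thesis
  proof (rule that[of "?c * \<kappa>"])
    fix n y
    let ?k = "K0 ((1 / h n) *\<^sub>R (x - y))"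
    have "\<bar>cond_var (g n) y\<bar> \<le> P (\<lambda>z. (g n z)\<^sup>2) y"
      using cond_var_nonneg[OF bdd_borel_g] cond_var_le by simp
    also have "\<dots> \<le> ?c * h n ^ (2 * DIM('a)) * \<bar>?k\<^sup>2\<bar>"
      unfolding g_power2
      using P_Ktens_le[OF bdd_borel_power2[OF bdd_borel_K0] K0_power2_integrable h_pos[of n], of x x0 x1 y] by simp
    also have "\<bar>?k\<^sup>2\<bar> = \<bar>?k\<bar> * \<bar>?k\<bar>" by (simp add: power2_eq_square)
    also have "?c * h n ^ (2 * DIM('a)) * (\<bar>?k\<bar> * \<bar>?k\<bar>) \<le> ?c * h n ^ (2 * DIM('a)) * (\<kappa> * \<bar>?k\<bar>)"
      using density_bounds(4) \<kappa>(2) by (intro mult_left_mono mult_right_mono mult_nonneg_nonneg) auto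
    finally show "\<bar>cond_var (g n) y\<bar> \<le> ?c * \<kappa> * h n ^ (2 * DIM('a)) * \<bar>?k\<bar>" by (simp only: mult_ac)
  qed
qed

lemma mu_bounded: "\<bar>mu y\<bar> \<le> C0"
  using density_bounds(1) mu_nonneg by simp

text \<open>The limit comes from the conditional second moment alone: the squared conditional mean
  is of order \<open>h^4d\<close>, which is small compared with \<open>h^3d\<close>.\<close>

lemma mean_cond_var_tendsto: "(\<lambda>n. (\<integral>y. cond_var (g n) y \<partial>\<mu>) / h n ^ (3 * DIM('a))) \<longlonglongrightarrow> \<sigma>2"
proof -
  obtain \<kappa> where \<kappa>: "0 < \<kappa>" "\<And>z. \<bar>K0 z\<bar> \<le> \<kappa>" by (rule bdd_borelE[OF bdd_borel_K0]) blast
  obtain C where C: "0 \<le> C" "\<And>n y. \<bar>P (g n) y\<bar> \<le> C * h n ^ (2 * DIM('a)) * \<bar>K0 ((1 / h n) *\<^sub>R (x - y))\<bar>"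
    by (rule P_g_le) blast
  let ?K2 = "\<lambda>u. (K0 u)\<^sup>2"
  have K2: "bdd_borel ?K2" by (rule bdd_borel_power2[OF bdd_borel_K0])
  have b1: "bdd_borel (P (\<lambda>z. (g n z)\<^sup>2))" and b2: "bdd_borel (\<lambda>y. (P (g n) y)\<^sup>2)" for n
    by (intro bdd_borel_P bdd_borel_power2 bdd_borel_g)+
  have eq: "(\<integral>y. cond_var (g n) y \<partial>\<mu>) / h n ^ (3 * DIM('a))
      = (\<integral>w. Ktens ?K2 w * mu_tri mu p (xx - h n *\<^sub>R w) \<partial>lborel) - (\<integral>y. (P (g n) y)\<^sup>2 \<partial>\<mu>) / h n ^ (3 * DIM('a))" for n
  proof -
    have "(\<integral>y. cond_var (g n) y \<partial>\<mu>) = (\<integral>y. P (\<lambda>z. (g n z)\<^sup>2) y \<partial>\<mu>) - (\<integral>y. (P (g n) y)\<^sup>2 \<partial>\<mu>)"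
      unfolding cond_var_def by (intro Bochner_Integration.integral_diff integrable_mu b1 b2)
    also have "(\<integral>y. P (\<lambda>z. (g n z)\<^sup>2) y \<partial>\<mu>) = h n ^ (3 * DIM('a)) * (\<integral>w. Ktens ?K2 w * mu_tri mu p (xx - h n *\<^sub>R w) \<partial>lborel)"
      unfolding g_power2 by (rule integral_mu_P_Ktens[OF K2 h_pos])
    finally show ?thesis by (simp add: diff_divide_distrib)
  qed
  have lim1: "(\<lambda>n. \<integral>w. Ktens ?K2 w * mu_tri mu p (xx - h n *\<^sub>R w) \<partial>lborel) \<longlonglongrightarrow> (\<integral>w. Ktens ?K2 w \<partial>lborel) * mu_tri mu p xx"
    by (rule approx_identity[OF mu_tri_measurable mu_tri_bounds(2) holder_smooth_isCont[OF smooth(1) s mu_tri_bounds(2)] Ktens_integral(1)[OF K0_power2_integrable] h_tendsto])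
  have le: "norm ((\<integral>y. (P (g n) y)\<^sup>2 \<partial>\<mu>) / h n ^ (3 * DIM('a))) \<le> (C * \<kappa>)\<^sup>2 * h n ^ DIM('a)" for n
  proof -
    have "\<bar>\<integral>y. (P (g n) y)\<^sup>2 \<partial>\<mu>\<bar> \<le> (C * \<kappa> * h n ^ (2 * DIM('a)))\<^sup>2"
    proof (rule integral_mu_abs_le[OF b2])
      fix y
      have "\<bar>P (g n) y\<bar> \<le> C * h n ^ (2 * DIM('a)) * \<kappa>"
        by (rule order_trans[OF C(2)]) (intro mult_left_mono \<kappa>(2), simp add: C(1))
      then have "\<bar>P (g n) y\<bar> \<le> C * \<kappa> * h n ^ (2 * DIM('a))" by (simp only: mult_ac)
      from power_mono[OF this abs_ge_zero, of 2]
      show "\<bar>(P (g n) y)\<^sup>2\<bar> \<le> (C * \<kappa> * h n ^ (2 * DIM('a)))\<^sup>2" by simp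
    qed
    also have "\<dots> = (C * \<kappa>)\<^sup>2 * h n ^ DIM('a) * h n ^ (3 * DIM('a))"
    proof -
      have "(h n ^ (2 * DIM('a)))\<^sup>2 = h n ^ DIM('a) * h n ^ (3 * DIM('a))"
        by (simp add: power_mult[symmetric] power_add[symmetric])
      then show ?thesis by (simp only: power_mult_distrib mult.assoc)
    qed
    finally show ?thesis by (simp add: divide_le_eq)
  qed
  have "(\<lambda>n. (C * \<kappa>)\<^sup>2 * h n ^ DIM('a)) \<longlonglongrightarrow> (C * \<kappa>)\<^sup>2 * 0 ^ DIM('a)"
    by (intro tendsto_intros h_tendsto)
  moreover have "(C * \<kappa>)\<^sup>2 * 0 ^ DIM('a) = 0" by simp
  ultimately have lim0: "(\<lambda>n. (C * \<kappa>)\<^sup>2 * h n ^ DIM('a)) \<longlonglongrightarrow> 0" by (simp only:)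
  have lim2: "(\<lambda>n. (\<integral>y. (P (g n) y)\<^sup>2 \<partial>\<mu>) / h n ^ (3 * DIM('a))) \<longlonglongrightarrow> 0"
    by (rule Lim_null_comparison[OF always_eventually[OF allI[OF le]] lim0])
  show ?thesis
    using tendsto_diff[OF lim1 lim2] unfolding eq \<sigma>2_def Ktens_integral(2)[OF K0_power2_integrable] by simp
qed

lemma \<sigma>2_nonneg: "0 \<le> \<sigma>2"
  unfolding \<sigma>2_def by (intro mult_nonneg_nonneg zero_le_power mu_tri_bounds(1)) simp

lemma target_nonneg: "0 \<le> target n k"
  using N_bounds(3)[of n] \<sigma>2_nonneg by (simp add: target_def)

lemma sum_target: "(\<Sum>k<Suc n. target n k) = \<sigma>2"
proof -
  have "(\<Sum>k<Suc n. target n k) = (\<Sum>k\<in>I n. 2 ^ k / N n * \<sigma>2)"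
    unfolding target_def by (rule sum_I)
  also have "\<dots> = N n / N n * \<sigma>2" by (simp only: sum_distrib_right[symmetric] sum_divide_distrib[symmetric] N_def)
  finally show ?thesis using N_bounds(3)[of n] by simp
qed

lemma integrable_S_cond_var: "bdd_borel g' \<Longrightarrow> integrable M (S k (cond_var g'))"
  by (intro integrable_S bdd_borel_cond_var)

text \<open>Two errors: the fluctuation of the conditional variances about their mean under
  \<open>\<mu>\<close>, negligible even with a factor \<open>1 / sqrt (a n)\<close> to spare, and
  the error of that mean, averaged with shares that sum to 1.\<close>

lemma var_error_tendsto: "var_error \<longlonglongrightarrow> 0"
proof -
  obtain C where C: "\<And>n y. \<bar>cond_var (g n) y\<bar> \<le> C * h n ^ (2 * DIM('a)) * \<bar>K0 ((1 / h n) *\<^sub>R (x - y))\<bar>"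
    by (rule cond_var_g_le) blast
  define m where "m n = (\<integral>y. cond_var (g n) y \<partial>\<mu>)" for n
  define D where "D n k = expectation (\<lambda>\<omega>. \<bar>S k (\<lambda>y. cond_var (g n) y - m n) \<omega>\<bar>)" for n k
  have lim1: "(\<lambda>n. (\<Sum>k\<in>I n. D n k) / sqrt (a n)) \<longlonglongrightarrow> 0"
    unfolding D_def m_def
    by (rule localized_sums_vanish[OF bdd_borel_measurable[OF bdd_borel_cond_var[OF bdd_borel_g]] C])
  have lim2: "(\<lambda>n. \<bar>m n / h n ^ (3 * DIM('a)) - \<sigma>2\<bar>) \<longlonglongrightarrow> 0"
    using tendsto_rabs[OF tendsto_diff[OF mean_cond_var_tendsto tendsto_const[of \<sigma>2]]] by (simp add: m_def)
  have term_le: "expectation (\<lambda>\<omega>. \<bar>S k (cond_var (\<lambda>z. weight n k * g n z)) \<omega> - target n k\<bar>)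
    \<le> (if k \<in> I n then D n k / a n + 2 ^ k / N n * \<bar>m n / h n ^ (3 * DIM('a)) - \<sigma>2\<bar> else 0)" for n k
  proof (cases "k \<in> I n")
    case False
    then show ?thesis unfolding cond_var_cmult by (simp add: weight_def target_def gen_sum_def)
  next
    case True
    let ?e = "m n / h n ^ (3 * DIM('a)) - \<sigma>2"
    have w: "(weight n k)\<^sup>2 = 1 / a n" using True a_pos[of n] by (simp add: weight_def power_divide less_imp_le del: a_pos)
    have iD: "integrable M (S k (\<lambda>y. cond_var (g n) y - m n))"
      by (intro integrable_S bdd_borel_diff bdd_borel_cond_var bdd_borel_g) simp
    \<comment> \<open>Since \<open>a n = N n * h n ^ (3 * DIM('a))\<close>, the mean part
      \<open>2 ^ k * m n / a n\<close> is the share \<open>2 ^ k / N n\<close> of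
      \<open>m n / h n ^ (3 * DIM('a))\<close>.\<close>
    have eq: "S k (cond_var (\<lambda>z. weight n k * g n z)) \<omega> - target n k
       = S k (\<lambda>y. cond_var (g n) y - m n) \<omega> / a n + 2 ^ k / N n * ?e" for \<omega>
      unfolding cond_var_cmult S_cmult w S_diff_const using True
      by (simp add: target_def diff_divide_distrib right_diff_distrib a_def)
    have "expectation (\<lambda>\<omega>. \<bar>S k (cond_var (\<lambda>z. weight n k * g n z)) \<omega> - target n k\<bar>)
       \<le> expectation (\<lambda>\<omega>. \<bar>S k (\<lambda>y. cond_var (g n) y - m n) \<omega>\<bar> / a n + 2 ^ k / N n * \<bar>?e\<bar>)"
    proof (rule integral_mono)
      show "integrable M (\<lambda>\<omega>. \<bar>S k (cond_var (\<lambda>z. weight n k * g n z)) \<omega> - target n k\<bar>)"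
        unfolding eq using iD by auto
      show "integrable M (\<lambda>\<omega>. \<bar>S k (\<lambda>y. cond_var (g n) y - m n) \<omega>\<bar> / a n + 2 ^ k / N n * \<bar>?e\<bar>)"
        using iD by auto
      show "\<bar>S k (cond_var (\<lambda>z. weight n k * g n z)) \<omega> - target n k\<bar>
         \<le> \<bar>S k (\<lambda>y. cond_var (g n) y - m n) \<omega>\<bar> / a n + 2 ^ k / N n * \<bar>?e\<bar>" for \<omega>
        unfolding eq using N_bounds(3)[of n] a_pos[of n]
        by (intro order_trans[OF abs_triangle_ineq] add_mono) (auto simp: abs_mult)
    qed
    also have "\<dots> = D n k / a n + 2 ^ k / N n * \<bar>?e\<bar>"
      using iD by (simp add: D_def prob_space)
    finally show ?thesis using True by simp
  qed
  have bound: "norm (var_error n) \<le> (\<Sum>k\<in>I n. D n k) / sqrt (a n) * (1 / sqrt (a n)) + \<bar>m n / h n ^ (3 * DIM('a)) - \<sigma>2\<bar>" for n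
  proof -
    have "norm (var_error n) = var_error n" unfolding var_error_def by (simp add: sum_nonneg del: sum.lessThan_Suc)
    also have "\<dots> \<le> (\<Sum>k<Suc n. if k \<in> I n then D n k / a n + 2 ^ k / N n * \<bar>m n / h n ^ (3 * DIM('a)) - \<sigma>2\<bar> else 0)"
      unfolding var_error_def by (intro sum_mono term_le)
    also have "\<dots> = (\<Sum>k\<in>I n. D n k / a n + 2 ^ k / N n * \<bar>m n / h n ^ (3 * DIM('a)) - \<sigma>2\<bar>)"
      by (rule sum_I)
    also have "\<dots> = (\<Sum>k\<in>I n. D n k) / a n + N n / N n * \<bar>m n / h n ^ (3 * DIM('a)) - \<sigma>2\<bar>"
      by (simp only: sum.distrib sum_distrib_right[symmetric] sum_divide_distrib[symmetric] N_def)
    also have "\<dots> = (\<Sum>k\<in>I n. D n k) / sqrt (a n) * (1 / sqrt (a n)) + \<bar>m n / h n ^ (3 * DIM('a)) - \<sigma>2\<bar>"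
      using N_bounds(3)[of n] less_imp_le[OF a_pos[of n]] by simp
    finally show ?thesis .
  qed
  have "(\<lambda>n. (\<Sum>k\<in>I n. D n k) / sqrt (a n) * (1 / sqrt (a n)) + \<bar>m n / h n ^ (3 * DIM('a)) - \<sigma>2\<bar>) \<longlonglongrightarrow> 0 * 0 + 0"
    by (intro tendsto_add tendsto_mult lim1 lim2 inverse_sqrt_a_tendsto)
  then have lim: "(\<lambda>n. (\<Sum>k\<in>I n. D n k) / sqrt (a n) * (1 / sqrt (a n)) + \<bar>m n / h n ^ (3 * DIM('a)) - \<sigma>2\<bar>) \<longlonglongrightarrow> 0"
    by (simp only: mult_zero_left add_0_right)
  show ?thesis by (rule Lim_null_comparison[OF always_eventually[OF allI[OF bound]] lim])
qed

lemma sum_cond_var_le: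
  "(\<Sum>k<Suc n. expectation (S k (cond_var (\<lambda>z. weight n k * g n z)))) \<le> \<sigma>2 + var_error n"
proof -
  have "expectation (S k (cond_var (\<lambda>z. weight n k * g n z)))
     \<le> target n k + expectation (\<lambda>\<omega>. \<bar>S k (cond_var (\<lambda>z. weight n k * g n z)) \<omega> - target n k\<bar>)" for k
  proof -
    note i = integrable_S_cond_var[OF bdd_borel_wg[of n k], of k]
    have "expectation (S k (cond_var (\<lambda>z. weight n k * g n z))) - target n k
       = expectation (\<lambda>\<omega>. S k (cond_var (\<lambda>z. weight n k * g n z)) \<omega> - target n k)"
      using i by (simp add: prob_space)
    also have "\<dots> \<le> expectation (\<lambda>\<omega>. \<bar>S k (cond_var (\<lambda>z. weight n k * g n z)) \<omega> - target n k\<bar>)"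
      using i by (intro integral_mono) auto
    finally show ?thesis by simp
  qed
  then have "(\<Sum>k<Suc n. expectation (S k (cond_var (\<lambda>z. weight n k * g n z))))
     \<le> (\<Sum>k<Suc n. target n k + expectation (\<lambda>\<omega>. \<bar>S k (cond_var (\<lambda>z. weight n k * g n z)) \<omega> - target n k\<bar>))"
    by (intro sum_mono)
  also have "\<dots> = \<sigma>2 + var_error n" unfolding sum.distrib sum_target var_error_def ..
  finally show ?thesis .
qed

text \<open>The summands are uniformly bounded by a multiple of \<open>e n\<close>, which tends to
  0. This does the work of a Lindeberg condition: the factor \<open>c n\<close> in front of the
  bounded total variance vanishes.\<close>

lemma char_mart_tendsto: "(\<lambda>n. CLINT \<omega>|M. iexp (t * mart n \<omega>)) \<longlonglongrightarrow> exp (- (t\<^sup>2 / 2 * \<sigma>2))"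
proof -
  obtain \<kappa> where \<kappa>: "0 < \<kappa>" "\<And>z. \<bar>Ktens K0 z\<bar> \<le> \<kappa>" by (rule bdd_borelE[OF bdd_borel_Ktens[OF bdd_borel_K0]]) blast
  define e where "e n = \<kappa> * (1 / sqrt (a n))" for n
  have e0: "0 \<le> e n" for n using \<kappa>(1) a_pos[of n] by (simp add: e_def less_imp_le del: a_pos)
  have wg: "\<bar>weight n k * g n z\<bar> \<le> e n" for n k z
  proof (cases "k \<in> I n")
    case True
    have "1 / sqrt (a n) * \<bar>g n z\<bar> \<le> 1 / sqrt (a n) * \<kappa>"
      using \<kappa>(2) a_pos[of n] by (intro mult_left_mono) (auto simp: g_def less_imp_le simp del: a_pos)
    then show ?thesis using True a_pos[of n] by (simp add: weight_def e_def abs_mult less_imp_le mult.commute del: a_pos)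
  qed (simp add: weight_def e0)
  define c where "c n = \<bar>t\<bar> ^ 3 * e n / 3 + t ^ 4 * (e n)\<^sup>2 / 2" for n
  have c0: "0 \<le> c n" for n unfolding c_def using e0[of n] by simp
  have e_lim: "e \<longlonglongrightarrow> 0"
    using tendsto_mult_left[OF inverse_sqrt_a_tendsto, of \<kappa>] by (simp add: e_def[abs_def])
  have "c \<longlonglongrightarrow> \<bar>t\<bar> ^ 3 * 0 / 3 + t ^ 4 * 0\<^sup>2 / 2"
    unfolding c_def[abs_def] by (intro tendsto_intros e_lim) auto
  then have c_lim: "c \<longlonglongrightarrow> 0" by simp
  have bound: "norm ((CLINT \<omega>|M. iexp (t * mart n \<omega>)) - exp (- (t\<^sup>2 / 2 * \<sigma>2))) \<le> t\<^sup>2 / 2 * var_error n + c n * (\<sigma>2 + var_error n)" for n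
  proof -
    have "norm ((CLINT \<omega>|M. iexp (t * mart n \<omega>)) - exp (- (t\<^sup>2 / 2 * (\<Sum>k<Suc n. target n k))))
      \<le> (\<Sum>k<Suc n. t\<^sup>2 / 2 * expectation (\<lambda>\<omega>. \<bar>S k (cond_var (\<lambda>z. weight n k * g n z)) \<omega> - target n k\<bar>)
        + (\<bar>t\<bar> ^ 3 * e n / 3 + t ^ 4 * (e n)\<^sup>2 / 2) * expectation (S k (cond_var (\<lambda>z. weight n k * g n z))))"
      unfolding mart_def by (rule mart_clt_bound[OF bdd_borel_wg wg target_nonneg])
    also have "\<dots> = t\<^sup>2 / 2 * var_error n + c n * (\<Sum>k<Suc n. expectation (S k (cond_var (\<lambda>z. weight n k * g n z))))"
      unfolding sum.distrib sum_distrib_left[symmetric] var_error_def c_def ..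
    also have "\<dots> \<le> t\<^sup>2 / 2 * var_error n + c n * (\<sigma>2 + var_error n)"
      by (intro add_left_mono mult_left_mono sum_cond_var_le c0)
    finally show ?thesis unfolding sum_target .
  qed
  have "(\<lambda>n. t\<^sup>2 / 2 * var_error n + c n * (\<sigma>2 + var_error n)) \<longlonglongrightarrow> t\<^sup>2 / 2 * 0 + 0 * (\<sigma>2 + 0)"
    by (intro tendsto_intros var_error_tendsto c_lim)
  then have lim: "(\<lambda>n. t\<^sup>2 / 2 * var_error n + c n * (\<sigma>2 + var_error n)) \<longlonglongrightarrow> 0" by simp
  have "(\<lambda>n. (CLINT \<omega>|M. iexp (t * mart n \<omega>)) - exp (- (t\<^sup>2 / 2 * \<sigma>2))) \<longlonglongrightarrow> 0"
    by (rule Lim_null_comparison[OF always_eventually[OF allI[OF bound]] lim])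
  then show ?thesis by (simp only: LIM_zero_iff)
qed

lemma mart_measurable [measurable]: "mart n \<in> borel_measurable M"
  unfolding mart_def[abs_def] by (intro borel_measurable_sum mart_incr_measurable bdd_borel_wg)

lemma mart_integrable: "integrable M (mart n)" "integrable M (\<lambda>\<omega>. (mart n \<omega>)\<^sup>2)"
proof -
  have "\<forall>k. \<exists>C. \<forall>\<omega>. \<bar>mart_incr k (\<lambda>z. weight n k * g n z) \<omega>\<bar> \<le> C"
  proof
    fix k
    show "\<exists>C. \<forall>\<omega>. \<bar>mart_incr k (\<lambda>z. weight n k * g n z) \<omega>\<bar> \<le> C"
      by (rule mart_incr_bounded[OF bdd_borel_wg[of n k], where k = k]) blast
  qed
  from choice[OF this] obtain C where C: "\<forall>k \<omega>. \<bar>mart_incr k (\<lambda>z. weight n k * g n z) \<omega>\<bar> \<le> C k" by (rule exE)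
  have b: "\<bar>mart n \<omega>\<bar> \<le> (\<Sum>k<Suc n. C k)" for \<omega>
    unfolding mart_def by (rule order_trans[OF sum_abs sum_mono]) (use C in blast)
  show "integrable M (mart n)" using b by (intro integrable_const_bound[where B = "\<Sum>k<Suc n. C k"]) auto
  show "integrable M (\<lambda>\<omega>. (mart n \<omega>)\<^sup>2)"
    using power_mono[OF b abs_ge_zero, where n = 2]
    by (intro integrable_const_bound[where B = "(\<Sum>k<Suc n. C k)\<^sup>2"]) simp_all
qed

lemma mart_L1_le: "expectation (\<lambda>\<omega>. \<bar>mart n \<omega>\<bar>) \<le> 1 + (\<sigma>2 + var_error n)"
proof -
  have "expectation (\<lambda>\<omega>. \<bar>mart n \<omega>\<bar>) \<le> expectation (\<lambda>\<omega>. 1 + (mart n \<omega>)\<^sup>2)"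
  proof (rule integral_mono)
    fix \<omega>
    have "0 \<le> (\<bar>mart n \<omega>\<bar> - 1)\<^sup>2" by simp
    then have "2 * \<bar>mart n \<omega>\<bar> \<le> 1 + (mart n \<omega>)\<^sup>2" by (simp add: power2_diff)
    then show "\<bar>mart n \<omega>\<bar> \<le> 1 + (mart n \<omega>)\<^sup>2" using abs_ge_zero[of "mart n \<omega>"] by linarith
  qed (use mart_integrable in auto)
  also have "\<dots> = 1 + expectation (\<lambda>\<omega>. (mart n \<omega>)\<^sup>2)" using mart_integrable(2) by (simp add: prob_space)
  also have "expectation (\<lambda>\<omega>. (mart n \<omega>)\<^sup>2) \<le> \<sigma>2 + var_error n"
    unfolding mart_def mart_second_moment[OF bdd_borel_wg] by (rule sum_cond_var_le)
  finally show ?thesis by simp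
qed

section \<open>Decomposition of the estimator and negligibility of its drift\<close>

definition vertices :: "nat \<Rightarrow> bool list set" where "vertices n = (\<Union>k\<in>I n. Gen k)"

lemma sum_vertices: "(\<Sum>u\<in>vertices n. f u) = (\<Sum>k\<in>I n. \<Sum>u\<in>Gen k. f u)" for f :: "bool list \<Rightarrow> real"
  unfolding vertices_def by (rule sum.UNION_disjoint) (auto simp: Gen_def[symmetric], auto simp: Gen_def)

lemma card_vertices: "real (card (vertices n)) = N n"
  using sum_vertices[of "\<lambda>_. 1" n] by (simp add: N_def)

lemma deviation_le:
  assumes f: "bdd_borel f"
  shows "expectation (\<lambda>\<omega>. \<bar>(\<Sum>k\<in>I n. S k f \<omega>) - N n * m\<bar>) \<le> (\<Sum>k\<in>I n. expectation (\<lambda>\<omega>. \<bar>S k (\<lambda>y. f y - m) \<omega>\<bar>))"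
proof -
  have i: "integrable M (S k (\<lambda>y. f y - m))" for k by (intro integrable_S bdd_borel_diff f) simp
  have eq: "(\<Sum>k\<in>I n. S k f \<omega>) - N n * m = (\<Sum>k\<in>I n. S k (\<lambda>y. f y - m) \<omega>)" for \<omega>
    by (simp add: S_diff_const sum_subtractf N_def sum_distrib_right)
  have "expectation (\<lambda>\<omega>. \<bar>(\<Sum>k\<in>I n. S k f \<omega>) - N n * m\<bar>) \<le> expectation (\<lambda>\<omega>. \<Sum>k\<in>I n. \<bar>S k (\<lambda>y. f y - m) \<omega>\<bar>)"
    unfolding eq using i by (intro integral_mono sum_abs) auto
  also have "\<dots> = (\<Sum>k\<in>I n. expectation (\<lambda>\<omega>. \<bar>S k (\<lambda>y. f y - m) \<omega>\<bar>))"
    using i by (intro Bochner_Integration.integral_sum) auto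
  finally show ?thesis .
qed

definition muhat :: "nat \<Rightarrow> 'w \<Rightarrow> real" where
  "muhat n \<omega> = mu_hat K0 X (vertices n) (bandwidth \<gamma> n) x \<omega>"

definition numerator :: "nat \<Rightarrow> 'w \<Rightarrow> real" where
  "numerator n \<omega> = sqrt (a n) * (mu_tri_hat K0 X (vertices n) (bandwidth \<gamma> n) x x0 x1 \<omega> - p x x0 x1 * muhat n \<omega>)"

text \<open>Conditional mean, given the position \<open>y\<close> of the vertex, of one unnormalised
  summand of the numerator.\<close>

definition drift :: "nat \<Rightarrow> 'a \<Rightarrow> real" where
  "drift n y = P (g n) y - p x x0 x1 * loc_kernel n y"

lemma bdd_borel_drift: "bdd_borel (drift n)"
  unfolding drift_def[abs_def] by (intro bdd_borel_diff bdd_borel_cmult bdd_borel_P bdd_borel_g bdd_borel_loc_kernel)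

lemma muhat_eq: "muhat n \<omega> = (\<Sum>k\<in>I n. S k (loc_kernel n) \<omega>) / a n"
proof -
  have "h n ^ (3 * DIM('a)) = h n ^ (2 * DIM('a)) * h n ^ DIM('a)" by (simp add: power_add[symmetric])
  then show ?thesis
    unfolding muhat_def mu_hat_def card_vertices sum_vertices h_def[symmetric] a_def loc_kernel_def gen_sum_def
    by (simp add: sum_distrib_left[symmetric])
qed

lemma numerator_eq: "numerator n \<omega> = mart n \<omega> + (\<Sum>k\<in>I n. S k (drift n) \<omega>) / sqrt (a n)"
proof -
  have a: "sqrt (a n) * (r / a n) = r / sqrt (a n)" for r
    using a_pos[of n] real_div_sqrt[of "a n"] by (simp add: field_simps less_imp_le del: a_pos)
  have K: "Ktens K0 ((1 / h n) *\<^sub>R (x - X u \<omega>), (1 / h n) *\<^sub>R (x0 - X (u @ [False]) \<omega>), (1 / h n) *\<^sub>R (x1 - X (u @ [True]) \<omega>))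
     = g n (offspring X u \<omega>)" for u
    by (simp add: g_def offspring_def)
  have split: "(\<Sum>u\<in>Gen k. g n (offspring X u \<omega>)) = mart_incr k (g n) \<omega> + S k (P (g n)) \<omega>" for k
    by (simp add: mart_incr_def centered_def gen_sum_def sum_subtractf offspring_def)
  have tri: "mu_tri_hat K0 X (vertices n) (bandwidth \<gamma> n) x x0 x1 \<omega>
      = ((\<Sum>k\<in>I n. mart_incr k (g n) \<omega>) + (\<Sum>k\<in>I n. S k (P (g n)) \<omega>)) / a n"
    unfolding mu_tri_hat_def card_vertices sum_vertices h_def[symmetric] K split sum.distrib a_def ..
  have dr: "S k (drift n) \<omega> = S k (P (g n)) \<omega> - p x x0 x1 * S k (loc_kernel n) \<omega>" for k
    by (simp add: drift_def gen_sum_def sum_subtractf sum_distrib_left)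
  have "mart n \<omega> = (\<Sum>k<Suc n. if k \<in> I n then mart_incr k (g n) \<omega> / sqrt (a n) else 0)"
    unfolding mart_def mart_incr_cmult by (intro sum.cong refl) (simp add: weight_def)
  also have "\<dots> = (\<Sum>k\<in>I n. mart_incr k (g n) \<omega>) / sqrt (a n)" unfolding sum_I sum_divide_distrib ..
  finally have mart: "mart n \<omega> = (\<Sum>k\<in>I n. mart_incr k (g n) \<omega>) / sqrt (a n)" .
  have "numerator n \<omega> = sqrt (a n) * (((\<Sum>k\<in>I n. mart_incr k (g n) \<omega>) + (\<Sum>k\<in>I n. S k (drift n) \<omega>)) / a n)"
    unfolding numerator_def tri muhat_eq dr sum_subtractf sum_distrib_left[symmetric]
    by (simp add: diff_divide_distrib add_divide_distrib)
  then show ?thesis unfolding a mart by (simp add: add_divide_distrib)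
qed

lemma muhat_integrable: "integrable M (muhat n)"
  unfolding muhat_eq[abs_def] using integrable_S[OF bdd_borel_loc_kernel] by auto

lemma numerator_integrable: "integrable M (numerator n)"
  unfolding numerator_eq[abs_def] using integrable_S[OF bdd_borel_drift] mart_integrable(1) by auto

lemma integral_loc_kernel: "(\<integral>y. loc_kernel n y \<partial>\<mu>) = h n ^ (3 * DIM('a)) * (\<integral>w. K0 w * mu (x - h n *\<^sub>R w) \<partial>lborel)"
proof -
  have "h n ^ (3 * DIM('a)) = h n ^ (2 * DIM('a)) * h n ^ DIM('a)" by (simp add: power_add[symmetric])
  then show ?thesis unfolding loc_kernel_def[abs_def] by (simp add: integral_mu_rescale)
qed

text \<open>The fluctuations vanish as for any localized function, with a factor
  \<open>1 / sqrt (a n)\<close> to spare. For the bias a limit without rate suffices, so continuity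
  of \<open>mu\<close> at \<open>x\<close> is enough.\<close>

lemma muhat_tendsto: "(\<lambda>n. expectation (\<lambda>\<omega>. \<bar>muhat n \<omega> - mu x\<bar>)) \<longlonglongrightarrow> 0"
proof -
  define m where "m n = (\<integral>y. loc_kernel n y \<partial>\<mu>)" for n
  define D where "D n = (\<Sum>k\<in>I n. expectation (\<lambda>\<omega>. \<bar>S k (\<lambda>y. loc_kernel n y - m n) \<omega>\<bar>))" for n
  have "\<bar>loc_kernel n y\<bar> \<le> 1 * h n ^ (2 * DIM('a)) * \<bar>K0 ((1 / h n) *\<^sub>R (x - y))\<bar>" for n y
    by (simp add: loc_kernel_def abs_mult)
  then have lim1: "(\<lambda>n. D n / sqrt (a n)) \<longlonglongrightarrow> 0"
    unfolding D_def m_def by (rule localized_sums_vanish[OF bdd_borel_measurable[OF bdd_borel_loc_kernel]])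
  have "(\<lambda>n. \<integral>w. K0 w * mu (x - h n *\<^sub>R w) \<partial>lborel) \<longlonglongrightarrow> (\<integral>w. K0 w \<partial>lborel) * mu x"
    by (rule approx_identity[OF mu_meas mu_bounded holder_smooth_isCont[OF smooth(2) s mu_bounded] K0_integrable h_tendsto])
  then have "(\<lambda>n. m n / h n ^ (3 * DIM('a))) \<longlonglongrightarrow> mu x"
    by (simp add: m_def integral_loc_kernel K0_integral)
  from tendsto_rabs[OF tendsto_diff[OF this tendsto_const[of "mu x"]]]
  have lim2: "(\<lambda>n. \<bar>m n / h n ^ (3 * DIM('a)) - mu x\<bar>) \<longlonglongrightarrow> 0" by simp
  have bound: "norm (expectation (\<lambda>\<omega>. \<bar>muhat n \<omega> - mu x\<bar>)) \<le> D n / sqrt (a n) * (1 / sqrt (a n)) + \<bar>m n / h n ^ (3 * DIM('a)) - mu x\<bar>" for n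
  proof -
    have i: "integrable M (\<lambda>\<omega>. \<Sum>k\<in>I n. S k (loc_kernel n) \<omega>)" using integrable_S[OF bdd_borel_loc_kernel] by auto
    have "muhat n \<omega> - mu x = ((\<Sum>k\<in>I n. S k (loc_kernel n) \<omega>) - N n * m n) / a n + (m n / h n ^ (3 * DIM('a)) - mu x)" for \<omega>
      unfolding muhat_eq using N_bounds(3)[of n] by (simp add: diff_divide_distrib a_def)
    then have le: "\<bar>muhat n \<omega> - mu x\<bar> \<le> \<bar>(\<Sum>k\<in>I n. S k (loc_kernel n) \<omega>) - N n * m n\<bar> / a n + \<bar>m n / h n ^ (3 * DIM('a)) - mu x\<bar>" for \<omega>
      using abs_triangle_ineq[of "((\<Sum>k\<in>I n. S k (loc_kernel n) \<omega>) - N n * m n) / a n" "m n / h n ^ (3 * DIM('a)) - mu x"] a_pos[of n]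
      by (simp add: abs_divide)
    have "norm (expectation (\<lambda>\<omega>. \<bar>muhat n \<omega> - mu x\<bar>)) = expectation (\<lambda>\<omega>. \<bar>muhat n \<omega> - mu x\<bar>)" by simp
    also have "\<dots> \<le> expectation (\<lambda>\<omega>. \<bar>(\<Sum>k\<in>I n. S k (loc_kernel n) \<omega>) - N n * m n\<bar> / a n + \<bar>m n / h n ^ (3 * DIM('a)) - mu x\<bar>)"
      using muhat_integrable[of n] i by (intro integral_mono le) auto
    also have "\<dots> = expectation (\<lambda>\<omega>. \<bar>(\<Sum>k\<in>I n. S k (loc_kernel n) \<omega>) - N n * m n\<bar>) / a n + \<bar>m n / h n ^ (3 * DIM('a)) - mu x\<bar>"
      using i by (simp add: prob_space)
    also have "\<dots> \<le> D n / a n + \<bar>m n / h n ^ (3 * DIM('a)) - mu x\<bar>"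
      unfolding D_def using less_imp_le[OF a_pos[of n]] by (intro add_right_mono divide_right_mono deviation_le bdd_borel_loc_kernel)
    also have "D n / a n = D n / sqrt (a n) * (1 / sqrt (a n))" using less_imp_le[OF a_pos[of n]] by simp
    finally show ?thesis .
  qed
  have "(\<lambda>n. D n / sqrt (a n) * (1 / sqrt (a n)) + \<bar>m n / h n ^ (3 * DIM('a)) - mu x\<bar>) \<longlonglongrightarrow> 0 * 0 + 0"
    by (intro tendsto_add tendsto_mult lim1 lim2 inverse_sqrt_a_tendsto)
  then have lim: "(\<lambda>n. D n / sqrt (a n) * (1 / sqrt (a n)) + \<bar>m n / h n ^ (3 * DIM('a)) - mu x\<bar>) \<longlonglongrightarrow> 0"
    by (simp only: mult_zero_left add_0_right)
  show ?thesis by (rule Lim_null_comparison[OF always_eventually[OF allI[OF bound]] lim])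
qed

text \<open>Both means have leading term \<open>h^3d * mu x * p x x0 x1\<close>, and these cancel.
  What is left is the kernel bias of \<open>mu_tri\<close> at \<open>xx\<close> and that of
  \<open>mu\<close> at \<open>x\<close>, each of relative order \<open>h powr s\<close>.\<close>

lemma mean_drift_le:
  obtains C where "0 \<le> C" "\<And>n. \<bar>\<integral>y. drift n y \<partial>\<mu>\<bar> \<le> h n ^ (3 * DIM('a)) * (C * h n powr s)"
proof -
  define C1 where "C1 = \<bar>L\<bar> * (\<Sum>b\<in>Basis. \<integral>w. \<bar>w \<bullet> b\<bar> powr s * \<bar>Ktens K0 w\<bar> \<partial>lborel)"
  define C2 where "C2 = \<bar>L\<bar> * (\<Sum>b\<in>Basis. \<integral>w. \<bar>w \<bullet> b\<bar> powr s * \<bar>K0 w\<bar> \<partial>lborel)"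
  have C12: "0 \<le> C1" "0 \<le> C2" unfolding C1_def C2_def by (auto intro!: mult_nonneg_nonneg sum_nonneg)
  let ?p = "p x x0 x1"
  define A1 where "A1 n = (\<integral>w. Ktens K0 w * mu_tri mu p (xx - h n *\<^sub>R w) \<partial>lborel)" for n
  define A2 where "A2 n = (\<integral>w. K0 w * mu (x - h n *\<^sub>R w) \<partial>lborel)" for n
  have s0: "0 \<le> s" using s by simp
  have b1: "\<bar>A1 n - mu x * ?p\<bar> \<le> h n powr s * C1" for n
    using holder_bias[OF smooth(1) s mu_tri_measurable mu_tri_bounds(2) Ktens_integral(1)[OF K0_integrable]
        kernel_moments_Ktens[OF K0_moments] coordinate_moment_integrable_Ktens[OF K0_measurable K0_integrable K0_tail s0] h_pos[of n], of xx]
    by (simp add: A1_def C1_def Ktens_integral(2)[OF K0_integrable] K0_integral mu_tri_def)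
  have b2: "\<bar>A2 n - mu x\<bar> \<le> h n powr s * C2" for n
    using holder_bias[OF smooth(2) s mu_meas mu_bounded K0_integrable K0_moments
        coordinate_moment_integrable[OF K0_measurable K0_tail s0] h_pos[of n], of x]
    by (simp add: A2_def C2_def K0_integral)
  show ?thesis
  proof (rule that[of "C1 + ?p * C2"])
    show "0 \<le> C1 + ?p * C2" using C12 p_nonneg by simp
    fix n
    have "(\<integral>y. drift n y \<partial>\<mu>) = (\<integral>y. P (g n) y \<partial>\<mu>) - ?p * (\<integral>y. loc_kernel n y \<partial>\<mu>)"
      unfolding drift_def by (subst Bochner_Integration.integral_diff)
        (auto intro!: integrable_mu bdd_borel_P bdd_borel_g bdd_borel_cmult bdd_borel_loc_kernel)
    also have "\<dots> = h n ^ (3 * DIM('a)) * (A1 n - ?p * A2 n)"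
      unfolding integral_loc_kernel g_def[abs_def] integral_mu_P_Ktens[OF bdd_borel_K0 h_pos] A1_def A2_def
      by (simp add: right_diff_distrib)
    finally have eq: "\<bar>\<integral>y. drift n y \<partial>\<mu>\<bar> = h n ^ (3 * DIM('a)) * \<bar>A1 n - ?p * A2 n\<bar>" by (simp add: abs_mult)
    have "\<bar>A1 n - ?p * A2 n\<bar> = \<bar>(A1 n - mu x * ?p) - ?p * (A2 n - mu x)\<bar>" by (simp add: right_diff_distrib mult.commute)
    also have "\<dots> \<le> \<bar>A1 n - mu x * ?p\<bar> + ?p * \<bar>A2 n - mu x\<bar>"
      by (rule order_trans[OF abs_triangle_ineq4]) (simp add: abs_mult p_nonneg)
    also have "\<dots> \<le> h n powr s * C1 + ?p * (h n powr s * C2)"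
      by (intro add_mono mult_left_mono b1 b2 p_nonneg)
    also have "\<dots> = (C1 + ?p * C2) * h n powr s" by (simp add: algebra_simps)
    finally show "\<bar>\<integral>y. drift n y \<partial>\<mu>\<bar> \<le> h n ^ (3 * DIM('a)) * ((C1 + ?p * C2) * h n powr s)"
      unfolding eq by (intro mult_left_mono) auto
  qed
qed

text \<open>Centering splits the drift. Its fluctuations are localized sums; its mean contributes
  \<open>N n * m n / sqrt (a n)\<close>, of order \<open>sqrt (a n) * h n powr s\<close>, which is
  where undersmoothing is used.\<close>

lemma numerator_mart_tendsto: "(\<lambda>n. expectation (\<lambda>\<omega>. \<bar>numerator n \<omega> - mart n \<omega>\<bar>)) \<longlonglongrightarrow> 0"
proof -
  obtain C where C: "0 \<le> C" "\<And>n y. \<bar>P (g n) y\<bar> \<le> C * h n ^ (2 * DIM('a)) * \<bar>K0 ((1 / h n) *\<^sub>R (x - y))\<bar>"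
    by (rule P_g_le) blast
  obtain C' where C': "0 \<le> C'" "\<And>n. \<bar>\<integral>y. drift n y \<partial>\<mu>\<bar> \<le> h n ^ (3 * DIM('a)) * (C' * h n powr s)"
    by (rule mean_drift_le) blast
  define m where "m n = (\<integral>y. drift n y \<partial>\<mu>)" for n
  define D where "D n = (\<Sum>k\<in>I n. expectation (\<lambda>\<omega>. \<bar>S k (\<lambda>y. drift n y - m n) \<omega>\<bar>))" for n
  have "\<bar>drift n y\<bar> \<le> (C + p x x0 x1) * h n ^ (2 * DIM('a)) * \<bar>K0 ((1 / h n) *\<^sub>R (x - y))\<bar>" for n y
  proof -
    have "\<bar>drift n y\<bar> \<le> \<bar>P (g n) y\<bar> + \<bar>p x x0 x1 * loc_kernel n y\<bar>" unfolding drift_def by (rule abs_triangle_ineq4)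
    also have "\<bar>p x x0 x1 * loc_kernel n y\<bar> = p x x0 x1 * h n ^ (2 * DIM('a)) * \<bar>K0 ((1 / h n) *\<^sub>R (x - y))\<bar>"
      by (simp add: loc_kernel_def abs_mult p_nonneg)
    finally show ?thesis using C(2)[of n y] by (simp add: distrib_right)
  qed
  then have lim1: "(\<lambda>n. D n / sqrt (a n)) \<longlonglongrightarrow> 0"
    unfolding D_def m_def by (rule localized_sums_vanish[OF bdd_borel_measurable[OF bdd_borel_drift]])
  have bound: "norm (expectation (\<lambda>\<omega>. \<bar>numerator n \<omega> - mart n \<omega>\<bar>)) \<le> D n / sqrt (a n) + C' * (sqrt (a n) * h n powr s)" for n
  proof -
    have sa: "0 < sqrt (a n)" using a_pos[of n] by (simp del: a_pos)
    have i: "integrable M (\<lambda>\<omega>. \<Sum>k\<in>I n. S k (drift n) \<omega>)" using integrable_S[OF bdd_borel_drift] by auto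
    have le: "\<bar>numerator n \<omega> - mart n \<omega>\<bar> \<le> \<bar>(\<Sum>k\<in>I n. S k (drift n) \<omega>) - N n * m n\<bar> / sqrt (a n) + \<bar>N n * m n\<bar> / sqrt (a n)" for \<omega>
    proof -
      have "numerator n \<omega> - mart n \<omega> = ((\<Sum>k\<in>I n. S k (drift n) \<omega>) - N n * m n) / sqrt (a n) + N n * m n / sqrt (a n)"
        unfolding numerator_eq by (simp add: diff_divide_distrib)
      also have "\<bar>\<dots>\<bar> \<le> \<bar>((\<Sum>k\<in>I n. S k (drift n) \<omega>) - N n * m n) / sqrt (a n)\<bar> + \<bar>N n * m n / sqrt (a n)\<bar>"
        by (rule abs_triangle_ineq)
      finally show ?thesis unfolding abs_divide abs_of_pos[OF sa] .
    qed
    have "norm (expectation (\<lambda>\<omega>. \<bar>numerator n \<omega> - mart n \<omega>\<bar>)) = expectation (\<lambda>\<omega>. \<bar>numerator n \<omega> - mart n \<omega>\<bar>)" by simp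
    also have "\<dots> \<le> expectation (\<lambda>\<omega>. \<bar>(\<Sum>k\<in>I n. S k (drift n) \<omega>) - N n * m n\<bar> / sqrt (a n) + \<bar>N n * m n\<bar> / sqrt (a n))"
      using numerator_integrable[of n] mart_integrable(1)[of n] i by (intro integral_mono le) auto
    also have "\<dots> = expectation (\<lambda>\<omega>. \<bar>(\<Sum>k\<in>I n. S k (drift n) \<omega>) - N n * m n\<bar>) / sqrt (a n) + \<bar>N n * m n\<bar> / sqrt (a n)"
      using i by (simp add: prob_space)
    also have "\<dots> \<le> D n / sqrt (a n) + \<bar>N n * m n\<bar> / sqrt (a n)"
      unfolding D_def using less_imp_le[OF sa] by (intro add_right_mono divide_right_mono deviation_le bdd_borel_drift)
    also have "\<bar>N n * m n\<bar> / sqrt (a n) \<le> C' * (sqrt (a n) * h n powr s)"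
    proof -
      have "\<bar>N n * m n\<bar> = N n * \<bar>m n\<bar>" using N_bounds(3)[of n] by (simp add: abs_mult)
      also have "\<dots> \<le> N n * (h n ^ (3 * DIM('a)) * (C' * h n powr s))"
        unfolding m_def using N_bounds(3)[of n] by (intro mult_left_mono C'(2)) simp
      also have "\<dots> = a n * (C' * h n powr s)" by (simp add: a_def)
      finally have "\<bar>N n * m n\<bar> / sqrt (a n) \<le> a n * (C' * h n powr s) / sqrt (a n)"
        using less_imp_le[OF sa] by (rule divide_right_mono)
      also have "\<dots> = (a n / sqrt (a n)) * (C' * h n powr s)" by simp
      also have "a n / sqrt (a n) = sqrt (a n)" using less_imp_le[OF a_pos[of n]] by (rule real_div_sqrt)
      finally show ?thesis by (simp add: mult_ac)
    qed
    finally show ?thesis by simp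
  qed
  have "(\<lambda>n. D n / sqrt (a n) + C' * (sqrt (a n) * h n powr s)) \<longlonglongrightarrow> 0 + C' * 0"
    by (intro tendsto_add tendsto_mult_left lim1 bias_rate_tendsto)
  then have lim: "(\<lambda>n. D n / sqrt (a n) + C' * (sqrt (a n) * h n powr s)) \<longlonglongrightarrow> 0" by simp
  show ?thesis by (rule Lim_null_comparison[OF always_eventually[OF allI[OF bound]] lim])
qed

lemma numerator_L1_bounded: obtains B where "\<And>n. expectation (\<lambda>\<omega>. \<bar>numerator n \<omega>\<bar>) \<le> B"
proof -
  let ?r = "\<lambda>n. (1 + (\<sigma>2 + var_error n)) + expectation (\<lambda>\<omega>. \<bar>numerator n \<omega> - mart n \<omega>\<bar>)"
  have "?r \<longlonglongrightarrow> (1 + (\<sigma>2 + 0)) + 0"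
    by (intro tendsto_intros var_error_tendsto numerator_mart_tendsto)
  then have "Bseq ?r" by (intro convergent_imp_Bseq convergentI)
  then obtain B where B: "\<And>n. norm (?r n) \<le> B" unfolding Bseq_def by blast
  show ?thesis
  proof (rule that[of B])
    fix n
    have "expectation (\<lambda>\<omega>. \<bar>numerator n \<omega>\<bar>) \<le> expectation (\<lambda>\<omega>. \<bar>mart n \<omega>\<bar> + \<bar>numerator n \<omega> - mart n \<omega>\<bar>)"
      using numerator_integrable[of n] mart_integrable(1)[of n] by (intro integral_mono) auto
    also have "\<dots> = expectation (\<lambda>\<omega>. \<bar>mart n \<omega>\<bar>) + expectation (\<lambda>\<omega>. \<bar>numerator n \<omega> - mart n \<omega>\<bar>)"
      using numerator_integrable[of n] mart_integrable(1)[of n] by simp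
    also have "\<dots> \<le> ?r n" by (intro add_right_mono mart_L1_le)
    also have "\<dots> \<le> B" using B[of n] by simp
    finally show "expectation (\<lambda>\<omega>. \<bar>numerator n \<omega>\<bar>) \<le> B" .
  qed
qed

lemma kernel_estimator_clt:
  "weak_conv_m
     (\<lambda>n. distr M borel
        (\<lambda>\<omega>. sqrt (real (card (vertices n)) * bandwidth \<gamma> n ^ (3 * DIM('a)))
              * (P_hat K0 X (vertices n) (bandwidth \<gamma> n) x x0 x1 \<omega> - p x x0 x1)))
     (centered_gaussian (L2norm K0 ^ 6 * p x x0 x1 / mu x))"
proof -
  let ?v = "L2norm K0 ^ 6 * p x x0 x1 / mu x"
  define Y where "Y n \<omega> = sqrt (a n) * (P_hat K0 X (vertices n) (bandwidth \<gamma> n) x x0 x1 \<omega> - p x x0 x1)" for n \<omega>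
  have nm [measurable]: "numerator n \<in> borel_measurable M" for n
    using numerator_integrable by auto
  have um [measurable]: "muhat n \<in> borel_measurable M" for n
    using muhat_integrable by auto
  have Y_eq: "Y n \<omega> = (if muhat n \<omega> = 0 then sqrt (a n) * (0 - p x x0 x1) else numerator n \<omega> / muhat n \<omega>)" for n \<omega>
    by (simp add: Y_def P_hat_def numerator_def muhat_def[symmetric] right_diff_distrib diff_divide_distrib)
  have Ym [measurable]: "Y n \<in> borel_measurable M" for n unfolding Y_eq[abs_def] by measurable
  have quot: "Y n \<omega> = numerator n \<omega> / muhat n \<omega>" if "muhat n \<omega> \<noteq> 0" for n \<omega> using that by (simp add: Y_eq)
  obtain B where B: "\<And>n. expectation (\<lambda>\<omega>. \<bar>numerator n \<omega>\<bar>) \<le> B" by (rule numerator_L1_bounded) blast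
  have lim: "(\<lambda>n. CLINT \<omega>|M. iexp (t * Y n \<omega>)) \<longlonglongrightarrow> exp (- ((t / mu x)\<^sup>2 / 2 * \<sigma>2))" for t
    by (rule char_quotient_tendsto[where \<phi> = "\<lambda>t. complex_of_real (exp (- (t\<^sup>2 / 2 * \<sigma>2)))",
        OF Ym nm mart_measurable um quot numerator_integrable B muhat_integrable mu_x muhat_tendsto
          mart_integrable(1) numerator_mart_tendsto char_mart_tendsto])
  have v0: "0 \<le> ?v" using mu_x p_nonneg by (simp add: L2norm_def)
  have "L2norm K0 ^ 6 = ((L2norm K0)\<^sup>2) ^ 3" by (simp add: power_mult[symmetric])
  then have "\<sigma>2 = L2norm K0 ^ 6 * (mu x * p x x0 x1)"
    by (simp add: \<sigma>2_def L2norm_def mu_tri_def)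
  then have \<sigma>: "(t / mu x)\<^sup>2 / 2 * \<sigma>2 = t\<^sup>2 * ?v / 2" for t
    using mu_x by (simp add: power2_eq_square field_simps)
  have "weak_conv_m (\<lambda>n. distr M borel (Y n)) (centered_gaussian ?v)"
  proof (rule levy_continuity)
    show "real_distribution (distr M borel (Y n))" for n by (rule real_distribution_distr) measurable
    show "real_distribution (centered_gaussian ?v)" by (rule real_distribution_centered_gaussian[OF v0])
    have "char (distr M borel (Y n)) t = (CLINT \<omega>|M. iexp (t * Y n \<omega>))" for n t
      unfolding char_def by (subst integral_distr) auto
    then show "(\<lambda>n. char (distr M borel (Y n)) t) \<longlonglongrightarrow> char (centered_gaussian ?v) t" for t
      using lim[of t] unfolding char_centered_gaussian[OF v0] \<sigma> by simp
  qed
  then show ?thesis unfolding Y_def[abs_def] card_vertices a_def h_def .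
qed

end

theorem theorem4p1:
  fixes M :: "'w measure"
    and X :: "bool list \<Rightarrow> 'w \<Rightarrow> 'a::euclidean_space"
    and nu :: "'a measure"
    and p :: "'a \<Rightarrow> 'a \<Rightarrow> 'a \<Rightarrow> real"
    and mu :: "'a \<Rightarrow> real"
    and F :: "('a \<Rightarrow> real) set"
    and V :: "'a \<Rightarrow> real"
    and \<alpha> Mc \<gamma> s L :: real
    and K0 :: "'a \<Rightarrow> real"
    and A :: "nat \<Rightarrow> bool list set"
    and x x0 x1 :: 'a
  assumes kernel: "is_density_kernel p"
    and BMC: "is_BMC M X nu p"
    and mu_nonneg: "\<forall>y. 0 \<le> mu y"
    and mu_meas: "mu \<in> borel_measurable borel"
    and mu_prob: "prob_space (density lborel mu)"
    and H1: "H1 F nu p"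
    and H2: "H2 F p mu V \<alpha> Mc"
    and H4: "\<exists>C0. \<forall>y y0 y1. mu y + Q_dens p y y0 + p y y0 y1 \<le> C0"
    and H5_gamma: "0 < \<gamma>" "\<gamma> < 1 / (3 * real DIM('a))"
    and H5_alpha: "2 * \<alpha>\<^sup>2 < 2 powr (3 * real DIM('a) * \<gamma>)"
    and H5_K0: "K0 \<in> borel_measurable borel" "bounded (range K0)" "integrable lborel K0"
               "(\<integral>z. K0 z \<partial>lborel) = 1"
    and H6_s: "0 < s"
    and H6a: "holder_smooth s L (mu_tri mu p)" "holder_smooth s L mu"
    and H6b: "integrable lborel (\<lambda>z. norm z powr s * \<bar>K0 z\<bar>)" "kernel_moments s K0"
    and H6c: "1 / (2 * s + 3 * real DIM('a)) < \<gamma>"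
    and A_choice: "A = Gen \<or> A = Tree"
    and mu_x: "0 < mu x"
  shows "weak_conv_m
           (\<lambda>n. distr M borel
                  (\<lambda>\<omega>. sqrt (real (card (A n)) * bandwidth \<gamma> n ^ (3 * DIM('a)))
                        * (P_hat K0 X (A n) (bandwidth \<gamma> n) x x0 x1 \<omega> - p x x0 x1)))
           (centered_gaussian (L2norm K0 ^ 6 * p x x0 x1 / mu x))"
proof -
  obtain C0 where C0: "\<And>y y0 y1. mu y + Q_dens p y y0 + p y y0 y1 \<le> C0" using H4 by blast
  define I where "I n = (if A = Gen then {n} else {..n})" for n :: nat
  have I: "n \<in> I n" "I n \<subseteq> {..n}" for n by (simp_all add: I_def)
  interpret kernel_estimation p M X nu F mu V \<alpha> Mc C0 K0 s L \<gamma> x x0 x1 I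
    by (intro kernel_estimation.intro kernel_estimation_axioms.intro ergodic_bmc.intro
        ergodic_bmc_axioms.intro bmc.intro bmc_axioms.intro density_kernel.intro)
      (rule kernel BMC H1 H2 mu_nonneg[rule_format] mu_meas mu_prob C0 H5_gamma H5_alpha
      H5_K0 H6_s H6a H6b H6c mu_x I)+
  have "A n = vertices n" for n
  proof (cases "A = Gen")
    case True then show ?thesis by (simp add: vertices_def I_def)
  next
    case False then show ?thesis using A_choice by (simp add: vertices_def I_def Tree_eq_UN_Gen)
  qed
  then show ?thesis using kernel_estimator_clt by simp
qed

end
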